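(* Let $n\ge 2$, let $P=\{(i,j)\}_{1\le i\le j\le n}$, $A=\{(i,i)\}_{i\in[1,n]}$, let $O\subset P$ be a subset with $A\subset O$, and let $\lambda=(a_1,\dots,a_{n-1})\in\mathbb{Z}_{\ge0}^{n-1}$ be an integral dominant $\mathfrak{sl}_n$-weight. Then the vectors $f^xv_\lambda$ with $x\in\Pi_O(\lambda)\cap\mathbb{Z}^P$ form a basis in the irreducible $\mathfrak{sl}_n(\mathbb{C})$-representation $V_\lambda$ with highest weight $\lambda$.
   Context: **Poset.** Order $P$ by $(i,j)\preceq(i',j')$ iff $i\le i'$ and $j\le j'$. $\mathcal J$ is the set of order ideals (lower sets) of $(P,\prec)$, and $\mathcal J_k=\{J\in\mathcal J: |J\cap A|=k\}$. For $J\in\mathcal J$ set $M_O(J)=(J\cap O)\cup\max_\prec(J)$, where $\max_\prec$ is the set of $\prec$-maximal elements. **Permutations (pipe dreams).** For $(i,j)\in P$ let $s_{i,j}\in\mathcal S_n$ be the transposition of $i$ and $j$ ($s_{i,i}=\mathrm{id}$). For $M\subset P$ let $w_M\in\mathcal S_n$ be the product of all $s_{i,j}$ with $(i,j)\in M$, ordered first by $i$ increasing from left to right and then by $j$ increasing from left to right (products are compositions of maps, the rightmost factor acting first). For $J\in\mathcal J$ set $w^J=w_O^{-1}w_{M_O(J)}$. It is a fact that $w^J(i)\ge i$ for $J\in\mathcal J_k$ and $i\in[1,k]$, so that $(i,w^J(i))\in P$. **Polytopes.** For $k\in[1,n-1]$, $\Pi_O(\omega_k)\subset\mathbb{R}^P$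 is the convex hull of the indicator vectors $\mathbf 1_{\{(1,w^J(1)),\dots,(k,w^J(k))\}}$ over all $J\in\mathcal J_k$. For $\lambda=(a_1,\dots,a_{n-1})$, $\Pi_O(\lambda)$ is the Minkowski sum $a_1\Pi_O(\omega_1)+\dots+a_{n-1}\Pi_O(\omega_{n-1})$. (It is the image, under a unimodular transformation $\xi$ of $\mathbb{Z}^P$ satisfying $\xi(\mathbf 1_{M_O(J)})=\mathbf 1_{\{(1,w^J(1)),\dots,(k,w^J(k))\}}$ for $J\in\mathcal J_k$, of the marked chain-order polytope $\mathcal Q_O(\lambda)=\sum_k a_k\,\mathrm{conv}\{\mathbf 1_{M_O(J)}\}_{J\in\mathcal J_k}$.) **Lie theory.** $\mathbb{Z}^{n-1}$ is identified with the lattice of integral $\mathfrak{sl}_n$-weights so that the $k$th basis vector $\omega_k$ is the $k$th fundamental weight. The simple roots are $\alpha_i=2\omega_i-\omega_{i-1}-\omega_{i+1}$ (with $\omega_0=\omega_n=0$) and the positive roots are $\alpha_{i,j}=\alpha_i+\dots+\alpha_{j-1}$, $1\le i<j\le n$. $f_{i,j}\in\mathfrak{sl}_n(\mathbb{C})$ is a negative root vector of weight $-\alpha_{i,j}$. For $x\in\mathbb{Z}_{\ge0}^P$, $f^x\in\mathcal U(\mathfrak{sl}_n(\mathbb{C}))$ is the monomial $\prod_{(i,j)\in P\setminus A} f_{i,j}^{x_{i,j}}$ with factors ordered first by $i$ increasing from left to right and then by $j$ increasing from left to right. $v_\lambda$ is a chosen highest-weight vector of $V_\lambda$. *)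

theory Defs
  imports
    "HOL-Analysis.Convex"
    "HOL-Library.Function_Algebras"
    "HOL-Library.Indicator_Function"
    "HOL-Library.Set_Algebras"
    "HOL-Combinatorics.Transposition"
    "Jordan_Normal_Form.Matrix"
begin

instantiation "fun" :: (type, real_vector) real_vector
begin

definition scaleR_fun :: "real \<Rightarrow> ('a \<Rightarrow> 'b) \<Rightarrow> 'a \<Rightarrow> 'b" where
  "scaleR_fun c f = (\<lambda>x. c *\<^sub>R f x)"

instance
  by standard (simp_all add: scaleR_fun_def fun_eq_iff scaleR_add_left scaleR_add_right)

end

definition tri :: "nat \<Rightarrow> (nat \<times> nat) set" where
  "tri n = {(i, j). 1 \<le> i \<and> i \<le> j \<and> j \<le> n}"

definition diag :: "nat \<Rightarrow> (nat \<times> nat) set" where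
  "diag n = {(i, i) |i. 1 \<le> i \<and> i \<le> n}"

definition tri_le :: "nat \<times> nat \<Rightarrow> nat \<times> nat \<Rightarrow> bool" where
  "tri_le p q \<longleftrightarrow> fst p \<le> fst q \<and> snd p \<le> snd q"

definition order_ideals :: "nat \<Rightarrow> (nat \<times> nat) set set" where
  "order_ideals n = {J. J \<subseteq> tri n \<and> (\<forall>q\<in>J. \<forall>p\<in>tri n. tri_le p q \<longrightarrow> p \<in> J)}"

definition order_ideals_rank :: "nat \<Rightarrow> nat \<Rightarrow> (nat \<times> nat) set set" where
  "order_ideals_rank n k = {J \<in> order_ideals n. card (J \<inter> diag n) = k}"

definition maximal_elements :: "(nat \<times> nat) set \<Rightarrow> (nat \<times> nat) set" where
  "maximal_elements J = {p \<in> J. \<forall>q\<in>J. tri_le p q \<longrightarrow> q = p}"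

definition M_set :: "(nat \<times> nat) set \<Rightarrow> (nat \<times> nat) set \<Rightarrow> (nat \<times> nat) set" where
  "M_set S J = (J \<inter> S) \<union> maximal_elements J"

text \<open>The pairs of \<^term>\<open>tri n\<close>, sorted by the first and then by the second component.\<close>

definition tri_list :: "nat \<Rightarrow> (nat \<times> nat) list" where
  "tri_list n = [(i, j). i \<leftarrow> [1..<Suc n], j \<leftarrow> [i..<Suc n]]"

text \<open>\<open>compose_list [g\<^sub>1, \<dots>, g\<^sub>m] = g\<^sub>1 \<circ> \<dots> \<circ> g\<^sub>m\<close>: the last factor acts first.\<close>

definition compose_list :: "('a \<Rightarrow> 'a) list \<Rightarrow> 'a \<Rightarrow> 'a" where
  "compose_list gs = foldr (\<circ>) gs id"

text \<open>Permutations of \<open>{1..n}\<close> are maps on all naturals fixing everything else.\<close>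

definition w_perm :: "nat \<Rightarrow> (nat \<times> nat) set \<Rightarrow> nat \<Rightarrow> nat" where
  "w_perm n M = compose_list (map (\<lambda>(i, j). Transposition.transpose i j) (filter (\<lambda>p. p \<in> M) (tri_list n)))"

definition w_ideal :: "nat \<Rightarrow> (nat \<times> nat) set \<Rightarrow> (nat \<times> nat) set \<Rightarrow> nat \<Rightarrow> nat" where
  "w_ideal n S J = inv_into UNIV (w_perm n S) \<circ> w_perm n (M_set S J)"

definition pipe_vertex ::
  "nat \<Rightarrow> (nat \<times> nat) set \<Rightarrow> nat \<Rightarrow> (nat \<times> nat) set \<Rightarrow> nat \<times> nat \<Rightarrow> real" where
  "pipe_vertex n S k J = indicator ((\<lambda>i. (i, w_ideal n S J i)) ` {1..k})"

text \<open>Vectors in \<open>\<real>\<^sup>P\<close> with \<open>P = tri n\<close> are functions vanishing outside \<open>P\<close>;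
  this holds automatically in the polytopes below, since it holds for the vertices.\<close>

definition pipe_polytope_fund ::
  "nat \<Rightarrow> (nat \<times> nat) set \<Rightarrow> nat \<Rightarrow> (nat \<times> nat \<Rightarrow> real) set" where
  "pipe_polytope_fund n S k = convex hull (pipe_vertex n S k ` order_ideals_rank n k)"

text \<open>The outer sum is the Minkowski sum of sets.\<close>

definition pipe_polytope ::
  "nat \<Rightarrow> (nat \<times> nat) set \<Rightarrow> (nat \<Rightarrow> int) \<Rightarrow> (nat \<times> nat \<Rightarrow> real) set" where
  "pipe_polytope n S a =
     (\<Sum>k\<in>{1..<n}. (\<lambda>x. real_of_int (a k) *\<^sub>R x) ` pipe_polytope_fund n S k)"

text \<open>Lattice points of the polytope for a dominant weight are thus valid exponents of monomials.\<close>

lemma pipe_polytope_nonneg: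
  assumes "x \<in> pipe_polytope n S a" and "\<And>k. k \<in> {1..<n} \<Longrightarrow> 0 \<le> a k"
  shows "0 \<le> x p"
proof -
  have fund: "0 \<le> y p" if "y \<in> pipe_polytope_fund n S k" for y k
  proof -
    have "convex {y :: nat \<times> nat \<Rightarrow> real. 0 \<le> y p}"
      by (auto simp: convex_def scaleR_fun_def)
    then have "pipe_polytope_fund n S k \<subseteq> {y. 0 \<le> y p}"
      unfolding pipe_polytope_fund_def
      by (intro hull_minimal) (auto simp: pipe_vertex_def)
    with that show ?thesis by auto
  qed
  have "0 \<le> x p" if "finite K" "K \<subseteq> {1..<n}"
    "x \<in> (\<Sum>k\<in>K. (\<lambda>x. real_of_int (a k) *\<^sub>R x) ` pipe_polytope_fund n S k)" for K x
    using that
  proof (induction K arbitrary: x rule: finite_induct)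
    case empty
    then show ?case by simp
  next
    case (insert k K)
    from insert.prems insert.hyps obtain y z where
      yz: "x = real_of_int (a k) *\<^sub>R y + z" "y \<in> pipe_polytope_fund n S k"
        "z \<in> (\<Sum>k\<in>K. (\<lambda>x. real_of_int (a k) *\<^sub>R x) ` pipe_polytope_fund n S k)"
      by (auto elim!: set_plus_elim)
    have "0 \<le> a k" using assms(2) insert.prems by simp
    moreover have "0 \<le> z p" using insert yz by auto
    ultimately show ?case using fund[OF yz(2)] yz(1) by (simp add: scaleR_fun_def)
  qed
  from this[of "{1..<n}" x] assms(1) show ?thesis
    by (simp add: pipe_polytope_def)
qed

definition lattice_points :: "('a \<Rightarrow> real) set \<Rightarrow> ('a \<Rightarrow> int) set" where
  "lattice_points Q = {x. (\<lambda>p. real_of_int (x p)) \<in> Q}"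

text \<open>Matrix entries are indexed from 0, whereas indices of weights, roots and of the poset
  start at 1.\<close>

definition sl :: "nat \<Rightarrow> complex mat set" where
  "sl n = {X \<in> carrier_mat n n. (\<Sum>i<n. X $$ (i, i)) = 0}"

definition lie_bracket :: "complex mat \<Rightarrow> complex mat \<Rightarrow> complex mat" where
  "lie_bracket X Y = X * Y - Y * X"

definition cartan :: "nat \<Rightarrow> complex mat set" where
  "cartan n = {h \<in> sl n. diagonal_mat h}"

text \<open>An integral weight is given by its coordinates at \<open>1, \<dots>, n - 1\<close> in the basis of
  fundamental weights; the \<open>k\<close>th fundamental weight sends a diagonal matrix to the sum of its
  first \<open>k\<close> diagonal entries.\<close>

definition weight_eval :: "nat \<Rightarrow> (nat \<Rightarrow> int) \<Rightarrow> complex mat \<Rightarrow> complex" where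
  "weight_eval n \<mu> h = (\<Sum>k\<in>{1..<n}. of_int (\<mu> k) * (\<Sum>i<k. h $$ (i, i)))"

text \<open>By convention \<open>fund_weight n 0 = fund_weight n n = 0\<close>.\<close>

definition fund_weight :: "nat \<Rightarrow> nat \<Rightarrow> nat \<Rightarrow> int" where
  "fund_weight n k = (\<lambda>l. if l = k \<and> 1 \<le> k \<and> k < n then 1 else 0)"

lemma weight_eval_fund_weight:
  assumes "k \<in> {1..<n}"
  shows "weight_eval n (fund_weight n k) h = (\<Sum>i<k. h $$ (i, i))"
proof -
  have "weight_eval n (fund_weight n k) h
      = (\<Sum>l\<in>{1..<n}. if l = k then (\<Sum>i<k. h $$ (i, i)) else 0)"
    unfolding weight_eval_def using assms by (intro sum.cong) (auto simp: fund_weight_def)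
  then show ?thesis using assms by simp
qed

definition simple_root :: "nat \<Rightarrow> nat \<Rightarrow> nat \<Rightarrow> int" where
  "simple_root n i = (\<lambda>l. 2 * fund_weight n i l - fund_weight n (i - 1) l - fund_weight n (i + 1) l)"

definition pos_root :: "nat \<Rightarrow> nat \<Rightarrow> nat \<Rightarrow> nat \<Rightarrow> int" where
  "pos_root n i j = (\<Sum>m\<in>{i..<j}. simple_root n m)"

definition root_vector :: "nat \<Rightarrow> (nat \<Rightarrow> int) \<Rightarrow> complex mat \<Rightarrow> bool" where
  "root_vector n \<mu> X \<longleftrightarrow> X \<in> sl n \<and> X \<noteq> 0\<^sub>m n n \<and>
     (\<forall>h\<in>cartan n. lie_bracket h X = weight_eval n \<mu> h \<cdot>\<^sub>m X)"

locale sl_representation = vector_space smul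
  for smul :: "complex \<Rightarrow> 'v::ab_group_add \<Rightarrow> 'v" +
  fixes n :: nat and act :: "complex mat \<Rightarrow> 'v \<Rightarrow> 'v"
  assumes act_linear: "X \<in> sl n \<Longrightarrow> Vector_Spaces.linear smul smul (act X)"
    and act_add: "X \<in> sl n \<Longrightarrow> Y \<in> sl n \<Longrightarrow> act (X + Y) v = act X v + act Y v"
    and act_smult: "X \<in> sl n \<Longrightarrow> act (c \<cdot>\<^sub>m X) v = smul c (act X v)"
    and act_bracket: "X \<in> sl n \<Longrightarrow> Y \<in> sl n \<Longrightarrow>
      act (lie_bracket X Y) v = act X (act Y v) - act Y (act X v)"

locale irreducible_sl_representation = sl_representation smul n act
  for smul :: "complex \<Rightarrow> 'v::ab_group_add \<Rightarrow> 'v"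
    and n :: nat and act :: "complex mat \<Rightarrow> 'v \<Rightarrow> 'v" +
  assumes nonzero: "\<exists>v :: 'v. v \<noteq> 0"
    and no_invariant_subspace:
      "subspace W \<Longrightarrow> (\<And>X w. X \<in> sl n \<Longrightarrow> w \<in> W \<Longrightarrow> act X w \<in> W) \<Longrightarrow> W = {0} \<or> W = UNIV"

definition highest_weight_vector ::
  "(complex \<Rightarrow> 'v \<Rightarrow> 'v) \<Rightarrow> nat \<Rightarrow> (complex mat \<Rightarrow> 'v \<Rightarrow> 'v) \<Rightarrow> (nat \<Rightarrow> int) \<Rightarrow>
    'v::ab_group_add \<Rightarrow> bool" where
  "highest_weight_vector smul n act \<mu> v \<longleftrightarrow> v \<noteq> 0 \<and>
     (\<forall>h\<in>cartan n. act h v = smul (weight_eval n \<mu> h) v) \<and>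
     (\<forall>i j e. 1 \<le> i \<and> i < j \<and> j \<le> n \<and> root_vector n (pos_root n i j) e \<longrightarrow> act e v = 0)"

text \<open>The action of the monomial \<open>f\<^sup>x\<close> in the universal enveloping algebra is the composition of
  the actions of its factors. Exponents are assumed nonnegative,
  so that \<^const>\<open>nat\<close> does not truncate.\<close>

definition monomial_action ::
  "nat \<Rightarrow> (complex mat \<Rightarrow> 'v \<Rightarrow> 'v) \<Rightarrow> (nat \<Rightarrow> nat \<Rightarrow> complex mat) \<Rightarrow> (nat \<times> nat \<Rightarrow> int) \<Rightarrow>
    'v \<Rightarrow> 'v" where
  "monomial_action n act f x =
     compose_list (map (\<lambda>(i, j). act (f i j) ^^ nat (x (i, j)))
       (filter (\<lambda>p. p \<in> tri n - diag n) (tri_list n)))"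

end

theory Submission
  imports Defs "HOL-Combinatorics.Permutations"
begin

text \<open>
  Let \<open>c\<^sub>i\<close> be the product of the transpositions \<open>(i j)\<close> with \<open>(i, j) \<in> S\<close>. The permutation
  \<open>c\<^sub>i \<dots> c\<^sub>n\<close> maps \<open>w\<^sup>J(i)\<close> to the largest \<open>q\<close> with \<open>(i, q)\<close> in \<open>M_set S J\<close>, and it maps \<open>w\<^sup>J(i')\<close>
  with \<open>i' < i\<close> either above this \<open>q\<close> or below \<open>i\<close>. The first fact makes the vertices of the polytope
  coordinate permutations, row by row, of simple 0-1 vectors. A piecewise linear transfer map then
  identifies its lattice points with the Gelfand-Tsetlin patterns for \<open>a\<close>, a pattern being a chain of
  order ideals. The second fact makes the graph of \<open>w\<^sup>J\<close> the unique minimum of a linear weight among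
  the terms of the minor with rows \<open>w\<^sup>J(1), \<dots>, w\<^sup>J(k)\<close> and columns \<open>1, \<dots>, k\<close> of a unitriangular matrix.

  The module is realized in a tensor power of \<open>\<complex>\<^sup>n\<close>, where the coordinates of \<open>f\<^sup>x v\<close> are coefficients of
  products of such minors. By the minimum property these coordinates form a triangular matrix, so the
  vectors are independent. By the Garnir relations an element of the module is determined by its
  coordinates at semistandard tableaux, which inject into the patterns, so the vectors span. That an
  abstract irreducible module agrees with the tensor one is seen from the submodule of the direct sum
  generated by the pair of highest weight vectors: it is the graph of an isomorphism, by irreducibility
  on one side and by positivity of the invariant Hermitian form on the other.
\<close>

text \<open>The products w_S and w_M behind w^J differ only through maximal elements of J, and these
  do not affect how the rows above move a point that is still inside J. The factors before row i
  therefore cancel in the inverse of w_S times w_M, evaluated at i. This is why the tail c_i ... c_n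
  appears, a different one for each row. A lattice point of a Minkowski sum need not be a sum of
  lattice points of the summands. Here the decomposition is found through the pattern: integrality
  passes to the pattern, whose level sets are the ideals of the vertices to be added. The number of
  vectors is pinned down by a chain of inequalities. Independence supplies one vector per pattern,
  straightening leaves at most one free coordinate per semistandard tableau, and tableaux inject
  into patterns. The abstract module comes without finiteness or a weight decomposition. A single
  diagonal matrix takes over the role of the weights: its eigenvalue drops under every lowering
  matrix unit, which keeps the highest weight vector out of the span of its proper
  lowerings.\<close>

lemma compose_list_append: "compose_list (xs @ ys) = compose_list xs \<circ> compose_list ys"
  by (induction xs) (auto simp: compose_list_def)

lemma compose_list_simps [simp]:
  "compose_list [] = id"
  "compose_list (g # gs) = g \<circ> compose_list gs"
  by (auto simp: compose_list_def)

lemma compose_list_concat: "compose_list (concat xss) = compose_list (map compose_list xss)"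
  by (induction xss) (auto simp: compose_list_append)

subsection \<open>The permutations of order ideals\<close>

text \<open>If i < j1 < ... < jm are the columns beyond the diagonal, up to n, of the members of T
  in row i, this is the cycle i -> jm -> ... -> j1 -> i, because the last transposition acts first.
  A diagonal member contributes the identity.\<close>

definition row_cycle :: "nat \<Rightarrow> (nat \<times> nat) set \<Rightarrow> nat \<Rightarrow> nat \<Rightarrow> nat" where
  "row_cycle n T i =
     compose_list (map (Transposition.transpose i) (filter (\<lambda>j. (i, j) \<in> T) [i..<Suc n]))"

definition tail_perm :: "nat \<Rightarrow> (nat \<times> nat) set \<Rightarrow> nat \<Rightarrow> nat \<Rightarrow> nat" where
  "tail_perm n T i = compose_list (map (row_cycle n T) [i..<Suc n])"

definition head_perm :: "nat \<Rightarrow> (nat \<times> nat) set \<Rightarrow> nat \<Rightarrow> nat \<Rightarrow> nat" where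
  "head_perm n T i = compose_list (map (row_cycle n T) [1..<i])"

lemma w_perm_eq_tail_perm: "w_perm n T = tail_perm n T 1"
proof -
  have "filter (\<lambda>p. p \<in> T) (tri_list n)
      = concat (map (\<lambda>i. map (Pair i) (filter (\<lambda>j. (i, j) \<in> T) [i..<Suc n])) [1..<Suc n])"
    by (simp add: tri_list_def filter_concat comp_def filter_map del: upt_Suc)
  then show ?thesis
    by (simp add: w_perm_def tail_perm_def row_cycle_def[abs_def] map_concat compose_list_concat
        comp_def del: upt_Suc)
qed

lemma w_perm_split:
  assumes "1 \<le> i" "i \<le> Suc n"
  shows "w_perm n T = head_perm n T i \<circ> tail_perm n T i"
proof -
  have "[1..<Suc n] = [1..<i] @ [i..<Suc n]"
    using assms by (metis le_add_diff_inverse upt_add_eq_append)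
  then show ?thesis
    by (simp add: w_perm_eq_tail_perm tail_perm_def head_perm_def compose_list_append del: upt_Suc)
qed

lemma tail_perm_Suc:
  assumes "i \<le> n"
  shows "tail_perm n T i = row_cycle n T i \<circ> tail_perm n T (Suc i)"
  using assms by (simp add: tail_perm_def upt_conv_Cons del: upt_Suc)

lemma head_perm_Suc:
  assumes "1 \<le> i"
  shows "head_perm n T (Suc i) = head_perm n T i \<circ> row_cycle n T i"
  using assms by (simp add: head_perm_def compose_list_append)

lemma permutes_compose_list:
  assumes "\<And>g. g \<in> set gs \<Longrightarrow> g permutes A"
  shows "compose_list gs permutes A"
  using assms by (induction gs) (auto intro: permutes_compose permutes_id)

lemma row_cycle_permutes:
  assumes "i \<le> n"
  shows "row_cycle n T i permutes {i..n}"
  unfolding row_cycle_def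
  by (rule permutes_compose_list) (use assms in \<open>auto simp del: upt_Suc intro!: permutes_swap_id\<close>)

lemma tail_perm_permutes: "tail_perm n T i permutes {i..n}"
  unfolding tail_perm_def
proof (rule permutes_compose_list)
  fix g assume "g \<in> set (map (row_cycle n T) [i..<Suc n])"
  then obtain l where "g = row_cycle n T l" "i \<le> l" "l \<le> n" by auto
  then show "g permutes {i..n}"
    using row_cycle_permutes[of l n T] by (auto intro: permutes_subset)
qed

lemma inj_head_perm:
  assumes "i \<le> Suc n"
  shows "inj (head_perm n T i)"
proof -
  have "head_perm n T i permutes {0..n}"
    unfolding head_perm_def
  proof (rule permutes_compose_list)
    fix g assume "g \<in> set (map (row_cycle n T) [1..<i])"
    then obtain l where "g = row_cycle n T l" "l \<le> n" using assms by auto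
    then show "g permutes {0..n}"
      using row_cycle_permutes[of l n T] by (auto intro: permutes_subset)
  qed
  then show ?thesis by (rule permutes_inj)
qed

section \<open>The cycle of a single row\<close>

lemma row_cycle_Suc:
  assumes "i \<le> n"
  shows "row_cycle (Suc n) T i =
    (if (i, Suc n) \<in> T then row_cycle n T i \<circ> Transposition.transpose i (Suc n) else row_cycle n T i)"
  using assms by (simp add: row_cycle_def compose_list_append comp_assoc)

lemma row_cycle_same [simp]: "row_cycle i T i = id"
  by (auto simp: row_cycle_def)

lemma row_cycle_other:
  assumes "i \<le> n" "(i, q) \<notin> T" "q \<noteq> i"
  shows "row_cycle n T i q = q"
  using assms
proof (induction n rule: dec_induct)
  case base then show ?case by simp
next
  case (step m) then show ?case by (auto simp: row_cycle_Suc Transposition.transpose_def)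
qed

lemma row_cycle_outside:
  assumes "i \<le> n" "q < i \<or> n < q"
  shows "row_cycle n T i q = q"
  using permutes_not_in[OF row_cycle_permutes[OF assms(1)]] assms(2) by auto

lemma row_cycle_first:
  assumes "i \<le> n"
  shows "row_cycle n T i i \<in> {i..n} \<and> (row_cycle n T i i = i \<or> (i, row_cycle n T i i) \<in> T) \<and>
    (\<forall>j\<in>{i..n}. (i, j) \<in> T \<longrightarrow> j \<le> row_cycle n T i i)"
  using assms
proof (induction n rule: dec_induct)
  case base then show ?case by simp
next
  case (step m)
  then show ?case
    by (auto simp: row_cycle_Suc row_cycle_outside le_Suc_eq)
qed

lemma row_cycle_pred:
  assumes "i < q" "q \<le> n" "(i, q) \<in> T"
  shows "row_cycle n T i q \<in> {i..<q} \<and> (row_cycle n T i q = i \<or> (i, row_cycle n T i q) \<in> T) \<and>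
    (\<forall>j\<in>{i..<q}. (i, j) \<in> T \<longrightarrow> j \<le> row_cycle n T i q)"
proof -
  have "i \<le> n" using assms by simp
  then show ?thesis using assms
  proof (induction n rule: dec_induct)
    case base then show ?case by simp
  next
    case (step m)
    show ?case
    proof (cases "q = Suc m")
      case True
      then show ?thesis using step row_cycle_first[of i m T] by (auto simp: row_cycle_Suc)
    next
      case False
      then show ?thesis using step by (auto simp: row_cycle_Suc Transposition.transpose_def)
    qed
  qed
qed

lemma row_cycle_le:
  assumes "i \<le> n" "q \<noteq> i"
  shows "row_cycle n T i q \<le> q"
proof (cases "i < q \<and> q \<le> n \<and> (i, q) \<in> T")
  case True then show ?thesis using row_cycle_pred[of i q n T] by auto
next
  case False
  then have "row_cycle n T i q = q"
    using row_cycle_other[of i n q T] row_cycle_outside[of i n q T] assms by (cases "q < i \<or> n < q") auto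
  then show ?thesis by simp
qed

section \<open>Order ideals and their row maxima\<close>

lemma order_idealsD:
  assumes "J \<in> order_ideals n" "(i, j) \<in> J"
  shows "1 \<le> i" "i \<le> j" "j \<le> n"
    and "\<And>i' j'. 1 \<le> i' \<Longrightarrow> i' \<le> j' \<Longrightarrow> i' \<le> i \<Longrightarrow> j' \<le> j \<Longrightarrow> (i', j') \<in> J"
  using assms by (auto simp: order_ideals_def tri_def tri_le_def Ball_def)

lemma M_setD: "p \<in> M_set S J \<Longrightarrow> p \<in> J"
  by (auto simp: M_set_def maximal_elements_def)

lemma M_set_new:
  assumes "(i, j) \<in> M_set S J" "(i, j) \<notin> S" "(i', j') \<in> J" "i \<le> i'" "j \<le> j'"
  shows "i' = i \<and> j' = j"
  using assms by (auto simp: M_set_def maximal_elements_def tri_le_def Ball_def)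

lemma M_set_I: "p \<in> J \<Longrightarrow> p \<in> S \<Longrightarrow> p \<in> M_set S J"
  by (auto simp: M_set_def)

abbreviation row_max :: "nat \<Rightarrow> (nat \<times> nat) set \<Rightarrow> (nat \<times> nat) set \<Rightarrow> nat \<Rightarrow> nat" where
  "row_max n S J i \<equiv> row_cycle n (M_set S J) i i"

lemma row_max_range:
  assumes "J \<in> order_ideals n" "(i, i) \<in> J"
  shows "i \<le> row_max n S J i" "row_max n S J i \<le> n" "(i, row_max n S J i) \<in> J"
    "row_max n S J i = i \<or> (i, row_max n S J i) \<in> M_set S J"
  using row_cycle_first[of i n "M_set S J"] order_idealsD[OF assms] assms(2)
  by (auto dest: M_setD)

text \<open>Together with \<open>row_max_eq_iff\<close> this is the origin of the two clauses of
  \<open>patt\<close>: the row maximum decides membership in J at a cell of \<open>S\<close>, but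
  only maximality in J at a cell outside \<open>S\<close>.\<close>

lemma row_max_ge_iff:
  assumes "J \<in> order_ideals n" "(i, i) \<in> J" "(i, q) \<in> S" "i \<le> q" "q \<le> n"
  shows "q \<le> row_max n S J i \<longleftrightarrow> (i, q) \<in> J"
proof
  assume "q \<le> row_max n S J i"
  then show "(i, q) \<in> J"
    using order_idealsD(4)[OF assms(1) row_max_range(3)[OF assms(1,2), of S], of i q]
      order_idealsD(1)[OF assms(1,2)] assms(4) by simp
next
  assume "(i, q) \<in> J"
  then show "q \<le> row_max n S J i"
    using row_cycle_first[of i n "M_set S J"] assms by (auto intro: M_set_I)
qed

lemma row_max_eq_iff:
  assumes "J \<in> order_ideals n" "(i, i) \<in> J" "(i, q) \<notin> S" "i < q" "q \<le> n"
  shows "row_max n S J i = q \<longleftrightarrow> (i, q) \<in> maximal_elements J"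
proof
  assume "row_max n S J i = q"
  then show "(i, q) \<in> maximal_elements J"
    using row_max_range(4)[OF assms(1,2), of S] assms by (auto simp: M_set_def)
next
  assume q: "(i, q) \<in> maximal_elements J"
  then have "q \<le> row_max n S J i"
    using row_cycle_first[of i n "M_set S J"] assms by (auto simp: M_set_def)
  moreover have "row_max n S J i = q" if "q \<le> row_max n S J i"
    using q that row_max_range(3)[OF assms(1,2), of S]
    by (auto simp: maximal_elements_def tri_le_def)
  ultimately show "row_max n S J i = q" by simp
qed

text \<open>The cells of row l up to column p lie in J and strictly below (Suc l, p), so none of
  them is maximal and \<open>M_set\<close> agrees with \<open>S\<close> there. The image of p under
  the cycle depends on no column beyond p.\<close>

lemma row_cycle_M_set_eq:
  assumes J: "J \<in> order_ideals n" and l: "1 \<le> l" "l < p" and p: "(Suc l, p) \<in> J"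
  shows "row_cycle n (M_set S J) l p = row_cycle n S l p"
proof -
  have n: "p \<le> n" "l \<le> n" and Jp: "(l, p) \<in> J"
    using order_idealsD[OF J p] l by auto
  have iff: "(l, q) \<in> M_set S J \<longleftrightarrow> (l, q) \<in> S" if "l \<le> q" "q \<le> p" for q
  proof
    assume q: "(l, q) \<in> M_set S J"
    then show "(l, q) \<in> S" using M_set_new[OF q _ p] that by auto
  next
    assume "(l, q) \<in> S"
    then show "(l, q) \<in> M_set S J"
      using order_idealsD(4)[OF J Jp, of l q] that l by (auto intro: M_set_I)
  qed
  show ?thesis
  proof (cases "(l, p) \<in> S")
    case True
    then have M: "(l, p) \<in> M_set S J" using iff l by auto
    show ?thesis
      using row_cycle_pred[OF l(2) n(1) M] row_cycle_pred[OF l(2) n(1) True] iff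
      by (smt (verit) atLeastLessThan_iff le_antisym nless_le)
  next
    case False
    then have M: "(l, p) \<notin> M_set S J" using iff l by auto
    show ?thesis
      using row_cycle_other[OF n(2) M] row_cycle_other[OF n(2) False] l by simp
  qed
qed

text \<open>On its way up through the rows the point only moves left, so paired with the current row
  it stays in J and the previous lemma applies in every row above.\<close>

lemma head_perm_M_set_eq:
  assumes J: "J \<in> order_ideals n" and "1 \<le> i" "i \<le> p" "(i, p) \<in> J"
  shows "head_perm n (M_set S J) i p = head_perm n S i p"
  using assms(2-)
proof (induction i arbitrary: p rule: nat_induct_at_least)
  case base
  then show ?case by (simp add: head_perm_def)
next
  case (Suc l)
  have l: "l < p" "p \<le> n" using Suc.prems order_idealsD[OF J, of "Suc l" p] by auto
  define p' where "p' = row_cycle n S l p"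
  have p': "l \<le> p'" "p' \<le> p"
    using row_cycle_le[of l n p S] permutes_in_image[OF row_cycle_permutes[of l n S], of p] l
    by (auto simp: p'_def)
  then have "(l, p') \<in> J"
    using order_idealsD(4)[OF J Suc.prems(2), of l p'] Suc.hyps by auto
  with Suc.IH[of p'] p' have "head_perm n (M_set S J) l p' = head_perm n S l p'" by simp
  then show ?case
    using row_cycle_M_set_eq[OF J Suc.hyps l(1) Suc.prems(2), of S] Suc.hyps
    by (simp add: head_perm_Suc p'_def)
qed

text \<open>The cycles after row i fix i, so the permutation of \<open>M_set\<close> sends i to the
  head applied to the row maximum. There the heads of \<open>M_set\<close> and \<open>S\<close>
  agree, and the common injective head cancels.\<close>

lemma tail_perm_w_ideal:
  assumes J: "J \<in> order_ideals n" and i: "(i, i) \<in> J"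
  shows "tail_perm n S i (w_ideal n S J i) = row_max n S J i"
proof -
  let ?M = "M_set S J"
  have n: "1 \<le> i" "i \<le> n" using order_idealsD[OF J i] by auto
  have "tail_perm n ?M i i = row_max n S J i"
    using tail_perm_Suc[OF n(2), of ?M] permutes_not_in[OF tail_perm_permutes[of n ?M "Suc i"], of i]
    by simp
  then have "w_perm n ?M i = head_perm n ?M i (row_max n S J i)"
    using w_perm_split[of i n ?M] n by simp
  also have "\<dots> = head_perm n S i (row_max n S J i)"
    by (rule head_perm_M_set_eq[OF J n(1)]) (use row_max_range[OF J i, of S] in auto)
  finally have 1: "w_perm n ?M i = head_perm n S i (row_max n S J i)" .
  have "bij (w_perm n S)"
    unfolding w_perm_eq_tail_perm by (rule permutes_bij[OF tail_perm_permutes])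
  then have "w_perm n S (w_ideal n S J i) = w_perm n ?M i"
    by (simp add: w_ideal_def bij_is_surj surj_f_inv_f)
  then have "head_perm n S i (tail_perm n S i (w_ideal n S J i)) = head_perm n S i (row_max n S J i)"
    using 1 w_perm_split[of i n S] n by simp
  then show ?thesis using inj_head_perm[of i n S] n by (simp add: inj_eq)
qed

lemma w_ideal_range:
  assumes J: "J \<in> order_ideals n" and i: "(i, i) \<in> J"
  shows "w_ideal n S J i \<in> {i..n}"
  using permutes_in_image[OF tail_perm_permutes[of n S i], of "w_ideal n S J i"]
    tail_perm_w_ideal[OF J i, of S] row_max_range[OF J i, of S] by auto

text \<open>If (Suc i, p) were in J, then (i, p) would be a nonmaximal member of J. For (i, p) in
  \<open>S\<close> the cycle sends p strictly to the left of p, which is at most the row maximum;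
  otherwise it fixes p, though outside \<open>S\<close> only a maximal element can be the row
  maximum. Both contradict \<open>tail_perm_w_ideal\<close>. Later rows inherit the property since
  their cycles move such points only to the left.\<close>

lemma tail_perm_w_ideal_not_in:
  assumes J: "J \<in> order_ideals n" and i: "(i, i) \<in> J" and l: "i \<le> l" "l \<le> n"
  shows "tail_perm n S (Suc l) (w_ideal n S J i) \<le> l \<or>
    (Suc l, tail_perm n S (Suc l) (w_ideal n S J i)) \<notin> J"
  using l
proof (induction l rule: dec_induct)
  case base
  define p where "p = tail_perm n S (Suc i) (w_ideal n S J i)"
  have cp: "row_cycle n S i p = row_max n S J i"
    using tail_perm_w_ideal[OF J i, of S] tail_perm_Suc[of i n S] base by (simp add: p_def)
  show ?case unfolding p_def[symmetric]
  proof (rule ccontr)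
    assume "\<not> (p \<le> i \<or> (Suc i, p) \<notin> J)"
    then have p: "i < p" "(Suc i, p) \<in> J" by auto
    have i1: "1 \<le> i" "p \<le> n" using order_idealsD[OF J i] order_idealsD[OF J p(2)] by auto
    show False
    proof (cases "(i, p) \<in> S")
      case True
      have "(i, p) \<in> J" using order_idealsD(4)[OF J p(2), of i p] p i1 by auto
      with row_max_ge_iff[OF J i True] p i1 have "p \<le> row_max n S J i" by simp
      then show False using row_cycle_pred[OF p(1) i1(2) True] cp by auto
    next
      case False
      then have "row_max n S J i = p" using row_cycle_other[of i n p S] p cp base by simp
      with row_max_eq_iff[OF J i False p(1) i1(2)] have "(i, p) \<in> maximal_elements J" by simp
      with p show False by (auto simp: maximal_elements_def tri_le_def)
    qed
  qed
next
  case (step l)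
  define p where "p = tail_perm n S (Suc (Suc l)) (w_ideal n S J i)"
  have eq: "tail_perm n S (Suc l) (w_ideal n S J i) = row_cycle n S (Suc l) p"
    using tail_perm_Suc[of "Suc l" n S] step by (simp add: p_def)
  have *: "row_cycle n S (Suc l) p \<le> l \<or> (Suc l, row_cycle n S (Suc l) p) \<notin> J"
    using step eq by simp
  show ?case unfolding p_def[symmetric]
  proof (rule ccontr)
    assume "\<not> (p \<le> Suc l \<or> (Suc (Suc l), p) \<notin> J)"
    then have p: "Suc l < p" "(Suc (Suc l), p) \<in> J" by auto
    have "row_cycle n S (Suc l) p \<le> p" using row_cycle_le[of "Suc l" n p S] p step by auto
    moreover have "Suc l \<le> row_cycle n S (Suc l) p"
      using permutes_in_image[OF row_cycle_permutes[of "Suc l" n S], of p] p step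
        order_idealsD[OF J p(2)] by auto
    ultimately show False
      using * order_idealsD(4)[OF J p(2), of "Suc l" "row_cycle n S (Suc l) p"] by auto
  qed
qed

text \<open>Row i of J contains every column from i to the row maximum, so a column from i on that
  is missing from it lies beyond the maximum.\<close>

lemma tail_perm_w_ideal_greater:
  assumes J: "J \<in> order_ideals n" and i: "(i, i) \<in> J" and i': "(i', i') \<in> J" "i' < i"
    and ge: "i \<le> tail_perm n S i (w_ideal n S J i')"
  shows "row_max n S J i < tail_perm n S i (w_ideal n S J i')"
proof -
  have n: "1 \<le> i" "i \<le> n" using order_idealsD[OF J i] by auto
  have "(i, tail_perm n S i (w_ideal n S J i')) \<notin> J"
    using tail_perm_w_ideal_not_in[OF J i'(1), of "i - 1" S] i' ge n by force
  then show ?thesis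
    using order_idealsD(4)[OF J row_max_range(3)[OF J i, of S], of i] n ge
    by (meson not_le order_refl)
qed

subsection \<open>Lattice points and patterns\<close>

text \<open>In these row coordinates a vertex is the indicator of the points \<open>(i, row_max n S J i)\<close>.\<close>

definition coord :: "nat \<Rightarrow> (nat \<times> nat) set \<Rightarrow> (nat \<times> nat \<Rightarrow> real) \<Rightarrow> nat \<Rightarrow> nat \<Rightarrow> real" where
  "coord n S X i q = X (i, inv_into UNIV (tail_perm n S i) q)"

text \<open>For a nested family of ideals, \<open>coord\<close> counts those with a given row
  maximum and \<open>patt\<close> those containing (i, q). At \<open>S\<close>, containing (i, q)
  means a row maximum of at least q. Elsewhere, either (i, q) is maximal in the ideal or one of its
  two upper neighbours belongs to it, and for nested ideals the latter are counted by a maximum.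
  This is an analogue of the transfer map between chain and order polytopes.\<close>

function patt :: "nat \<Rightarrow> (nat \<times> nat) set \<Rightarrow> (nat \<times> nat \<Rightarrow> real) \<Rightarrow> nat \<Rightarrow> nat \<Rightarrow> real" where
  "patt n S X i q =
    (if n < q \<or> q < i then 0
     else if (i, q) \<in> S then \<Sum>q'\<in>{q..n}. coord n S X i q'
     else coord n S X i q + max (patt n S X i (Suc q)) (patt n S X (Suc i) q))"
  by auto
termination
  by (relation "measure (\<lambda>(n, S, X, i, q). (Suc n - q) + (Suc n - i))") auto

declare patt.simps [simp del]

lemma coord_scale: "coord n S (c *\<^sub>R X) i q = c * coord n S X i q"
  by (simp add: coord_def scaleR_fun_def)

lemma patt_outside: "n < q \<or> q < i \<Longrightarrow> patt n S X i q = 0"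
  by (subst patt.simps) auto

lemma patt_in: "i \<le> q \<Longrightarrow> q \<le> n \<Longrightarrow> (i, q) \<in> S \<Longrightarrow> patt n S X i q = (\<Sum>q'\<in>{q..n}. coord n S X i q')"
  by (subst patt.simps) auto

lemma patt_not_in: "i \<le> q \<Longrightarrow> q \<le> n \<Longrightarrow> (i, q) \<notin> S \<Longrightarrow>
    patt n S X i q = coord n S X i q + max (patt n S X i (Suc q)) (patt n S X (Suc i) q)"
  by (subst patt.simps) auto

lemma patt_induct [case_names outside in_S not_in_S]:
  assumes "\<And>i q. n < q \<or> q < i \<Longrightarrow> P i q"
    and "\<And>i q. i \<le> q \<Longrightarrow> q \<le> n \<Longrightarrow> (i, q) \<in> S \<Longrightarrow> P i q"
    and "\<And>i q. i \<le> q \<Longrightarrow> q \<le> n \<Longrightarrow> (i, q) \<notin> S \<Longrightarrow> P i (Suc q) \<Longrightarrow> P (Suc i) q \<Longrightarrow> P i q"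
  shows "P i q"
proof (induction "(Suc n - q) + (Suc n - i)" arbitrary: i q rule: less_induct)
  case less
  show ?case
  proof (cases "n < q \<or> q < i")
    case False
    then have "P i (Suc q)" by (intro less) linarith
    moreover have "P (Suc i) q" using False by (intro less) linarith
    ultimately show ?thesis using assms(2,3)[of i q] False by (cases "(i, q) \<in> S") (simp_all add: not_less)
  qed (rule assms(1))
qed

lemma patt_subadd: "patt n S (X + Y) i q \<le> patt n S X i q + patt n S Y i q"
  by (induction i q rule: patt_induct[of n _ S])
    (simp_all add: patt_outside patt_in patt_not_in coord_def sum.distrib max_def)

lemma patt_scale: "0 \<le> c \<Longrightarrow> patt n S (c *\<^sub>R X) i q = c * patt n S X i q"
  by (induction i q rule: patt_induct[of n _ S])
    (simp_all add: patt_outside patt_in patt_not_in coord_scale sum_distrib_left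
      max_mult_distrib_left distrib_left)

lemma patt_nonneg:
  assumes "\<And>p. 0 \<le> X p"
  shows "0 \<le> patt n S X i q"
proof (induction i q rule: patt_induct[of n _ S])
  case (not_in_S i q)
  moreover have "0 \<le> coord n S X i q" using assms by (simp add: coord_def)
  ultimately show ?case by (simp add: patt_not_in max_def)
qed (use assms in \<open>simp_all add: patt_outside patt_in coord_def sum_nonneg\<close>)

lemma patt_Ints: "(\<And>p. X p \<in> \<int>) \<Longrightarrow> patt n S X i q \<in> \<int>"
  by (induction i q rule: patt_induct[of n _ S])
    (auto simp: patt_outside patt_in patt_not_in coord_def max_def intro!: Ints_sum)

text \<open>Inversion of \<open>patt\<close>: once row \<open>Suc i\<close> of the values is known,
  the coordinates of row i come out from right to left.\<close>

lemma coord_eqI: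
  assumes eq: "\<And>q. i \<le> q \<Longrightarrow> patt n S X i q = patt n S Y i q"
    and eq': "\<And>q. Suc i \<le> q \<Longrightarrow> patt n S X (Suc i) q = patt n S Y (Suc i) q"
    and q: "i \<le> q" "q \<le> n"
  shows "coord n S X i q = coord n S Y i q"
  using q
proof (induction "n - q" arbitrary: q rule: less_induct)
  case less
  show ?case
  proof (cases "(i, q) \<in> S")
    case True
    have "(\<Sum>q'\<in>{q..n}. coord n S X i q') = (\<Sum>q'\<in>{q..n}. coord n S Y i q')"
      using eq[of q] less.prems True by (simp add: patt_in)
    moreover have "(\<Sum>q'\<in>{Suc q..n}. coord n S X i q') = (\<Sum>q'\<in>{Suc q..n}. coord n S Y i q')"
      using less by (intro sum.cong) auto
    ultimately show ?thesis using less.prems by (simp add: sum.atLeast_Suc_atMost)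
  next
    case False
    have "patt n S X (Suc i) q = patt n S Y (Suc i) q"
      using eq'[of q] by (cases "Suc i \<le> q") (auto simp: patt_outside)
    then show ?thesis using eq[of q] eq[of "Suc q"] less.prems False by (simp add: patt_not_in)
  qed
qed

lemma patt_inject:
  assumes supp: "\<And>p. p \<notin> tri n \<Longrightarrow> X p = 0" "\<And>p. p \<notin> tri n \<Longrightarrow> Y p = 0"
    and eq: "\<And>i q. (i, q) \<in> tri n \<Longrightarrow> patt n S X i q = patt n S Y i q"
  shows "X = Y"
proof
  fix p :: "nat \<times> nat"
  obtain i j where p: "p = (i, j)" by force
  show "X p = Y p"
  proof (cases "p \<in> tri n")
    case True
    then have ij: "1 \<le> i" "i \<le> j" "j \<le> n" by (auto simp: p tri_def)
    have eq': "patt n S X i' q = patt n S Y i' q" if "i \<le> i'" for i' q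
      using eq[of i' q] that ij by (cases "i' \<le> q \<and> q \<le> n") (auto simp: tri_def patt_outside)
    define q where "q = tail_perm n S i j"
    have "q \<in> {i..n}"
      using permutes_in_image[OF tail_perm_permutes[of n S i], of j] ij by (auto simp: q_def)
    then have "coord n S X i q = coord n S Y i q"
      by (intro coord_eqI) (auto intro: eq')
    moreover have "inv_into UNIV (tail_perm n S i) q = j"
      using permutes_inverses(2)[OF tail_perm_permutes[of n S i]] by (simp add: q_def)
    ultimately show ?thesis by (simp add: coord_def p)
  qed (use supp in auto)
qed

lemma initial_segment_iff:
  fixes D :: "nat set"
  assumes fin: "finite D" and pos: "\<And>x. x \<in> D \<Longrightarrow> 1 \<le> x"
    and down: "\<And>x y. x \<in> D \<Longrightarrow> 1 \<le> y \<Longrightarrow> y \<le> x \<Longrightarrow> y \<in> D"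
  shows "i \<in> D \<longleftrightarrow> i \<in> {1..card D}"
proof (cases "D = {}")
  case False
  have "i \<in> D \<longleftrightarrow> i \<in> {1..Max D}" for i
    using pos[of i] down[OF Max_in[OF fin False], of i] Max_ge[OF fin, of i] by auto
  then have D: "D = {1..Max D}" by blast
  then have "card D = Max D" using card_atLeastAtMost[of 1 "Max D"] by simp
  then show ?thesis by (simp only:) (rule eqset_imp_iff[OF D])
qed simp

lemma diag_in_rank_iff:
  assumes J: "J \<in> order_ideals_rank n k"
  shows "(i, i) \<in> J \<longleftrightarrow> i \<in> {1..k}"
proof -
  have J': "J \<in> order_ideals n" and c: "card (J \<inter> diag n) = k"
    using J by (auto simp: order_ideals_rank_def)
  define D where "D = {i. (i, i) \<in> J}"
  have D: "1 \<le> i \<and> i \<le> n" if "i \<in> D" for i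
    using order_idealsD(1,3)[OF J', of i i] that by (simp add: D_def)
  then have "D \<subseteq> {1..n}" by (simp add: subset_iff)
  then have fin: "finite D" by (rule finite_subset) simp
  have "J \<inter> diag n = (\<lambda>i. (i, i)) ` D"
    unfolding diag_def D_def using D[unfolded D_def] by blast
  then have "card D = k" using c by (simp add: card_image inj_on_def)
  moreover have "i \<in> D \<longleftrightarrow> i \<in> {1..card D}"
  proof (rule initial_segment_iff[OF fin])
    show "1 \<le> x" if "x \<in> D" for x using D[OF that] by simp
    show "y \<in> D" if "x \<in> D" "1 \<le> y" "y \<le> x" for x y
      using order_idealsD(4)[OF J', of x x y y] that by (simp add: D_def)
  qed
  ultimately have "i \<in> D \<longleftrightarrow> i \<in> {1..k}" by simp
  then show ?thesis by (simp add: D_def)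
qed

lemma maximal_elements_iff:
  assumes J: "J \<in> order_ideals n" and i: "1 \<le> i" "i \<le> q"
  shows "(i, q) \<in> maximal_elements J \<longleftrightarrow> (i, q) \<in> J \<and> (i, Suc q) \<notin> J \<and> (Suc i, q) \<notin> J"
proof
  assume "(i, q) \<in> maximal_elements J"
  then show "(i, q) \<in> J \<and> (i, Suc q) \<notin> J \<and> (Suc i, q) \<notin> J"
    by (auto simp: maximal_elements_def tri_le_def)
next
  assume r: "(i, q) \<in> J \<and> (i, Suc q) \<notin> J \<and> (Suc i, q) \<notin> J"
  have "i' = i \<and> q' = q" if J': "(i', q') \<in> J" and ge: "i \<le> i'" "q \<le> q'" for i' q'
  proof -
    have "\<not> Suc q \<le> q'"
    proof
      assume "Suc q \<le> q'"
      then have "(i, Suc q) \<in> J" using order_idealsD(4)[OF J J', of i "Suc q"] i ge by simp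
      then show False using r by simp
    qed
    moreover have "\<not> Suc i \<le> i'"
    proof
      assume *: "Suc i \<le> i'"
      then have "Suc i \<le> q" using order_idealsD(2)[OF J J'] \<open>\<not> Suc q \<le> q'\<close> by simp
      then have "(Suc i, q) \<in> J" using order_idealsD(4)[OF J J', of "Suc i" q] * ge by simp
      then show False using r by simp
    qed
    ultimately show ?thesis using ge by simp
  qed
  then show "(i, q) \<in> maximal_elements J" using r by (auto simp: maximal_elements_def tri_le_def)
qed

lemma pipe_vertex_apply:
  "pipe_vertex n S k J (i, j) = (if i \<in> {1..k} \<and> w_ideal n S J i = j then 1 else 0)"
  by (auto simp: pipe_vertex_def indicator_def)

lemma coord_pipe_vertex:
  assumes J: "J \<in> order_ideals_rank n k"
  shows "coord n S (pipe_vertex n S k J) i q = (if i \<in> {1..k} \<and> row_max n S J i = q then 1 else 0)"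
proof (cases "i \<in> {1..k}")
  case True
  then have i: "(i, i) \<in> J" using diag_in_rank_iff[OF J] by simp
  have J': "J \<in> order_ideals n" using J by (auto simp: order_ideals_rank_def)
  have "inv_into UNIV (tail_perm n S i) q = w_ideal n S J i \<longleftrightarrow> row_max n S J i = q"
    by (simp only: permutes_inv_eq[OF tail_perm_permutes] tail_perm_w_ideal[OF J' i])
  then have "w_ideal n S J i = inv_into UNIV (tail_perm n S i) q \<longleftrightarrow> row_max n S J i = q"
    by (simp only: eq_commute)
  then show ?thesis
    using True by (simp add: coord_def pipe_vertex_apply)
qed (auto simp: coord_def pipe_vertex_apply)

lemma patt_pipe_vertex:
  assumes J: "J \<in> order_ideals_rank n k" and S: "diag n \<subseteq> S"
    and i: "1 \<le> i"
  shows "patt n S (pipe_vertex n S k J) i q = (if (i, q) \<in> J then 1 else 0)"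
  using i
proof (induction "(Suc n - q) + (Suc n - i)" arbitrary: i q rule: less_induct)
  case less
  have J': "J \<in> order_ideals n" using J by (auto simp: order_ideals_rank_def)
  let ?V = "pipe_vertex n S k J"
  consider "n < q \<or> q < i" | "i \<le> q" "q \<le> n" "(i, i) \<notin> J"
    | "i \<le> q" "q \<le> n" "(i, i) \<in> J" "(i, q) \<in> S"
    | "i \<le> q" "q \<le> n" "(i, i) \<in> J" "(i, q) \<notin> S"
    by linarith
  then show ?case
  proof cases
    case 1
    then show ?thesis by (auto simp: patt_outside dest: order_idealsD(2,3)[OF J'])
  next
    case 2
    have "(i, q) \<notin> J" using 2 order_idealsD(4)[OF J', of i q i i] less.prems by auto
    moreover have c: "coord n S ?V i q' = 0" for q'
      using 2 diag_in_rank_iff[OF J, of i] by (auto simp: coord_pipe_vertex[OF J])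
    moreover have "(i, Suc q) \<notin> J" "(Suc i, q) \<notin> J"
      using order_idealsD(4)[OF J', of i "Suc q" i q] order_idealsD(4)[OF J', of "Suc i" q i q]
        \<open>(i, q) \<notin> J\<close> 2 less.prems by auto
    ultimately show ?thesis
      using 2 less.hyps[of "Suc q" i] less.hyps[of q "Suc i"] less.prems
      by (cases "(i, q) \<in> S") (auto simp: patt_in patt_not_in)
  next
    case 3
    have "(\<Sum>q'\<in>{q..n}. coord n S ?V i q') = (\<Sum>q'\<in>{q..n}. if row_max n S J i = q' then 1 else 0)"
      using 3 diag_in_rank_iff[OF J, of i] by (simp add: coord_pipe_vertex[OF J])
    also have "\<dots> = (if row_max n S J i \<in> {q..n} then 1 else 0)" by simp
    finally show ?thesis
      using 3 row_max_ge_iff[OF J' 3(3,4)] row_max_range[OF J' 3(3), of S] by (simp add: patt_in)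
  next
    case 4
    \<comment> \<open>On the diagonal \<open>row_max\<close> could equal i merely by default, with
      no maximal element behind it; as the diagonal lies in \<open>S\<close>, this clause only meets
      cells beyond it.\<close>
    have "i < q" using 4 S less.prems by (cases "i = q") (auto simp: diag_def)
    have "coord n S ?V i q = (if (i, q) \<in> maximal_elements J then 1 else 0)"
      using 4 diag_in_rank_iff[OF J, of i] row_max_eq_iff[OF J' 4(3,4) \<open>i < q\<close> 4(2)]
      by (simp add: coord_pipe_vertex[OF J])
    moreover have "(i, q) \<in> J" if "(i, Suc q) \<in> J \<or> (Suc i, q) \<in> J"
      using that order_idealsD(4)[OF J', of i "Suc q" i q] order_idealsD(4)[OF J', of "Suc i" q i q]
        4 less.prems by auto
    ultimately show ?thesis
      using 4 less.hyps[of "Suc q" i] less.hyps[of q "Suc i"] less.prems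
        maximal_elements_iff[OF J' less.prems 4(1)]
      by (auto simp: patt_not_in)
  qed
qed

section \<open>Partitions, patterns and their lattice points\<close>

locale pipe_setup =
  fixes n :: nat and S :: "(nat \<times> nat) set" and a :: "nat \<Rightarrow> int"
  assumes n2: "2 \<le> n" and S_tri: "S \<subseteq> tri n" and diag_S: "diag n \<subseteq> S"
    and a_nonneg: "\<And>k. 1 \<le> k \<Longrightarrow> k \<le> n - 1 \<Longrightarrow> 0 \<le> a k"
begin

text \<open>The row lengths of the Young diagram with \<open>a k\<close> columns of length k. For i
  >= 1 the sum is nonnegative, so \<open>nat\<close> loses nothing.\<close>

definition part :: "nat \<Rightarrow> nat" where
  "part i = nat (\<Sum>k\<in>{i..<n}. a k)"

lemma int_part: "1 \<le> i \<Longrightarrow> int (part i) = (\<Sum>k\<in>{i..<n}. a k)"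
  unfolding part_def by (subst int_nat_eq) (auto intro!: sum_nonneg a_nonneg)

lemma part_Suc: "1 \<le> i \<Longrightarrow> i < n \<Longrightarrow> int (part i) = a i + int (part (Suc i))"
  by (simp add: int_part sum.atLeast_Suc_lessThan)

lemma part_mono: "1 \<le> i \<Longrightarrow> i \<le> j \<Longrightarrow> part j \<le> part i"
proof -
  assume "1 \<le> i" "i \<le> j"
  then have "(\<Sum>k\<in>{j..<n}. a k) \<le> (\<Sum>k\<in>{i..<n}. a k)"
    by (intro sum_mono2) (auto intro!: a_nonneg)
  then show ?thesis by (simp add: part_def nat_mono)
qed

lemma part_end: "n \<le> i \<Longrightarrow> part i = 0"
  by (simp add: part_def)

text \<open>The conjugate partition, with columns counted from 0.\<close>

definition col_len :: "nat \<Rightarrow> nat" where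
  "col_len s = card {i\<in>{1..n}. s < part i}"

lemma le_col_len_iff:
  assumes "1 \<le> i"
  shows "i \<le> col_len s \<longleftrightarrow> s < part i"
proof -
  define D where "D = {i\<in>{1..n}. s < part i}"
  have "i \<in> D \<longleftrightarrow> i \<in> {1..card D}"
  proof (rule initial_segment_iff)
    show "y \<in> D" if "x \<in> D" "1 \<le> y" "y \<le> x" for x y
      using part_mono[OF that(2,3)] that by (simp add: D_def)
  qed (simp_all add: D_def)
  moreover have "card D = col_len s" by (simp add: col_len_def D_def)
  moreover have "i \<in> D \<longleftrightarrow> s < part i"
    using assms part_end[of i] by (cases "i \<le> n") (auto simp: D_def)
  ultimately show ?thesis using assms by simp
qed

lemma col_len_range: "s < part 1 \<Longrightarrow> col_len s \<in> {1..<n}"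
  using le_col_len_iff[of 1 s] le_col_len_iff[of n s] part_end[of n] n2 by auto

lemma card_col_len:
  assumes k: "k \<in> {1..<n}"
  shows "int (card {s\<in>{..<part 1}. col_len s = k}) = a k"
proof -
  have "{s\<in>{..<part 1}. col_len s = k} = {part (Suc k)..<part k}"
  proof -
    have "s < part 1 \<and> col_len s = k \<longleftrightarrow> s \<in> {part (Suc k)..<part k}" for s
      using le_col_len_iff[of k s] le_col_len_iff[of "Suc k" s] part_mono[of 1 k] k by auto
    then show ?thesis by blast
  qed
  then show ?thesis using part_Suc[of k] part_mono[of k "Suc k"] k by simp
qed

text \<open>Gelfand-Tsetlin patterns; the levels of a pattern form a chain of order ideals.\<close>

definition patterns :: "(nat \<times> nat \<Rightarrow> nat) set" where
  "patterns = {z. (\<forall>p. p \<notin> tri n \<longrightarrow> z p = 0) \<and> (\<forall>i\<in>{1..n}. z (i, i) = part i) \<and>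
     (\<forall>p\<in>tri n. \<forall>q\<in>tri n. tri_le p q \<longrightarrow> z q \<le> z p)}"

definition level :: "(nat \<times> nat \<Rightarrow> nat) \<Rightarrow> nat \<Rightarrow> (nat \<times> nat) set" where
  "level z s = {p. s < z p}"

lemma patternsD:
  assumes "z \<in> patterns"
  shows "p \<notin> tri n \<Longrightarrow> z p = 0" "i \<in> {1..n} \<Longrightarrow> z (i, i) = part i"
    "p \<in> tri n \<Longrightarrow> q \<in> tri n \<Longrightarrow> tri_le p q \<Longrightarrow> z q \<le> z p"
proof -
  have c: "\<forall>p. p \<notin> tri n \<longrightarrow> z p = 0" "\<forall>i\<in>{1..n}. z (i, i) = part i"
    "\<forall>p\<in>tri n. \<forall>q\<in>tri n. tri_le p q \<longrightarrow> z q \<le> z p"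
    using assms unfolding patterns_def mem_Collect_eq by - (elim conjE, assumption)+
  show "p \<notin> tri n \<Longrightarrow> z p = 0" using c(1) by blast
  show "i \<in> {1..n} \<Longrightarrow> z (i, i) = part i" using c(2) by blast
  show "p \<in> tri n \<Longrightarrow> q \<in> tri n \<Longrightarrow> tri_le p q \<Longrightarrow> z q \<le> z p" using c(3) by blast
qed

lemma pattern_le_part:
  assumes z: "z \<in> patterns" and "1 \<le> i"
  shows "z (i, q) \<le> part i"
proof (cases "(i, q) \<in> tri n")
  case True
  then show ?thesis
    using patternsD(3)[OF z, of "(i, i)" "(i, q)"] patternsD(2)[OF z, of i]
    by (auto simp: tri_def tri_le_def)
qed (simp add: patternsD(1)[OF z])

lemma level_in_order_ideals:
  assumes z: "z \<in> patterns"
  shows "level z s \<in> order_ideals n"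
proof -
  have sub: "p \<in> tri n" if "p \<in> level z s" for p
    using patternsD(1)[OF z, of p] that by (cases "p \<in> tri n") (simp_all add: level_def)
  have "p \<in> level z s" if "q \<in> level z s" "p \<in> tri n" "tri_le p q" for p q
    using patternsD(3)[OF z that(2) sub[OF that(1)] that(3)] that(1) by (simp add: level_def)
  then show ?thesis
    unfolding order_ideals_def using sub by blast
qed

lemma diag_in_level_iff:
  assumes z: "z \<in> patterns"
  shows "(i, i) \<in> level z s \<longleftrightarrow> 1 \<le> i \<and> s < part i"
proof (cases "i \<in> {1..n}")
  case True then show ?thesis using patternsD(2)[OF z True] by (simp add: level_def)
next
  case False
  then have "(i, i) \<notin> tri n" by (auto simp: tri_def)
  then show ?thesis using patternsD(1)[OF z] part_end[of i] False by (auto simp: level_def)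
qed

lemma level_in_rank:
  assumes z: "z \<in> patterns"
  shows "level z s \<in> order_ideals_rank n (col_len s)"
proof -
  have "level z s \<inter> diag n = (\<lambda>i. (i, i)) ` {i\<in>{1..n}. s < part i}"
    using diag_in_level_iff[OF z] by (auto simp: diag_def)
  then have "card (level z s \<inter> diag n) = col_len s"
    by (simp add: card_image inj_on_def col_len_def)
  then show ?thesis using level_in_order_ideals[OF z] by (simp add: order_ideals_rank_def)
qed

text \<open>The sum of the vertices of all levels, written as a count so that it is integral by
  construction; \<open>pattern_point_eq_sum\<close> gives the link.\<close>

definition pattern_point :: "(nat \<times> nat \<Rightarrow> nat) \<Rightarrow> nat \<times> nat \<Rightarrow> int" where
  "pattern_point z = (\<lambda>(i, j).
     int (card {s. 1 \<le> i \<and> s < part i \<and> w_ideal n S (level z s) i = j}))"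

abbreviation pattern_vertex :: "(nat \<times> nat \<Rightarrow> nat) \<Rightarrow> nat \<Rightarrow> nat \<times> nat \<Rightarrow> real" where
  "pattern_vertex z s \<equiv> pipe_vertex n S (col_len s) (level z s)"

lemma sum_fun_apply: "(\<Sum>s\<in>A. V s) p = (\<Sum>s\<in>A. V s p)"
  by (induction A rule: infinite_finite_induct) auto

lemma pattern_point_eq_sum:
  "(\<lambda>p. real_of_int (pattern_point z p)) = (\<Sum>s<part 1. pattern_vertex z s)"
proof
  fix p :: "nat \<times> nat"
  obtain i j where p: "p = (i, j)" by force
  have "(\<Sum>s<part 1. pattern_vertex z s) p = (\<Sum>s<part 1. pattern_vertex z s p)"
    by (rule sum_fun_apply)
  also have "\<dots> = real (card {s\<in>{..<part 1}. 1 \<le> i \<and> i \<le> col_len s \<and> w_ideal n S (level z s) i = j})"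
    by (simp add: p pipe_vertex_apply sum.If_cases Int_def)
  also have "{s\<in>{..<part 1}. 1 \<le> i \<and> i \<le> col_len s \<and> w_ideal n S (level z s) i = j}
      = {s. 1 \<le> i \<and> s < part i \<and> w_ideal n S (level z s) i = j}"
    using part_mono[of 1 i] by (auto simp: le_col_len_iff)
  finally show "real_of_int (pattern_point z p) = (\<Sum>s<part 1. pattern_vertex z s) p"
    by (simp add: p pattern_point_def)
qed

lemma coord_sum: "coord n S (\<Sum>s\<in>A. V s) i q = (\<Sum>s\<in>A. coord n S (V s) i q)"
  by (induction A rule: infinite_finite_induct) (auto simp: coord_def)

lemma coord_pattern_point:
  assumes z: "z \<in> patterns" and i: "1 \<le> i"
  shows "coord n S (\<lambda>p. real_of_int (pattern_point z p)) i q
    = real (card {s. s < part i \<and> row_max n S (level z s) i = q})"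
proof -
  have "coord n S (\<lambda>p. real_of_int (pattern_point z p)) i q
      = (\<Sum>s<part 1. if i \<le> col_len s \<and> row_max n S (level z s) i = q then 1 else 0)"
    unfolding pattern_point_eq_sum coord_sum
    using i by (simp add: coord_pipe_vertex[OF level_in_rank[OF z]])
  also have "\<dots> = real (card {s\<in>{..<part 1}. i \<le> col_len s \<and> row_max n S (level z s) i = q})"
    by (simp add: sum.If_cases Int_def)
  also have "{s\<in>{..<part 1}. i \<le> col_len s \<and> row_max n S (level z s) i = q}
      = {s. s < part i \<and> row_max n S (level z s) i = q}"
    using part_mono[of 1 i] i by (auto simp: le_col_len_iff)
  finally show ?thesis .
qed

text \<open>\<open>patt\<close> is not additive, yet it adds up correctly over nested levels:
  outside \<open>S\<close>, the levels in which (i, q) is maximal run exactly from the larger of the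
  two neighbouring entries up to z (i, q).\<close>

lemma patt_pattern_point:
  assumes z: "z \<in> patterns" and i: "1 \<le> i"
  shows "patt n S (\<lambda>p. real_of_int (pattern_point z p)) i q = real (z (i, q))"
  using i
proof (induction "(Suc n - q) + (Suc n - i)" arbitrary: i q rule: less_induct)
  case less
  let ?X = "\<lambda>p. real_of_int (pattern_point z p)"
  note ideal = level_in_order_ideals[OF z]
  have dg: "(i, i) \<in> level z s" if "s < part i" for s
    using that less.prems diag_in_level_iff[OF z] by simp
  consider "n < q \<or> q < i" | "i \<le> q" "q \<le> n" "(i, q) \<in> S" | "i \<le> q" "q \<le> n" "(i, q) \<notin> S"
    by linarith
  then show ?case
  proof cases
    case 1
    then have "(i, q) \<notin> tri n" by (auto simp: tri_def)
    with 1 show ?thesis using patternsD(1)[OF z] by (simp add: patt_outside)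
  next
    case 2
    have "patt n S ?X i q = (\<Sum>q'\<in>{q..n}. real (card {s. s < part i \<and> row_max n S (level z s) i = q'}))"
      using 2 less.prems by (simp add: patt_in coord_pattern_point[OF z])
    also have "\<dots> = real (card (\<Union>q'\<in>{q..n}. {s. s < part i \<and> row_max n S (level z s) i = q'}))"
      by (subst card_UN_disjoint) auto
    also have "(\<Union>q'\<in>{q..n}. {s. s < part i \<and> row_max n S (level z s) i = q'}) = {..<z (i, q)}"
    proof -
      have "(\<exists>q'\<in>{q..n}. row_max n S (level z s) i = q') \<longleftrightarrow> s < z (i, q)" if "s < part i" for s
        using row_max_ge_iff[OF ideal dg[OF that] 2(3,1,2)] row_max_range(2)[OF ideal dg[OF that], of S]
        by (simp add: level_def)
      then have "s < part i \<and> (\<exists>q'\<in>{q..n}. row_max n S (level z s) i = q') \<longleftrightarrow> s < z (i, q)" for s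
        using pattern_le_part[OF z less.prems, of q] by (cases "s < part i") simp_all
      then show ?thesis unfolding lessThan_def by blast
    qed
    finally show ?thesis by simp
  next
    case 3
    have iq: "i < q" using 3 diag_S less.prems by (cases "i = q") (auto simp: diag_def)
    have mon: "z (i, Suc q) \<le> z (i, q)" "z (Suc i, q) \<le> z (i, q)"
      using patternsD(3)[OF z, of "(i, q)" "(i, Suc q)"] patternsD(1)[OF z, of "(i, Suc q)"]
        patternsD(3)[OF z, of "(i, q)" "(Suc i, q)"] patternsD(1)[OF z, of "(Suc i, q)"] 3 less.prems
      by (cases "Suc q \<le> n"; cases "Suc i \<le> q"; auto simp: tri_def tri_le_def)+
    have "{s. s < part i \<and> row_max n S (level z s) i = q} = {max (z (i, Suc q)) (z (Suc i, q))..<z (i, q)}"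
    proof -
      have "row_max n S (level z s) i = q \<longleftrightarrow> s < z (i, q) \<and> z (i, Suc q) \<le> s \<and> z (Suc i, q) \<le> s"
        if "s < part i" for s
        using row_max_eq_iff[OF ideal dg[OF that] 3(3) iq 3(2)]
          maximal_elements_iff[OF ideal less.prems 3(1)]
        by (simp add: level_def not_less)
      then have "s < part i \<and> row_max n S (level z s) i = q \<longleftrightarrow>
          s \<in> {max (z (i, Suc q)) (z (Suc i, q))..<z (i, q)}" for s
        using pattern_le_part[OF z less.prems, of q] by (cases "s < part i") auto
      then show ?thesis by blast
    qed
    then have "coord n S ?X i q = real (z (i, q)) - real (max (z (i, Suc q)) (z (Suc i, q)))"
      using mon less.prems by (simp add: coord_pattern_point[OF z])
    then show ?thesis
      using 3 less.hyps[of "Suc q" i] less.hyps[of q "Suc i"] less.prems by (simp add: patt_not_in)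
  qed
qed

lemma inj_on_pattern_point: "inj_on pattern_point patterns"
proof
  fix z z' assume z: "z \<in> patterns" "z' \<in> patterns" "pattern_point z = pattern_point z'"
  have "z (i, q) = z' (i, q)" for i q
  proof (cases "1 \<le> i")
    case True
    then show ?thesis using patt_pattern_point[OF z(1) True, of q] patt_pattern_point[OF z(2) True, of q] z(3)
      by simp
  next
    case False
    then show ?thesis using patternsD(1)[OF z(1), of "(i, q)"] patternsD(1)[OF z(2), of "(i, q)"]
      by (auto simp: tri_def)
  qed
  then show "z = z'" by auto
qed

lemma pattern_point_outside:
  assumes z: "z \<in> patterns" and p: "p \<notin> tri n"
  shows "pattern_point z p = 0"
proof -
  obtain i j where ij: "p = (i, j)" by force
  have "\<not> (1 \<le> i \<and> s < part i \<and> w_ideal n S (level z s) i = j)" for s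
  proof
    assume *: "1 \<le> i \<and> s < part i \<and> w_ideal n S (level z s) i = j"
    then have "(i, i) \<in> level z s" using diag_in_level_iff[OF z] by blast
    then have "j \<in> {i..n}" using w_ideal_range[OF level_in_order_ideals[OF z]] * by blast
    then show False using * p by (simp add: ij tri_def)
  qed
  then show ?thesis unfolding ij pattern_point_def by simp
qed

text \<open>Exactly \<open>a k\<close> levels have rank k, and the sum of their vertices is
  \<open>a k\<close> times their average.\<close>

lemma pattern_point_in_polytope:
  assumes z: "z \<in> patterns"
  shows "pattern_point z \<in> lattice_points (pipe_polytope n S a)"
proof -
  let ?B = "\<lambda>k. {s\<in>{..<part 1}. col_len s = k}"
  have *: "(\<Sum>s\<in>?B k. pattern_vertex z s) \<in> (\<lambda>x. real_of_int (a k) *\<^sub>R x) ` pipe_polytope_fund n S k"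
    if k: "k \<in> {1..<n}" for k
  proof (cases "?B k = {}")
    case True
    \<comment> \<open>For \<open>a k = 0\<close> the summand consists of the origin only if the
      scaled polytope is nonempty, so an ideal of rank k has to be exhibited.\<close>
    define J where "J = {(i, j) \<in> tri n. j \<le> k}"
    have "J \<inter> diag n = (\<lambda>i. (i, i)) ` {1..k}" using k by (auto simp: J_def diag_def tri_def)
    then have "J \<in> order_ideals_rank n k"
      by (auto simp: order_ideals_rank_def order_ideals_def J_def tri_le_def card_image inj_on_def)
    then have "pipe_vertex n S k J \<in> pipe_polytope_fund n S k"
      by (auto simp: pipe_polytope_fund_def intro: hull_inc)
    moreover have "a k = 0" using card_col_len[OF k] unfolding True by simp
    ultimately show ?thesis unfolding True by (auto simp: image_iff)
  next
    case False
    let ?c = "real_of_int (a k)"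
    have c: "?c = real (card (?B k))" using card_col_len[OF k] by (metis of_int_of_nat_eq)
    have "0 < card (?B k)" using False by (subst card_gt_0_iff) auto
    then have c0: "?c > 0" using c by simp
    have "(\<Sum>s\<in>?B k. (1 / ?c) *\<^sub>R pattern_vertex z s) \<in> pipe_polytope_fund n S k"
      unfolding pipe_polytope_fund_def
    proof (rule convex_sum)
      show "(\<Sum>s\<in>?B k. 1 / ?c) = 1"
        unfolding sum_constant c[symmetric] using c0 by simp
      fix s assume "s \<in> ?B k"
      then show "pattern_vertex z s \<in> convex hull pipe_vertex n S k ` order_ideals_rank n k"
        using level_in_rank[OF z, of s] by (auto intro!: hull_inc)
    qed (use c0 in auto)
    moreover have "(\<Sum>s\<in>?B k. pattern_vertex z s) = ?c *\<^sub>R (\<Sum>s\<in>?B k. (1 / ?c) *\<^sub>R pattern_vertex z s)"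
      using c0 by (simp add: scaleR_sum_right)
    ultimately show ?thesis by blast
  qed
  have "(\<Sum>s<part 1. pattern_vertex z s) = (\<Sum>k\<in>{1..<n}. \<Sum>s\<in>?B k. pattern_vertex z s)"
    using col_len_range by (subst sum.group) auto
  also have "\<dots> \<in> pipe_polytope n S a"
    unfolding pipe_polytope_def by (subst set_sum_alt) (use * in auto)
  finally show ?thesis by (simp add: lattice_points_def pattern_point_eq_sum)
qed

text \<open>A convex description of the polytope by which each of its lattice points is seen to come
  from a pattern: \<^const>\<open>patt\<close> is convex where the order relations are to be proved and linear on \<open>S\<close>.\<close>

definition region :: "(nat \<Rightarrow> real) \<Rightarrow> (nat \<times> nat \<Rightarrow> real) set" where
  "region r = {X. (\<forall>p. 0 \<le> X p) \<and> (\<forall>p. p \<notin> tri n \<longrightarrow> X p = 0) \<and>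
     (\<forall>i\<in>{1..n}. (\<Sum>j\<in>{i..n}. X (i, j)) = r i) \<and>
     (\<forall>(i, q)\<in>S. patt n S X i (Suc q) \<le> patt n S X i q \<and> patt n S X (Suc i) q \<le> patt n S X i q)}"

text \<open>In each inequality the larger side sits at a cell of \<open>S\<close>, where
  \<open>patt\<close> is linear, while the smaller side is subadditive; so the inequalities can be
  added.\<close>

lemma region_add:
  assumes X: "X \<in> region r" and Y: "Y \<in> region r'"
  shows "X + Y \<in> region (\<lambda>i. r i + r' i)"
proof -
  have lin: "patt n S (X + Y) i q = patt n S X i q + patt n S Y i q" if "(i, q) \<in> S" for i q
    using that S_tri by (auto simp: patt_in coord_def tri_def sum.distrib)
  have sub: "patt n S (X + Y) i' q' \<le> patt n S (X + Y) i q"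
    if "(i, q) \<in> S" "patt n S X i' q' \<le> patt n S X i q" "patt n S Y i' q' \<le> patt n S Y i q" for i q i' q'
    using lin[OF that(1)] patt_subadd[of n S X Y i' q'] that(2,3) by linarith
  show ?thesis unfolding region_def mem_Collect_eq
  proof (intro conjI)
    show "\<forall>p. 0 \<le> (X + Y) p" using X Y by (simp add: region_def)
    show "\<forall>p. p \<notin> tri n \<longrightarrow> (X + Y) p = 0" using X Y by (simp add: region_def)
    show "\<forall>i\<in>{1..n}. (\<Sum>j\<in>{i..n}. (X + Y) (i, j)) = r i + r' i"
      using X Y by (simp add: region_def sum.distrib)
    show "\<forall>(i, q)\<in>S. patt n S (X + Y) i (Suc q) \<le> patt n S (X + Y) i q \<and>
        patt n S (X + Y) (Suc i) q \<le> patt n S (X + Y) i q"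
    proof clarify
      fix i q assume iq: "(i, q) \<in> S"
      have "patt n S X i (Suc q) \<le> patt n S X i q" "patt n S X (Suc i) q \<le> patt n S X i q"
        "patt n S Y i (Suc q) \<le> patt n S Y i q" "patt n S Y (Suc i) q \<le> patt n S Y i q"
        using X Y iq unfolding region_def by blast+
      then show "patt n S (X + Y) i (Suc q) \<le> patt n S (X + Y) i q \<and>
        patt n S (X + Y) (Suc i) q \<le> patt n S (X + Y) i q"
        using sub[OF iq] by blast
    qed
  qed
qed

lemma region_scale:
  assumes X: "X \<in> region r" and c: "0 \<le> c"
  shows "c *\<^sub>R X \<in> region (\<lambda>i. c * r i)"
proof -
  have "(\<Sum>j\<in>{i..n}. (c *\<^sub>R X) (i, j)) = c * (\<Sum>j\<in>{i..n}. X (i, j))" for i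
    by (simp add: scaleR_fun_def sum_distrib_left)
  then show ?thesis
    using X c by (auto simp: region_def patt_scale intro!: mult_left_mono) (auto simp: scaleR_fun_def)
qed

lemma convex_region: "convex (region r)"
  unfolding convex_def
proof (intro ballI allI impI)
  fix X Y u v assume *: "X \<in> region r" "Y \<in> region r" "0 \<le> u" "0 \<le> v" "u + v = (1::real)"
  have "u *\<^sub>R X + v *\<^sub>R Y \<in> region (\<lambda>i. u * r i + v * r i)"
    by (intro region_add region_scale *)
  also have "(\<lambda>i. u * r i + v * r i) = r"
    using *(5) by (simp add: fun_eq_iff distrib_right[symmetric])
  finally show "u *\<^sub>R X + v *\<^sub>R Y \<in> region r" .
qed

lemma pipe_vertex_in_region:
  assumes J: "J \<in> order_ideals_rank n k"
  shows "pipe_vertex n S k J \<in> region (\<lambda>i. if i \<le> k then 1 else 0)"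
proof -
  have J': "J \<in> order_ideals n" using J by (auto simp: order_ideals_rank_def)
  have rng: "w_ideal n S J i \<in> {i..n}" if "i \<in> {1..k}" for i
    using w_ideal_range[OF J', of i S] diag_in_rank_iff[OF J, of i] that by simp
  have "pipe_vertex n S k J p = 0" if "p \<notin> tri n" for p
    using that rng by (cases p) (auto simp: pipe_vertex_apply tri_def)
  moreover have "(\<Sum>j\<in>{i..n}. pipe_vertex n S k J (i, j)) = (if i \<le> k then 1 else 0)" if "i \<in> {1..n}" for i
    using that rng[of i] by (auto simp: pipe_vertex_apply)
  moreover have "patt n S (pipe_vertex n S k J) i (Suc q) \<le> patt n S (pipe_vertex n S k J) i q \<and>
      patt n S (pipe_vertex n S k J) (Suc i) q \<le> patt n S (pipe_vertex n S k J) i q" if "(i, q) \<in> S" for i q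
  proof -
    have iq: "1 \<le> i" "i \<le> q" using that S_tri by (auto simp: tri_def)
    then show ?thesis
      using order_idealsD(4)[OF J', of i "Suc q" i q] order_idealsD(4)[OF J', of "Suc i" q i q]
      by (auto simp: patt_pipe_vertex[OF J diag_S])
  qed
  ultimately show ?thesis by (auto simp: region_def pipe_vertex_def)
qed

lemma pipe_polytope_subset_region: "pipe_polytope n S a \<subseteq> region (\<lambda>i. real (part i))"
proof
  fix X assume "X \<in> pipe_polytope n S a"
  then obtain V where X: "X = sum V {1..<n}"
    and V: "\<And>k. k \<in> {1..<n} \<Longrightarrow> V k \<in> (\<lambda>x. real_of_int (a k) *\<^sub>R x) ` pipe_polytope_fund n S k"
    unfolding pipe_polytope_def by (subst (asm) set_sum_alt) auto
  have V': "V k \<in> region (\<lambda>i. real_of_int (a k) * (if i \<le> k then 1 else 0))" if k: "k \<in> {1..<n}" for k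
  proof -
    have "pipe_polytope_fund n S k \<subseteq> region (\<lambda>i. if i \<le> k then 1 else 0)"
      unfolding pipe_polytope_fund_def
      by (intro hull_minimal convex_region) (auto intro: pipe_vertex_in_region)
    moreover have "0 \<le> a k" using a_nonneg[of k] k by auto
    ultimately show ?thesis using V[OF k] by (auto intro!: region_scale)
  qed
  have "sum V K \<in> region (\<lambda>i. \<Sum>k\<in>K. real_of_int (a k) * (if i \<le> k then 1 else 0))"
    if "finite K" "K \<subseteq> {1..<n}" for K
    using that
  proof (induction K rule: finite_induct)
    case empty
    have "patt n S (\<lambda>_. 0) i q = 0" for i q
      using patt_scale[of 0 n S 0 i q] by (simp add: zero_fun_def scaleR_fun_def)
    then show ?case by (auto simp: region_def)
  next
    case (insert k K)
    then show ?case
      unfolding sum.insert[OF insert.hyps(1,2)] by (intro region_add V') simp_all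
  qed
  from this[of "{1..<n}"] have "X \<in> region (\<lambda>i. \<Sum>k\<in>{1..<n}. real_of_int (a k) * (if i \<le> k then 1 else 0))"
    by (simp add: X)
  moreover have "(\<Sum>k\<in>{1..<n}. real_of_int (a k) * (if i \<le> k then 1 else 0)) = real (part i)"
    if "i \<in> {1..n}" for i
  proof -
    have "(\<Sum>k\<in>{1..<n}. real_of_int (a k) * (if i \<le> k then 1 else 0)) = (\<Sum>k\<in>{i..<n}. real_of_int (a k))"
      using that by (intro sum.mono_neutral_cong_right) auto
    also have "\<dots> = real_of_int (int (part i))" using that by (subst int_part) auto
    finally show ?thesis by simp
  qed
  ultimately show "X \<in> region (\<lambda>i. real (part i))" by (simp add: region_def)
qed

lemma sum_coord: "(\<Sum>q\<in>{i..n}. coord n S X i q) = (\<Sum>j\<in>{i..n}. X (i, j))"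
  unfolding coord_def
  by (rule sum.permute[OF permutes_inv[OF tail_perm_permutes], unfolded comp_def, symmetric])

text \<open>An integral point has integral \<open>patt\<close>, whose clauses use only sums and
  maxima. The order relations of a pattern come from \<open>region\<close> at the cells of
  \<open>S\<close> and from nonnegative coordinates at all others. Injectivity of
  \<open>patt\<close> then identifies the point.\<close>

lemma lattice_points_pipe_polytope:
  "lattice_points (pipe_polytope n S a) = pattern_point ` patterns"
proof (intro equalityI subsetI)
  fix x assume x: "x \<in> lattice_points (pipe_polytope n S a)"
  define X where "X = (\<lambda>p. real_of_int (x p))"
  have X: "X \<in> region (\<lambda>i. real (part i))"
    using x pipe_polytope_subset_region by (auto simp: lattice_points_def X_def)
  then have X0: "\<And>p. 0 \<le> X p" and Xsupp: "\<And>p. p \<notin> tri n \<Longrightarrow> X p = 0"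
    and Xrow: "\<And>i. i \<in> {1..n} \<Longrightarrow> (\<Sum>j\<in>{i..n}. X (i, j)) = real (part i)"
    and XS: "\<And>i q. (i, q) \<in> S \<Longrightarrow> patt n S X i (Suc q) \<le> patt n S X i q \<and>
      patt n S X (Suc i) q \<le> patt n S X i q"
    by (auto simp: region_def)
  have st: "patt n S X i (Suc q) \<le> patt n S X i q \<and> patt n S X (Suc i) q \<le> patt n S X i q"
    if "i \<le> q" "q \<le> n" for i q
  proof (cases "(i, q) \<in> S")
    case False
    have "0 \<le> coord n S X i q" using X0 by (simp add: coord_def)
    then show ?thesis using that False by (simp add: patt_not_in max_def)
  qed (rule XS)
  have mono: "patt n S X i' q' \<le> patt n S X i q" if "i \<le> i'" "q \<le> q'" "i' \<le> q" "q' \<le> n" for i q i' q'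
  proof -
    have "patt n S X i' q \<le> patt n S X i q" using that(1,3)
    proof (induction i' rule: dec_induct)
      case (step l)
      then show ?case using st[of l q] that by linarith
    qed simp
    moreover have "patt n S X i' q' \<le> patt n S X i' q" using that(2,3,4)
    proof (induction q' rule: dec_induct)
      case (step l)
      then show ?case using st[of i' l] by linarith
    qed simp
    ultimately show ?thesis by simp
  qed
  \<comment> \<open>The path above turns at (i', q), which may lie outside the triangle. Turning at
    (i, q') instead covers every comparable pair of cells.\<close>
  have mono: "patt n S X i' q' \<le> patt n S X i q" if "i \<le> i'" "q \<le> q'" "i \<le> q" "i' \<le> q'" "q' \<le> n" for i q i' q'
  proof -
    have "patt n S X i q' \<le> patt n S X i q" using mono[of i i q q'] that by simp
    moreover have "patt n S X i' q' \<le> patt n S X i q'" using mono[of i i' q' q'] that by simp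
    ultimately show ?thesis by simp
  qed
  define z where "z p = (if p \<in> tri n then nat \<lfloor>patt n S X (fst p) (snd p)\<rfloor> else 0)" for p
  have zX: "real (z (i, q)) = patt n S X i q" if "(i, q) \<in> tri n" for i q
  proof -
    have "patt n S X i q \<in> \<int>" by (rule patt_Ints) (simp add: X_def)
    then show ?thesis
      using that patt_nonneg[of X n S i q, OF X0] by (auto simp: z_def elim!: Ints_cases)
  qed
  have z: "z \<in> patterns"
    unfolding patterns_def mem_Collect_eq
  proof (intro conjI ballI allI impI)
    fix i assume i: "i \<in> {1..n}"
    then have "(i, i) \<in> S" using diag_S by (auto simp: diag_def)
    then have "patt n S X i i = real (part i)" using i Xrow by (simp add: patt_in sum_coord)
    then show "z (i, i) = part i" using zX[of i i] i by (simp add: tri_def)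
  next
    fix p q assume "p \<in> tri n" "q \<in> tri n" "tri_le p q"
    then have "real (z q) \<le> real (z p)"
      using zX[of "fst p" "snd p"] zX[of "fst q" "snd q"] mono[of "fst p" "fst q" "snd p" "snd q"]
      by (auto simp: tri_def tri_le_def)
    then show "z q \<le> z p" by simp
  qed (simp add: z_def)
  have "X = (\<lambda>p. real_of_int (pattern_point z p))"
    by (rule patt_inject[of n _ _ S])
      (use Xsupp pattern_point_outside[OF z] zX patt_pattern_point[OF z] in \<open>auto simp: tri_def\<close>)
  then have "x = pattern_point z" by (auto simp: X_def fun_eq_iff)
  with z show "x \<in> pattern_point ` patterns" by blast
qed (auto intro: pattern_point_in_polytope)

end

subsection \<open>The tensor model\<close>

type_synonym filling = "nat \<times> nat \<Rightarrow> nat"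

type_synonym tensor = "filling \<Rightarrow> complex"

definition munit :: "nat \<Rightarrow> nat \<Rightarrow> nat \<Rightarrow> complex mat" where
  "munit n i j = mat n n (\<lambda>(k, l). if k = i \<and> l = j then 1 else 0)"

lemma munit_carrier [simp]: "munit n i j \<in> carrier_mat n n"
  by (simp add: munit_def)

context pipe_setup
begin

text \<open>The Young diagram of the weight; the cell \<open>(s, r)\<close> lies in column \<open>s\<close> and row \<open>r\<close>. Columns
  are numbered from 0, rows from 1.\<close>

definition cells :: "(nat \<times> nat) set" where
  "cells = {(s, r). 1 \<le> r \<and> s < part r}"

lemma cells_subset: "cells \<subseteq> {..<part 1} \<times> {1..<n}"
proof clarify
  fix s r assume "(s, r) \<in> cells"
  then show "s \<in> {..<part 1} \<and> r \<in> {1..<n}"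
    using part_mono[of 1 r] part_end[of r] by (cases "r < n") (auto simp: cells_def)
qed

lemma finite_cells [simp]: "finite cells"
  using cells_subset by (rule finite_subset) simp

lemma cellsD: "p \<in> cells \<Longrightarrow> 1 \<le> snd p \<and> snd p < n \<and> fst p < part (snd p)"
  using cells_subset by (auto simp: cells_def)

definition words :: "(nat \<times> nat \<Rightarrow> nat) set" where
  "words = (cells \<rightarrow>\<^sub>E {1..n})"

lemma finite_words [simp]: "finite words"
  by (simp add: words_def finite_PiE)

lemma words_range: "w \<in> words \<Longrightarrow> p \<in> cells \<Longrightarrow> w p \<in> {1..n}"
  by (auto simp: words_def)

lemma words_upd: "w \<in> words \<Longrightarrow> p \<in> cells \<Longrightarrow> l \<in> {1..n} \<Longrightarrow> w(p := l) \<in> words"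
  unfolding words_def PiE_def extensional_def Pi_def by auto

lemma words_eqI: "w \<in> words \<Longrightarrow> w' \<in> words \<Longrightarrow> (\<And>p. p \<in> cells \<Longrightarrow> w p = w' p) \<Longrightarrow> w = w'"
  unfolding words_def by (rule PiE_ext)

lemma words_comp:
  assumes "w \<in> words" "\<sigma> permutes cells"
  shows "w \<circ> \<sigma> \<in> words"
proof -
  have "(w \<circ> \<sigma>) p \<in> {1..n}" if "p \<in> cells" for p
    using permutes_in_image[OF assms(2), of p] that words_range[OF assms(1), of "\<sigma> p"] by (simp only: o_apply)
  moreover have "(w \<circ> \<sigma>) p = undefined" if "p \<notin> cells" for p
    using PiE_arb[OF assms(1)[unfolded words_def] that] permutes_not_in[OF assms(2) that]
    by (simp only: o_apply)
  ultimately show ?thesis unfolding words_def by (intro PiE_I)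
qed

text \<open>The derivation action on a tensor power, written on coefficients: \<phi> stands for the
  tensor with coefficient \<open>\<phi> w\<close> at the basis tensor of the word w. The value 0
  elsewhere keeps images supported on \<open>words\<close>.\<close>

definition tens :: "complex mat \<Rightarrow> tensor \<Rightarrow> filling \<Rightarrow> complex" where
  "tens X \<phi> w = (if w \<in> words
     then \<Sum>p\<in>cells. \<Sum>l\<in>{1..n}. X $$ (w p - 1, l - 1) * \<phi> (w(p := l)) else 0)"

lemma tens_outside: "w \<notin> words \<Longrightarrow> tens X \<phi> w = 0"
  by (simp add: tens_def)

lemma tens_add_right: "tens X (\<lambda>w. \<phi> w + \<psi> w) w = tens X \<phi> w + tens X \<psi> w"
  by (simp add: tens_def distrib_left sum.distrib)

lemma tens_scale_right: "tens X (\<lambda>w. c * \<phi> w) w = c * tens X \<phi> w"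
  by (simp add: tens_def sum_distrib_left mult.left_commute)

lemma index_range: "w \<in> words \<Longrightarrow> p \<in> cells \<Longrightarrow> w p - 1 < n"
  using words_range[of w p] by auto

lemma tens_add_left:
  assumes "X \<in> carrier_mat n n" "Y \<in> carrier_mat n n"
  shows "tens (X + Y) \<phi> w = tens X \<phi> w + tens Y \<phi> w"
proof (cases "w \<in> words")
  case True
  have "(X + Y) $$ (w p - 1, l - 1) = X $$ (w p - 1, l - 1) + Y $$ (w p - 1, l - 1)"
    if "p \<in> cells" "l \<in> {1..n}" for p l
    using index_range[OF True that(1)] that(2) assms by auto
  then show ?thesis using True by (simp add: tens_def distrib_right sum.distrib)
qed (simp add: tens_outside)

lemma tens_scale_left:
  assumes "X \<in> carrier_mat n n"
  shows "tens (c \<cdot>\<^sub>m X) \<phi> w = c * tens X \<phi> w"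
proof (cases "w \<in> words")
  case True
  have "(c \<cdot>\<^sub>m X) $$ (w p - 1, l - 1) = c * X $$ (w p - 1, l - 1)"
    if "p \<in> cells" "l \<in> {1..n}" for p l
    using index_range[OF True that(1)] that(2) assms by auto
  then show ?thesis using True by (simp add: tens_def sum_distrib_left mult.assoc)
qed (simp add: tens_outside)

text \<open>The part of \<open>tens X (tens Y \<phi>)\<close> in which the two factors act on different tensor positions.\<close>

definition tens2 :: "complex mat \<Rightarrow> complex mat \<Rightarrow> tensor \<Rightarrow>
    filling \<Rightarrow> complex" where
  "tens2 X Y \<phi> w = (\<Sum>p\<in>cells. \<Sum>q\<in>cells - {p}. \<Sum>l\<in>{1..n}. \<Sum>m\<in>{1..n}.
     X $$ (w p - 1, l - 1) * Y $$ (w q - 1, m - 1) * \<phi> (w(p := l, q := m)))"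

lemma tens2_commute: "tens2 X Y \<phi> w = tens2 Y X \<phi> w"
proof -
  let ?f = "\<lambda>p q. \<Sum>l\<in>{1..n}. \<Sum>m\<in>{1..n}.
     X $$ (w p - 1, l - 1) * Y $$ (w q - 1, m - 1) * \<phi> (w(p := l, q := m))"
  let ?g = "\<lambda>p q. \<Sum>l\<in>{1..n}. \<Sum>m\<in>{1..n}.
     Y $$ (w p - 1, l - 1) * X $$ (w q - 1, m - 1) * \<phi> (w(p := l, q := m))"
  have fg: "?f p q = ?g q p" if "p \<noteq> q" for p q
  proof -
    have "?f p q = (\<Sum>m\<in>{1..n}. \<Sum>l\<in>{1..n}.
       X $$ (w p - 1, l - 1) * Y $$ (w q - 1, m - 1) * \<phi> (w(p := l, q := m)))"
      by (rule sum.swap)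
    then show ?thesis using that by (simp add: mult_ac fun_upd_twist)
  qed
  have "(\<Sum>p\<in>cells. \<Sum>q\<in>cells - {p}. ?f p q) = (\<Sum>p\<in>cells. \<Sum>q\<in>cells. if p = q then 0 else ?f p q)"
    by (rule sum.cong[OF refl]) (rule sum.mono_neutral_cong_left; auto)
  also have "\<dots> = (\<Sum>q\<in>cells. \<Sum>p\<in>cells. if p = q then 0 else ?f p q)" by (rule sum.swap)
  also have "\<dots> = (\<Sum>q\<in>cells. \<Sum>p\<in>cells - {q}. ?f p q)"
    by (rule sum.cong[OF refl]) (rule sum.mono_neutral_cong_right; auto)
  also have "\<dots> = (\<Sum>q\<in>cells. \<Sum>p\<in>cells - {q}. ?g q p)"
    by (intro sum.cong refl fg) auto
  finally show ?thesis by (simp add: tens2_def)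
qed

text \<open>Where both factors hit the same position, the matrix product acts. Distinct positions
  give \<open>tens2\<close>, which is symmetric in X and Y and therefore drops out of the
  commutator.\<close>

lemma tens_tens:
  assumes X: "X \<in> carrier_mat n n" and Y: "Y \<in> carrier_mat n n" and w: "w \<in> words"
  shows "tens X (tens Y \<phi>) w = tens (X * Y) \<phi> w + tens2 X Y \<phi> w"
proof -
  have XY: "(X * Y) $$ (w p - 1, m - 1) = (\<Sum>l\<in>{1..n}. X $$ (w p - 1, l - 1) * Y $$ (l - 1, m - 1))"
    if "p \<in> cells" "m \<in> {1..n}" for p m
  proof -
    have "(X * Y) $$ (w p - 1, m - 1) = (\<Sum>l\<in>{0..<n}. X $$ (w p - 1, l) * Y $$ (l, m - 1))"
      using index_range[OF w that(1)] that(2) X Y by (auto simp: scalar_prod_def)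
    also have "\<dots> = (\<Sum>l\<in>{1..n}. X $$ (w p - 1, l - 1) * Y $$ (l - 1, m - 1))"
      by (rule sum.reindex_bij_witness[of _ "\<lambda>l. l - 1" Suc]) auto
    finally show ?thesis .
  qed
  have "tens X (tens Y \<phi>) w = (\<Sum>p\<in>cells. \<Sum>l\<in>{1..n}. X $$ (w p - 1, l - 1) *
      (\<Sum>q\<in>cells. \<Sum>m\<in>{1..n}. Y $$ ((w(p := l)) q - 1, m - 1) * \<phi> (w(p := l, q := m))))"
    unfolding tens_def[of X] if_P[OF w]
    by (intro sum.cong refl arg_cong2[where f = "(*)"]) (simp add: tens_def words_upd[OF w])
  also have "\<dots> = (\<Sum>p\<in>cells. \<Sum>l\<in>{1..n}. X $$ (w p - 1, l - 1) *
      ((\<Sum>m\<in>{1..n}. Y $$ (l - 1, m - 1) * \<phi> (w(p := m))) +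
       (\<Sum>q\<in>cells - {p}. \<Sum>m\<in>{1..n}. Y $$ (w q - 1, m - 1) * \<phi> (w(p := l, q := m)))))"
  proof (intro sum.cong refl arg_cong2[where f = "(*)"])
    fix p l assume p: "p \<in> cells"
    show "(\<Sum>q\<in>cells. \<Sum>m\<in>{1..n}. Y $$ ((w(p := l)) q - 1, m - 1) * \<phi> (w(p := l, q := m))) =
       (\<Sum>m\<in>{1..n}. Y $$ (l - 1, m - 1) * \<phi> (w(p := m))) +
       (\<Sum>q\<in>cells - {p}. \<Sum>m\<in>{1..n}. Y $$ (w q - 1, m - 1) * \<phi> (w(p := l, q := m)))"
      by (subst sum.remove[OF finite_cells p]) simp
  qed
  also have "\<dots> = (\<Sum>p\<in>cells. \<Sum>l\<in>{1..n}. \<Sum>m\<in>{1..n}. X $$ (w p - 1, l - 1) * Y $$ (l - 1, m - 1) * \<phi> (w(p := m)))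
     + (\<Sum>p\<in>cells. \<Sum>l\<in>{1..n}. \<Sum>q\<in>cells - {p}. \<Sum>m\<in>{1..n}.
         X $$ (w p - 1, l - 1) * Y $$ (w q - 1, m - 1) * \<phi> (w(p := l, q := m)))"
    by (simp add: distrib_left sum.distrib sum_distrib_left mult.assoc)
  also have "(\<Sum>p\<in>cells. \<Sum>l\<in>{1..n}. \<Sum>q\<in>cells - {p}. \<Sum>m\<in>{1..n}.
         X $$ (w p - 1, l - 1) * Y $$ (w q - 1, m - 1) * \<phi> (w(p := l, q := m))) = tens2 X Y \<phi> w"
    unfolding tens2_def by (rule sum.cong[OF refl], rule sum.swap)
  also have "(\<Sum>p\<in>cells. \<Sum>l\<in>{1..n}. \<Sum>m\<in>{1..n}. X $$ (w p - 1, l - 1) * Y $$ (l - 1, m - 1) * \<phi> (w(p := m)))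
     = (\<Sum>p\<in>cells. \<Sum>m\<in>{1..n}. (\<Sum>l\<in>{1..n}. X $$ (w p - 1, l - 1) * Y $$ (l - 1, m - 1)) * \<phi> (w(p := m)))"
    unfolding sum_distrib_right by (rule sum.cong[OF refl], rule sum.swap)
  also have "\<dots> = tens (X * Y) \<phi> w"
    unfolding tens_def if_P[OF w] by (intro sum.cong refl arg_cong2[where f = "(*)"] XY[symmetric])
  finally show ?thesis .
qed

lemma tens_bracket:
  assumes X: "X \<in> carrier_mat n n" and Y: "Y \<in> carrier_mat n n"
  shows "tens (lie_bracket X Y) \<phi> w = tens X (tens Y \<phi>) w - tens Y (tens X \<phi>) w"
proof (cases "w \<in> words")
  case True
  have "tens (X * Y) \<phi> w = tens (lie_bracket X Y + Y * X) \<phi> w"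
  proof -
    have "lie_bracket X Y + Y * X = X * Y"
      using X Y by (intro eq_matI) (auto simp: lie_bracket_def)
    then show ?thesis by simp
  qed
  also have "\<dots> = tens (lie_bracket X Y) \<phi> w + tens (Y * X) \<phi> w"
    using X Y by (intro tens_add_left) (auto simp: lie_bracket_def)
  finally show ?thesis
    using tens_tens[OF X Y True, of \<phi>] tens_tens[OF Y X True, of \<phi>] tens2_commute[of X Y \<phi> w] by simp
qed (simp add: tens_outside)

lemma tens_munit:
  assumes w: "w \<in> words" and ij: "i < n" "j < n"
  shows "tens (munit n i j) \<phi> w = (\<Sum>p\<in>{p\<in>cells. w p = Suc i}. \<phi> (w(p := Suc j)))"
proof -
  have "(\<Sum>l\<in>{1..n}. munit n i j $$ (w p - 1, l - 1) * \<phi> (w(p := l))) =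
      (if w p = Suc i then \<phi> (w(p := Suc j)) else 0)" if p: "p \<in> cells" for p
  proof -
    have "(\<Sum>l\<in>{1..n}. munit n i j $$ (w p - 1, l - 1) * \<phi> (w(p := l))) =
        (\<Sum>l\<in>{1..n}. if l = Suc j then (if w p = Suc i then \<phi> (w(p := l)) else 0) else 0)"
    proof (intro sum.cong refl)
      fix l assume l: "l \<in> {1..n}"
      have "munit n i j $$ (w p - 1, l - 1) = (if w p - 1 = i \<and> l - 1 = j then 1 else 0)"
        using index_range[OF w p] l by (auto simp: munit_def)
      moreover have "w p - 1 = i \<longleftrightarrow> w p = Suc i" "l - 1 = j \<longleftrightarrow> l = Suc j"
        using words_range[OF w p] l by auto
      ultimately show "munit n i j $$ (w p - 1, l - 1) * \<phi> (w(p := l)) =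
          (if l = Suc j then (if w p = Suc i then \<phi> (w(p := l)) else 0) else 0)" by simp
    qed
    also have "\<dots> = (if w p = Suc i then \<phi> (w(p := Suc j)) else 0)" using ij by simp
    finally show ?thesis .
  qed
  then show ?thesis
    using w by (simp add: tens_def sum.If_cases Int_def cong: sum.cong)
qed

lemma tens_diagonal:
  assumes w: "w \<in> words" and h: "h \<in> carrier_mat n n" "diagonal_mat h"
  shows "tens h \<phi> w = (\<Sum>p\<in>cells. h $$ (w p - 1, w p - 1)) * \<phi> w"
proof -
  have "(\<Sum>l\<in>{1..n}. h $$ (w p - 1, l - 1) * \<phi> (w(p := l))) = h $$ (w p - 1, w p - 1) * \<phi> w"
    if p: "p \<in> cells" for p
  proof -
    have "(\<Sum>l\<in>{1..n}. h $$ (w p - 1, l - 1) * \<phi> (w(p := l))) =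
        (\<Sum>l\<in>{1..n}. if l = w p then h $$ (w p - 1, w p - 1) * \<phi> w else 0)"
    proof (intro sum.cong refl)
      fix l assume l: "l \<in> {1..n}"
      show "h $$ (w p - 1, l - 1) * \<phi> (w(p := l)) = (if l = w p then h $$ (w p - 1, w p - 1) * \<phi> w else 0)"
      proof (cases "l = w p")
        case False
        then have "w p - 1 \<noteq> l - 1" using words_range[OF w p] l by auto
        then have "h $$ (w p - 1, l - 1) = 0"
          using h index_range[OF w p] l by (auto simp: diagonal_mat_def)
        then show ?thesis using False by simp
      qed simp
    qed
    then show ?thesis using words_range[OF w p] by simp
  qed
  then show ?thesis using w by (simp add: tens_def sum_distrib_right cong: sum.cong)
qed

lemma tens_comp:
  assumes w: "w \<in> words" and \<sigma>: "\<sigma> permutes cells"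
  shows "tens X \<phi> (w \<circ> \<sigma>) = tens X (\<lambda>w. \<phi> (w \<circ> \<sigma>)) w"
proof -
  let ?f = "\<lambda>p. \<Sum>l\<in>{1..n}. X $$ (w p - 1, l - 1) * \<phi> ((w(p := l)) \<circ> \<sigma>)"
  have upd: "(w \<circ> \<sigma>)(p := l) = (w(\<sigma> p := l)) \<circ> \<sigma>" for p l
    by (rule ext) (simp add: inj_eq[OF permutes_inj[OF \<sigma>]])
  have "tens X \<phi> (w \<circ> \<sigma>) = (\<Sum>p\<in>cells. ?f (\<sigma> p))"
    using words_comp[OF w \<sigma>] by (simp add: tens_def upd[unfolded comp_def] comp_def)
  also have "\<dots> = (\<Sum>p\<in>cells. ?f p)"
    using sum.permute[OF \<sigma>, of ?f] by (simp add: comp_def)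
  finally show ?thesis using w by (simp add: tens_def)
qed

text \<open>The action treats all positions alike and so commutes with permuting them. Every linear
  relation among permuted coordinates thus survives it, which makes \<open>straight\<close> a
  submodule.\<close>

lemma tens_relation:
  assumes fin: "finite I" and g: "\<And>i. i \<in> I \<Longrightarrow> g i permutes cells"
    and rel: "\<And>w. w \<in> words \<Longrightarrow> (\<Sum>i\<in>I. c i * \<phi> (w \<circ> g i)) = 0" and w: "w \<in> words"
  shows "(\<Sum>i\<in>I. c i * tens X \<phi> (w \<circ> g i)) = 0"
proof -
  have "(\<Sum>i\<in>I. c i * tens X \<phi> (w \<circ> g i)) = (\<Sum>i\<in>I. c i * tens X (\<lambda>w. \<phi> (w \<circ> g i)) w)"
    using g w by (simp add: tens_comp)
  also have "\<dots> = (\<Sum>i\<in>I. \<Sum>p\<in>cells. \<Sum>l\<in>{1..n}.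
      X $$ (w p - 1, l - 1) * (c i * \<phi> ((w(p := l)) \<circ> g i)))"
    using w by (simp add: tens_def sum_distrib_left mult.left_commute)
  also have "\<dots> = (\<Sum>p\<in>cells. \<Sum>l\<in>{1..n}. \<Sum>i\<in>I. X $$ (w p - 1, l - 1) * (c i * \<phi> ((w(p := l)) \<circ> g i)))"
    by (subst sum.swap) (intro sum.cong refl sum.swap)
  also have "\<dots> = (\<Sum>p\<in>cells. \<Sum>l\<in>{1..n}. X $$ (w p - 1, l - 1) * (\<Sum>i\<in>I. c i * \<phi> ((w(p := l)) \<circ> g i)))"
    by (simp add: sum_distrib_left)
  also have "\<dots> = 0"
    using rel words_upd[OF w] by (intro sum.neutral ballI) simp
  finally show ?thesis .
qed

section \<open>Column permutations and Garnir relations\<close>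

definition col_perms :: "(nat \<times> nat \<Rightarrow> nat \<times> nat) set" where
  "col_perms = {\<sigma>. \<sigma> permutes cells \<and> (\<forall>p. fst (\<sigma> p) = fst p)}"

lemma col_permsD:
  assumes "\<sigma> \<in> col_perms"
  shows "\<sigma> permutes cells" "fst (\<sigma> p) = fst p"
  using assms unfolding col_perms_def by blast+

lemma finite_col_perms [simp]: "finite col_perms"
  unfolding col_perms_def by (rule finite_subset[OF _ finite_permutations[of cells]]) auto

lemma id_col_perms [simp]: "id \<in> col_perms"
  by (simp add: col_perms_def permutes_id)

lemma col_perms_comp: "\<sigma> \<in> col_perms \<Longrightarrow> \<tau> \<in> col_perms \<Longrightarrow> \<sigma> \<circ> \<tau> \<in> col_perms"
proof -
  assume s: "\<sigma> \<in> col_perms" "\<tau> \<in> col_perms"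
  have "fst ((\<sigma> \<circ> \<tau>) p) = fst p" for p using col_permsD(2)[OF s(1)] col_permsD(2)[OF s(2)] by simp
  moreover have "\<sigma> \<circ> \<tau> permutes cells" using s by (intro permutes_compose col_permsD)
  ultimately show ?thesis unfolding col_perms_def by blast
qed

lemma col_perms_inv: "\<sigma> \<in> col_perms \<Longrightarrow> inv_into UNIV \<sigma> \<in> col_perms"
proof -
  assume s: "\<sigma> \<in> col_perms"
  have "fst (inv_into UNIV \<sigma> p) = fst p" for p
    using col_permsD(2)[OF s, of "inv_into UNIV \<sigma> p"] permutes_inverses(1)[OF col_permsD(1)[OF s]] by simp
  then show ?thesis using permutes_inv[OF col_permsD(1)[OF s]] unfolding col_perms_def by blast
qed

lemma col_perms_transpose:
  assumes "p \<in> cells" "q \<in> cells" "fst p = fst q"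
  shows "Transposition.transpose p q \<in> col_perms"
proof -
  have "fst (Transposition.transpose p q r) = fst r" for r
    using assms(3) by (simp add: Transposition.transpose_def)
  then show ?thesis using permutes_swap_id[OF assms(1,2)] unfolding col_perms_def by blast
qed

lemma permutation_cells: "\<sigma> permutes cells \<Longrightarrow> permutation \<sigma>"
  using finite_cells by (rule permutes_imp_permutation)

definition csign :: "(nat \<times> nat \<Rightarrow> nat \<times> nat) \<Rightarrow> complex" where
  "csign \<sigma> = of_int (sign \<sigma>)"

lemma csign_comp: "\<sigma> permutes cells \<Longrightarrow> \<tau> permutes cells \<Longrightarrow> csign (\<sigma> \<circ> \<tau>) = csign \<sigma> * csign \<tau>"
  by (simp add: csign_def sign_compose permutation_cells)

lemma csign_sq [simp]: "csign \<sigma> * csign \<sigma> = 1"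
  unfolding csign_def of_int_mult[symmetric] by simp

abbreviation alternate :: "(nat \<times> nat) set \<Rightarrow> tensor \<Rightarrow> filling \<Rightarrow> complex" where
  "alternate Y \<phi> w \<equiv> \<Sum>\<sigma> | \<sigma> permutes Y. csign \<sigma> * \<phi> (w \<circ> \<sigma>)"

text \<open>Column antisymmetry and the Garnir relations.\<close>

definition straight :: "tensor set" where
  "straight = {\<phi>. (\<forall>w. w \<notin> words \<longrightarrow> \<phi> w = 0) \<and>
     (\<forall>\<sigma>\<in>col_perms. \<forall>w\<in>words. \<phi> (w \<circ> \<sigma>) = csign \<sigma> * \<phi> w) \<and>
     (\<forall>s Y. Y \<subseteq> {p\<in>cells. s \<le> fst p} \<and> col_len s < card Y \<longrightarrow>
       (\<forall>w\<in>words. alternate Y \<phi> w = 0))}"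

lemma straight_outside: "\<phi> \<in> straight \<Longrightarrow> w \<notin> words \<Longrightarrow> \<phi> w = 0"
  unfolding straight_def by blast

lemma straight_col: "\<phi> \<in> straight \<Longrightarrow> \<sigma> \<in> col_perms \<Longrightarrow> w \<in> words \<Longrightarrow> \<phi> (w \<circ> \<sigma>) = csign \<sigma> * \<phi> w"
  unfolding straight_def by blast

lemma straight_garnir:
  "\<phi> \<in> straight \<Longrightarrow> Y \<subseteq> {p\<in>cells. s \<le> fst p} \<Longrightarrow> col_len s < card Y \<Longrightarrow> w \<in> words \<Longrightarrow>
    alternate Y \<phi> w = 0"
  unfolding straight_def by blast

lemma tens_straight:
  assumes \<phi>: "\<phi> \<in> straight"
  shows "tens X \<phi> \<in> straight"
proof -
  have "tens X \<phi> (w \<circ> \<sigma>) = csign \<sigma> * tens X \<phi> w" if \<sigma>: "\<sigma> \<in> col_perms" and w: "w \<in> words" for \<sigma> w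
  proof -
    \<comment> \<open>Antisymmetry brought into the form of a relation with two terms, indexed by
      truth values.\<close>
    let ?g = "\<lambda>b. if b then \<sigma> else id" and ?c = "\<lambda>b. if b then 1 else - csign \<sigma>"
    have "(\<Sum>b\<in>{True, False}. ?c b * tens X \<phi> (w \<circ> ?g b)) = 0"
      by (rule tens_relation[OF _ _ _ w]) (use straight_col[OF \<phi> \<sigma>] col_permsD[OF \<sigma>] in \<open>auto simp: permutes_id\<close>)
    then show ?thesis by simp
  qed
  moreover have "alternate Y (tens X \<phi>) w = 0"
    if Y: "Y \<subseteq> {p\<in>cells. s \<le> fst p}" "col_len s < card Y" and w: "w \<in> words" for s Y w
  proof (rule tens_relation[OF _ _ _ w])
    have Yc: "Y \<subseteq> cells" using Y by auto
    then show "finite {\<sigma>. \<sigma> permutes Y}" by (intro finite_permutations) (auto intro: finite_subset)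
    show "\<sigma> permutes cells" if "\<sigma> \<in> {\<sigma>. \<sigma> permutes Y}" for \<sigma>
      using that Yc by (auto intro: permutes_subset)
  qed (rule straight_garnir[OF \<phi> Y])
  ultimately show ?thesis unfolding straight_def using tens_outside by blast
qed

lemma straight_repeat:
  assumes \<phi>: "\<phi> \<in> straight" and w: "w \<in> words" and pq: "p \<in> cells" "q \<in> cells" "fst p = fst q" "p \<noteq> q"
    and eq: "w p = w q"
  shows "\<phi> w = 0"
proof -
  have "w \<circ> Transposition.transpose p q = w"
    using eq by (auto simp: fun_eq_iff Transposition.transpose_def)
  then have "\<phi> w = csign (Transposition.transpose p q) * \<phi> w"
    using straight_col[OF \<phi> col_perms_transpose[OF pq(1,2,3)] w] by simp
  then show ?thesis using pq(4) by (simp add: csign_def sign_swap_id)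
qed


lemma cells_le_col_len: "(s, r) \<in> cells \<longleftrightarrow> r \<in> {1..col_len s}"
  using le_col_len_iff[of r s] by (auto simp: cells_def)

lemma cells_up: "(s, r) \<in> cells \<Longrightarrow> 1 \<le> r' \<Longrightarrow> r' \<le> r \<Longrightarrow> s' \<le> s \<Longrightarrow> (s', r') \<in> cells"
  using part_mono[of r' r] by (auto simp: cells_def)

section \<open>The highest weight tensor\<close>

definition top_word :: "filling" where
  "top_word = restrict snd cells"

lemma top_word_apply [simp]: "p \<in> cells \<Longrightarrow> top_word p = snd p"
  by (simp add: top_word_def)

lemma top_word_in_words [simp]: "top_word \<in> words"
  unfolding words_def using cellsD by (intro PiE_I) (force simp: top_word_def)+

abbreviation col_fit :: "(nat \<times> nat \<Rightarrow> nat \<times> nat) \<Rightarrow> filling \<Rightarrow> complex" where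
  "col_fit \<sigma> w \<equiv> if \<forall>p\<in>cells. w p = snd (\<sigma> p) then csign \<sigma> else 0"

text \<open>The tensor product, over all columns, of the antisymmetrization of e_1, ..., e_r for a
  column of length r. At most one \<sigma> contributes at a given word, so every coordinate is 0, 1
  or -1.\<close>

definition hwv :: tensor where
  "hwv w = (if w \<in> words
     then \<Sum>\<sigma>\<in>col_perms. col_fit \<sigma> w else 0)"

lemma col_perms_in_cells: "\<sigma> \<in> col_perms \<Longrightarrow> p \<in> cells \<Longrightarrow> \<sigma> p \<in> cells"
  using permutes_in_image[OF col_permsD(1)] by blast

lemma col_perms_eqI:
  assumes s: "\<sigma> \<in> col_perms" and t: "\<tau> \<in> col_perms" and eq: "\<And>p. p \<in> cells \<Longrightarrow> snd (\<sigma> p) = snd (\<tau> p)"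
  shows "\<sigma> = \<tau>"
proof
  fix p show "\<sigma> p = \<tau> p"
  proof (cases "p \<in> cells")
    case True
    then show ?thesis using eq col_permsD(2)[OF s, of p] col_permsD(2)[OF t, of p]
      by (simp add: prod_eq_iff)
  next
    case False
    then show ?thesis using permutes_not_in[OF col_permsD(1)[OF s]] permutes_not_in[OF col_permsD(1)[OF t]]
      by simp
  qed
qed

lemma hwv_nonzeroD:
  assumes "hwv w \<noteq> 0"
  shows "w \<in> words" "\<exists>\<sigma>\<in>col_perms. \<forall>p\<in>cells. w p = snd (\<sigma> p)"
proof -
  show "w \<in> words"
  proof (rule ccontr)
    assume "w \<notin> words"
    then have "hwv w = 0" by (simp only: hwv_def if_False)
    then show False using assms by simp
  qed
  show "\<exists>\<sigma>\<in>col_perms. \<forall>p\<in>cells. w p = snd (\<sigma> p)"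
  proof (rule ccontr)
    assume "\<not> ?thesis"
    then have "(\<Sum>\<sigma>\<in>col_perms. col_fit \<sigma> w) = 0"
      by (intro sum.neutral ballI if_not_P) blast
    then show False using assms by (simp add: hwv_def split: if_splits)
  qed
qed

lemma hwv_comp:
  assumes w: "w \<in> words" and \<tau>: "\<tau> \<in> col_perms"
  shows "hwv (w \<circ> \<tau>) = csign \<tau> * hwv w"
proof -
  let ?i = "inv_into UNIV \<tau>"
  note p\<tau> = col_permsD(1)[OF \<tau>]
  have "(\<Sum>\<sigma>\<in>col_perms. col_fit \<sigma> (w \<circ> \<tau>))
      = (\<Sum>\<sigma>\<in>col_perms. csign \<tau> * col_fit \<sigma> w)"
  proof (rule sum.reindex_bij_witness[of _ "\<lambda>\<sigma>. \<sigma> \<circ> \<tau>" "\<lambda>\<sigma>. \<sigma> \<circ> ?i"])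
    fix \<sigma> assume s: "\<sigma> \<in> col_perms"
    show "\<sigma> \<circ> \<tau> \<circ> ?i = \<sigma>" "\<sigma> \<circ> ?i \<circ> \<tau> = \<sigma>"
      using permutes_inv_o[OF p\<tau>] by (simp_all add: comp_assoc)
    show "\<sigma> \<circ> ?i \<in> col_perms" "\<sigma> \<circ> \<tau> \<in> col_perms"
      using s \<tau> by (auto intro: col_perms_comp col_perms_inv)
    have "(\<forall>p\<in>cells. w p = snd ((\<sigma> \<circ> ?i) p)) \<longleftrightarrow> (\<forall>p\<in>cells. (w \<circ> \<tau>) p = snd (\<sigma> p))"
    proof
      assume *: "\<forall>p\<in>cells. w p = snd ((\<sigma> \<circ> ?i) p)"
      show "\<forall>p\<in>cells. (w \<circ> \<tau>) p = snd (\<sigma> p)"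
      proof
        fix p assume "p \<in> cells"
        then show "(w \<circ> \<tau>) p = snd (\<sigma> p)"
          using bspec[OF * col_perms_in_cells[OF \<tau>]] permutes_inverses(2)[OF p\<tau>] by simp
      qed
    next
      assume *: "\<forall>p\<in>cells. (w \<circ> \<tau>) p = snd (\<sigma> p)"
      show "\<forall>p\<in>cells. w p = snd ((\<sigma> \<circ> ?i) p)"
      proof
        fix p assume "p \<in> cells"
        then show "w p = snd ((\<sigma> \<circ> ?i) p)"
          using bspec[OF * col_perms_in_cells[OF col_perms_inv[OF \<tau>]]] permutes_inverses(1)[OF p\<tau>] by simp
      qed
    qed
    moreover have "csign \<tau> * csign (\<sigma> \<circ> ?i) = csign \<sigma>"
    proof -
      have "csign \<sigma> = csign ((\<sigma> \<circ> ?i) \<circ> \<tau>)" using permutes_inv_o[OF p\<tau>] by (simp add: comp_assoc)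
      also have "\<dots> = csign (\<sigma> \<circ> ?i) * csign \<tau>"
        using s \<tau> by (intro csign_comp col_permsD col_perms_comp col_perms_inv)
      finally show ?thesis by simp
    qed
    ultimately show "csign \<tau> * col_fit (\<sigma> \<circ> ?i) w =
        col_fit \<sigma> (w \<circ> \<tau>)"
      by (simp only: if_distrib[of "\<lambda>x. csign \<tau> * x"] mult_zero_right)
  qed
  then show ?thesis
    using w words_comp[OF w p\<tau>] by (simp only: hwv_def if_True sum_distrib_left)
qed

lemma hwv_top: "hwv top_word = 1"
proof -
  have "col_fit \<sigma> top_word = (if \<sigma> = id then 1 else 0)"
    if s: "\<sigma> \<in> col_perms" for \<sigma>
  proof (cases "\<sigma> = id")
    case False
    then have "\<not> (\<forall>p\<in>cells. top_word p = snd (\<sigma> p))"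
      using col_perms_eqI[OF s id_col_perms] by (metis top_word_apply id_apply)
    then show ?thesis unfolding if_not_P[OF False] by (rule if_not_P)
  qed (simp add: csign_def)
  then have "(\<Sum>\<sigma>\<in>col_perms. col_fit \<sigma> top_word) = (\<Sum>\<sigma>\<in>col_perms. if \<sigma> = id then 1 else 0)"
    by (rule sum.cong[OF refl])
  then show ?thesis by (simp add: hwv_def)
qed

text \<open>Composing with the transposition of p and q leaves the permuted word unchanged and
  reverses the sign, so the sum equals its own negative.\<close>

lemma garnir_alternating:
  fixes \<phi> :: tensor
  assumes Y: "Y \<subseteq> cells" and pq: "p \<in> Y" "q \<in> Y" "p \<noteq> q" "w p = w q"
  shows "alternate Y \<phi> w = 0"
proof -
  let ?T = "Transposition.transpose p q"
  have T: "?T permutes Y" using pq by (intro permutes_swap_id)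
  have wT: "w \<circ> ?T = w"
  proof
    fix x show "(w \<circ> ?T) x = w x"
      using pq(4) by (cases "x = p"; cases "x = q") simp_all
  qed
  let ?S = "alternate Y \<phi> w"
  have "?S = (\<Sum>\<sigma> | \<sigma> permutes Y. - (csign \<sigma> * \<phi> (w \<circ> \<sigma>)))"
  proof (rule sum.reindex_bij_witness[of _ "\<lambda>\<sigma>. ?T \<circ> \<sigma>" "\<lambda>\<sigma>. ?T \<circ> \<sigma>"])
    fix \<sigma> assume s: "\<sigma> \<in> {\<sigma>. \<sigma> permutes Y}"
    show "?T \<circ> (?T \<circ> \<sigma>) = \<sigma>" by (simp add: comp_assoc[symmetric])
    then show "?T \<circ> (?T \<circ> \<sigma>) = \<sigma>" .
    show "?T \<circ> \<sigma> \<in> {\<sigma>. \<sigma> permutes Y}" using s T by (auto intro: permutes_compose)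
    then show "?T \<circ> \<sigma> \<in> {\<sigma>. \<sigma> permutes Y}" .
    have "csign (?T \<circ> \<sigma>) = - csign \<sigma>"
      using csign_comp[of ?T \<sigma>] permutes_subset[OF T Y] s Y pq(3)
      by (auto simp: csign_def sign_swap_id intro: permutes_subset)
    moreover have "w \<circ> (?T \<circ> \<sigma>) = w \<circ> \<sigma>" using wT by (simp add: comp_assoc[symmetric])
    ultimately show "- (csign (?T \<circ> \<sigma>) * \<phi> (w \<circ> (?T \<circ> \<sigma>))) = csign \<sigma> * \<phi> (w \<circ> \<sigma>)" by simp
  qed
  then have "?S = - ?S" by (simp only: sum_negf)
  then show ?thesis by simp
qed

text \<open>Wherever \<open>hwv\<close> is nonzero, the columns from s on carry only letters up to
  \<open>col_len s\<close>. A word injective on Y has too many letters for that, so every term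
  vanishes; a word with a repetition on Y is settled by \<open>garnir_alternating\<close>.\<close>

lemma hwv_straight: "hwv \<in> straight"
proof -
  have "alternate Y hwv w = 0"
    if Y: "Y \<subseteq> {p\<in>cells. s \<le> fst p}" "col_len s < card Y" and w: "w \<in> words" for s Y w
  proof (cases "inj_on w Y")
    case False
    then obtain p q where "p \<in> Y" "q \<in> Y" "p \<noteq> q" "w p = w q" by (auto simp: inj_on_def)
    then show ?thesis using Y by (intro garnir_alternating[of Y p q]) auto
  next
    case True
    have "\<not> w ` Y \<subseteq> {1..col_len s}"
    proof
      assume "w ` Y \<subseteq> {1..col_len s}"
      from card_mono[OF _ this] show False using card_image[OF True] Y(2) by simp
    qed
    then obtain p where p: "p \<in> Y" "w p \<notin> {1..col_len s}" by blast
    have "hwv (w \<circ> \<sigma>) = 0" if s: "\<sigma> permutes Y" for \<sigma>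
    proof (rule ccontr)
      assume "hwv (w \<circ> \<sigma>) \<noteq> 0"
      from hwv_nonzeroD(2)[OF this] obtain \<tau> where t: "\<tau> \<in> col_perms" "\<forall>p\<in>cells. (w \<circ> \<sigma>) p = snd (\<tau> p)" by blast
      define q where "q = inv_into UNIV \<sigma> p"
      have "\<sigma> q = p" using permutes_inverses(1)[OF s] by (simp add: q_def)
      moreover have "q \<in> Y" using permutes_in_image[OF s, of q] p(1) \<open>\<sigma> q = p\<close> by simp
      ultimately have q: "w p = snd (\<tau> q)" "q \<in> cells" "s \<le> fst q" using t(2) Y by auto
      then have "(fst q, snd (\<tau> q)) \<in> cells"
        using col_perms_in_cells[OF t(1) q(2)] col_permsD(2)[OF t(1), of q] by (metis prod.collapse)
      then have "(s, snd (\<tau> q)) \<in> cells" using q(3) by (auto simp: cells_def)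
      then show False using p(2) q(1) by (simp add: cells_le_col_len)
    qed
    then show ?thesis by (intro sum.neutral) auto
  qed
  moreover have "hwv w = 0" if "w \<notin> words" for w using that by (simp add: hwv_def)
  ultimately show ?thesis unfolding straight_def using hwv_comp by blast
qed

subsection \<open>Straightening\<close>

definition standard_words :: "filling set" where
  "standard_words = {w\<in>words.
     (\<forall>s r. (s, r) \<in> cells \<and> (s, Suc r) \<in> cells \<longrightarrow> w (s, r) < w (s, Suc r)) \<and>
     (\<forall>s r. (s, r) \<in> cells \<and> (Suc s, r) \<in> cells \<longrightarrow> w (s, r) \<le> w (Suc s, r))}"

lemma column_strict:
  assumes w: "\<And>s r. (s, r) \<in> cells \<Longrightarrow> (s, Suc r) \<in> cells \<Longrightarrow> w (s, r) < (w (s, Suc r) :: nat)"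
    and r: "1 \<le> r" "r \<le> r'" "(s, r') \<in> cells"
  shows "w (s, r) + (r' - r) \<le> w (s, r')"
  using r(2,3)
proof (induction r' rule: dec_induct)
  case (step m)
  have "(s, m) \<in> cells" using cells_up[OF step.prems, of m s] step r by simp
  then show ?case using step w[of s m] by fastforce
qed simp

lemma sum_less_of_exchange:
  fixes f :: "'b \<Rightarrow> nat"
  assumes fin: "finite D" "finite E" and card: "card D = card E" and ne: "D \<noteq> E"
    and D: "\<And>x. x \<in> D - E \<Longrightarrow> b < f x" and E: "\<And>y. y \<in> E \<Longrightarrow> f y \<le> b"
  shows "sum f E < sum f D"
proof -
  have c: "card (D - E) = card (E - D)"
    using card card_Diff_subset_Int[of D E] card_Diff_subset_Int[of E D] fin by (simp add: Int_commute)
  have "D - E \<noteq> {}"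
  proof
    assume "D - E = {}"
    then have "D \<subseteq> E" by blast
    then show False using card_subset_eq[OF fin(2)] card ne by blast
  qed
  then have pos: "0 < card (D - E)" using fin by (simp add: card_gt_0_iff)
  have "sum f (E - D) \<le> card (E - D) * b" using sum_bounded_above[of "E - D" f b] E by simp
  also have "\<dots> < card (D - E) * Suc b" using pos c by simp
  also have "\<dots> \<le> sum f (D - E)"
    using sum_bounded_below[of "D - E" "Suc b" f] D by (simp add: Suc_le_eq)
  finally have "sum f (E - D) < sum f (D - E)" .
  then show ?thesis
    using sum.Int_Diff[OF fin(2), of f D] sum.Int_Diff[OF fin(1), of f E] by (simp add: Int_commute)
qed

text \<open>The two measures of straightening: \<open>col_weight\<close> grows when large letters
  move right, \<open>row_weight\<close> when they move down.\<close>

definition col_weight :: "filling \<Rightarrow> nat" where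
  "col_weight w = (\<Sum>p\<in>cells. fst p * w p)"

definition row_weight :: "filling \<Rightarrow> nat" where
  "row_weight w = (\<Sum>p\<in>cells. snd p * w p)"

lemma col_weight_comp:
  assumes "\<sigma> \<in> col_perms"
  shows "col_weight (w \<circ> \<sigma>) = col_weight w"
proof -
  have "col_weight (w \<circ> \<sigma>) = (\<Sum>p\<in>cells. fst (\<sigma> p) * w (\<sigma> p))"
    unfolding col_weight_def by (simp add: col_permsD(2)[OF assms])
  also have "\<dots> = col_weight w"
    unfolding col_weight_def
    using sum.permute[OF col_permsD(1)[OF assms], of "\<lambda>p. fst p * w p"] by (simp add: comp_def)
  finally show ?thesis .
qed

lemma row_weight_swap:
  assumes c: "(s, r) \<in> cells" "(s, Suc r) \<in> cells" and less: "w (s, Suc r) < w (s, r)"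
  shows "row_weight w < row_weight (w \<circ> Transposition.transpose (s, r) (s, Suc r))"
proof -
  let ?R = "cells - {(s, r), (s, Suc r)}" and ?T = "Transposition.transpose (s, r) (s, Suc r)"
  have split: "row_weight u = r * u (s, r) + (Suc r * u (s, Suc r) + (\<Sum>p\<in>?R. snd p * u p))" for u
  proof -
    have "row_weight u = r * u (s, r) + (\<Sum>p\<in>cells - {(s, r)}. snd p * u p)"
      unfolding row_weight_def by (subst sum.remove[OF finite_cells c(1)]) simp
    also have "(\<Sum>p\<in>cells - {(s, r)}. snd p * u p) = Suc r * u (s, Suc r) + (\<Sum>p\<in>?R. snd p * u p)"
      using c by (subst sum.remove[of _ "(s, Suc r)"]) (auto intro!: sum.cong)
    finally show ?thesis .
  qed
  have "(\<Sum>p\<in>?R. snd p * (w \<circ> ?T) p) = (\<Sum>p\<in>?R. snd p * w p)"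
    by (intro sum.cong refl) (auto simp: Transposition.transpose_def)
  then show ?thesis using less by (simp add: split)
qed

text \<open>The letters on \<open>Y1\<close> all exceed those on \<open>Y2\<close>, so whatever
  enters the right column is larger than what leaves it, while the total over both columns is
  unchanged.\<close>

lemma col_weight_exchange:
  assumes Y: "Y1 \<subseteq> {p\<in>cells. fst p = s}" "Y2 \<subseteq> {p\<in>cells. fst p = Suc s}"
    and \<sigma>: "\<sigma> permutes (Y1 \<union> Y2)" and ne: "\<sigma> ` Y2 \<noteq> Y2"
    and Y1: "\<And>x. x \<in> Y1 \<Longrightarrow> b < w x" and Y2: "\<And>x. x \<in> Y2 \<Longrightarrow> w x \<le> b"
  shows "col_weight w < col_weight (w \<circ> \<sigma>)"
proof -
  let ?Y = "Y1 \<union> Y2"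
  have Yc: "?Y \<subseteq> cells" using Y by auto
  have fin: "finite Y1" "finite Y2" using Yc finite_subset[OF _ finite_cells] by auto
  have disj: "Y1 \<inter> Y2 = {}" using Y by fastforce
  have split: "col_weight u = (\<Sum>p\<in>cells - ?Y. fst p * u p) + (s * sum u ?Y + sum u Y2)" for u
  proof -
    have "col_weight u = (\<Sum>p\<in>cells - ?Y. fst p * u p) + (\<Sum>p\<in>?Y. fst p * u p)"
      unfolding col_weight_def by (rule sum.subset_diff[OF Yc finite_cells])
    also have "(\<Sum>p\<in>?Y. fst p * u p) = (\<Sum>p\<in>Y1. fst p * u p) + (\<Sum>p\<in>Y2. fst p * u p)"
      using fin disj by (rule sum.union_disjoint)
    also have "(\<Sum>p\<in>Y1. fst p * u p) = (\<Sum>p\<in>Y1. s * u p)" using Y by (intro sum.cong) auto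
    also have "(\<Sum>p\<in>Y2. fst p * u p) = (\<Sum>p\<in>Y2. s * u p + u p)" using Y by (intro sum.cong) auto
    also have "(\<Sum>p\<in>Y1. s * u p) + (\<Sum>p\<in>Y2. s * u p + u p) = s * sum u ?Y + sum u Y2"
      using sum.union_disjoint[OF fin disj, of u]
      by (simp add: sum.distrib sum_distrib_left[symmetric] distrib_left)
    finally show ?thesis .
  qed
  have "(\<Sum>p\<in>cells - ?Y. fst p * (w \<circ> \<sigma>) p) = (\<Sum>p\<in>cells - ?Y. fst p * w p)"
    using permutes_not_in[OF \<sigma>] by (intro sum.cong) auto
  moreover have "sum (w \<circ> \<sigma>) ?Y = sum w ?Y" using sum.permute[OF \<sigma>, of w] by simp
  moreover have "sum w Y2 < sum (w \<circ> \<sigma>) Y2"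
  proof -
    have inj: "inj_on \<sigma> Y2" using permutes_inj_on[OF \<sigma>] .
    have sub: "\<sigma> ` Y2 \<subseteq> ?Y" using permutes_image[OF \<sigma>] by blast
    have "sum w Y2 < sum w (\<sigma> ` Y2)"
      by (rule sum_less_of_exchange[of _ _ b]) (use fin ne sub Y1 Y2 card_image[OF inj] in auto)
    also have "\<dots> = sum (w \<circ> \<sigma>) Y2" by (rule sum.reindex[OF inj])
    finally show ?thesis .
  qed
  ultimately show ?thesis by (simp only: split)
qed

text \<open>Straightening in dual form: vanishing is propagated from words of larger
  \<open>col_weight\<close>, and for equal \<open>col_weight\<close> of larger
  \<open>row_weight\<close>. A descent in a column is treated by antisymmetry, a descent in a row by
  a Garnir relation whose remaining terms all have larger \<open>col_weight\<close>.\<close>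

lemma straight_zero:
  assumes \<phi>: "\<phi> \<in> straight" and std: "\<And>w. w \<in> standard_words \<Longrightarrow> \<phi> w = 0" and w: "w \<in> words"
  shows "\<phi> w = 0"
proof -
  define B where "B = (\<Sum>p\<in>cells. fst p * n)"
  define B' where "B' = (\<Sum>p\<in>cells. snd p * n)"
  have bound: "col_weight u \<le> B" "row_weight u \<le> B'" if "u \<in> words" for u
    using words_range[OF that] unfolding B_def B'_def col_weight_def row_weight_def
    by (auto intro!: sum_mono mult_le_mono2)
  have "wf (measures [\<lambda>w. B - col_weight w, \<lambda>w. B' - row_weight w])" by simp
  then show ?thesis using w
  proof (induction w rule: wf_induct_rule)
    case (less w)
    have IH: "\<phi> u = 0" if "u \<in> words" "col_weight w < col_weight u" for u
    proof -
      have "B - col_weight u < B - col_weight w" using bound(1)[OF that(1)] that(2) by linarith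
      then show ?thesis using less.IH[OF _ that(1)] by simp
    qed
    have IH': "\<phi> u = 0" if "u \<in> words" "col_weight w = col_weight u" "row_weight w < row_weight u" for u
    proof -
      have "B' - row_weight u < B' - row_weight w" using bound(2)[OF that(1)] that(3) by linarith
      then show ?thesis using less.IH[OF _ that(1)] that(2) by simp
    qed
    show ?case
    proof (cases "\<exists>s r. (s, r) \<in> cells \<and> (s, Suc r) \<in> cells \<and> w (s, Suc r) \<le> w (s, r)")
      case True
      then obtain s r where c: "(s, r) \<in> cells" "(s, Suc r) \<in> cells" and le: "w (s, Suc r) \<le> w (s, r)"
        by blast
      show ?thesis
      proof (cases "w (s, Suc r) = w (s, r)")
        case True
        then show ?thesis using straight_repeat[OF \<phi> less.prems c] by simp
      next
        case False
        let ?T = "Transposition.transpose (s, r) (s, Suc r)"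
        have T: "?T \<in> col_perms" using c by (intro col_perms_transpose) auto
        have "\<phi> (w \<circ> ?T) = 0"
          using col_weight_comp[OF T, of w] row_weight_swap[OF c, of w] le False
          by (intro IH' words_comp less.prems col_permsD(1)[OF T]) auto
        then have "csign ?T * \<phi> w = 0" using straight_col[OF \<phi> T less.prems] by simp
        then show ?thesis by (simp add: csign_def)
      qed
    next
      case False
      then have strict: "w (s, r) < w (s, Suc r)" if "(s, r) \<in> cells" "(s, Suc r) \<in> cells" for s r
        using that not_le by blast
      show ?thesis
      proof (cases "\<exists>s r. (s, r) \<in> cells \<and> (Suc s, r) \<in> cells \<and> w (Suc s, r) < w (s, r)")
        case False
        then have "w \<in> standard_words"
          using less.prems strict by (auto simp: standard_words_def not_less)
        then show ?thesis by (rule std)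
      next
        case True
        then obtain s r where c: "(s, r) \<in> cells" "(Suc s, r) \<in> cells" and lt: "w (Suc s, r) < w (s, r)"
          by blast
        \<comment> \<open>The Garnir set of the row descent: column s from row r down and column
          \<open>Suc s\<close> from the top to row r. It has one cell more than column s, and strict
          columns put b = \<open>w (Suc s, r)\<close> between the letters of the two halves.\<close>
        define Y1 where "Y1 = Pair s ` {r..col_len s}"
        define Y2 where "Y2 = Pair (Suc s) ` {1..r}"
        have r: "1 \<le> r" "r \<le> col_len s" "r \<le> col_len (Suc s)" using c by (auto simp: cells_le_col_len)
        have Y1: "Y1 \<subseteq> {p\<in>cells. fst p = s}" using r by (auto simp: Y1_def cells_le_col_len)
        have Y2: "Y2 \<subseteq> {p\<in>cells. fst p = Suc s}" using r by (auto simp: Y2_def cells_le_col_len)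
        have disj: "Y1 \<inter> Y2 = {}" by (auto simp: Y1_def Y2_def)
        have "card (Y1 \<union> Y2) = card Y1 + card Y2"
          using disj by (intro card_Un_disjoint) (auto simp: Y1_def Y2_def)
        then have cardY: "col_len s < card (Y1 \<union> Y2)"
          using r by (simp add: Y1_def Y2_def card_image inj_on_def)
        have w1: "w (Suc s, r) < w x" if "x \<in> Y1" for x
        proof -
          obtain r' where "x = (s, r')" "r \<le> r'" "(s, r') \<in> cells"
            using \<open>x \<in> Y1\<close> r by (auto simp: Y1_def cells_le_col_len)
          then show ?thesis using column_strict[of w r r' s] strict r(1) lt by fastforce
        qed
        have w2: "w x \<le> w (Suc s, r)" if "x \<in> Y2" for x
        proof -
          obtain r' where "x = (Suc s, r')" "1 \<le> r'" "r' \<le> r"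
            using \<open>x \<in> Y2\<close> by (auto simp: Y2_def)
          then show ?thesis using column_strict[of w r' r "Suc s"] strict c(2) by fastforce
        qed
        let ?P = "{\<sigma>. \<sigma> permutes Y1 \<union> Y2}"
        \<comment> \<open>A permutation that keeps \<open>Y2\<close> respects columns, and its sign
          cancels against antisymmetry; any other reaches a word of larger
          \<open>col_weight\<close>. The relation thus becomes a positive multiple of
          \<open>\<phi> w\<close>, the identity being among the permutations counted.\<close>
        have summand: "csign \<sigma> * \<phi> (w \<circ> \<sigma>) = (if \<sigma> ` Y2 = Y2 then \<phi> w else 0)" if s: "\<sigma> \<in> ?P" for \<sigma>
        proof (cases "\<sigma> ` Y2 = Y2")
          case True
          have s': "\<sigma> permutes Y1 \<union> Y2" using s by simp
          have "fst (\<sigma> p) = fst p" for p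
          proof -
            consider "p \<in> Y1" | "p \<in> Y2" | "p \<notin> Y1 \<union> Y2" by blast
            then show ?thesis
            proof cases
              case 1
              have "\<sigma> p \<notin> Y2"
              proof
                assume "\<sigma> p \<in> Y2"
                then obtain q where "q \<in> Y2" "\<sigma> p = \<sigma> q" using True by (metis imageE)
                then show False using 1 disj permutes_inj[OF s'] by (auto dest: injD)
              qed
              then have "\<sigma> p \<in> Y1" using permutes_in_image[OF s', of p] 1 by blast
              then show ?thesis using subsetD[OF Y1, of p] subsetD[OF Y1, of "\<sigma> p"] 1 by simp
            next
              case 2
              then have "\<sigma> p \<in> Y2" using True by blast
              then show ?thesis using subsetD[OF Y2, of p] subsetD[OF Y2, of "\<sigma> p"] 2 by simp
            next
              case 3 then show ?thesis using permutes_not_in[OF s'] by simp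
            qed
          qed
          moreover have "\<sigma> permutes cells" using permutes_subset[OF s'] Y1 Y2 by blast
          ultimately have "\<sigma> \<in> col_perms" unfolding col_perms_def by blast
          then show ?thesis
            using True straight_col[OF \<phi> _ less.prems] by (simp add: mult.assoc[symmetric])
        next
          case False
          have "\<sigma> permutes cells" using s permutes_subset[of \<sigma> "Y1 \<union> Y2" cells] Y1 Y2 by blast
          moreover have "col_weight w < col_weight (w \<circ> \<sigma>)"
            using col_weight_exchange[OF Y1 Y2 _ False w1 w2] s by simp
          ultimately have "\<phi> (w \<circ> \<sigma>) = 0" using IH words_comp[OF less.prems] by blast
          then show ?thesis using False by simp
        qed
        have finP: "finite ?P" by (rule finite_permutations) (auto simp: Y1_def Y2_def)
        have "(\<Sum>\<sigma>\<in>?P. csign \<sigma> * \<phi> (w \<circ> \<sigma>)) = 0"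
          using Y1 Y2 by (intro straight_garnir[OF \<phi> _ cardY less.prems]) auto
        then have "(\<Sum>\<sigma>\<in>?P. if \<sigma> ` Y2 = Y2 then \<phi> w else 0) = 0"
          by (simp only: summand cong: sum.cong)
        then have "of_nat (card {\<sigma>\<in>?P. \<sigma> ` Y2 = Y2}) * \<phi> w = 0"
          using finP by (simp add: sum.If_cases Int_def)
        moreover have "card {\<sigma>\<in>?P. \<sigma> ` Y2 = Y2} \<noteq> 0"
        proof -
          have "id \<in> {\<sigma>\<in>?P. \<sigma> ` Y2 = Y2}" by (simp add: permutes_id)
          moreover have "finite {\<sigma>\<in>?P. \<sigma> ` Y2 = Y2}" using finP by simp
          ultimately have "0 < card {\<sigma>\<in>?P. \<sigma> ` Y2 = Y2}" unfolding card_gt_0_iff by blast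
          then show ?thesis by (rule gr_implies_not0)
        qed
        ultimately show ?thesis by (simp only: mult_eq_0_iff of_nat_eq_0_iff) simp
      qed
    qed
  qed
qed


section \<open>Semistandard tableaux as patterns\<close>

lemma standard_wordsD:
  assumes "w \<in> standard_words"
  shows "w \<in> words" "(s, r) \<in> cells \<Longrightarrow> (s, Suc r) \<in> cells \<Longrightarrow> w (s, r) < w (s, Suc r)"
    "(s, r) \<in> cells \<Longrightarrow> (Suc s, r) \<in> cells \<Longrightarrow> w (s, r) \<le> w (Suc s, r)"
  using assms unfolding standard_words_def by blast+

lemma standard_words_column:
  assumes "w \<in> standard_words" "1 \<le> r" "r \<le> r'" "(s, r') \<in> cells"
  shows "w (s, r) + (r' - r) \<le> w (s, r')"
  using column_strict[of w, OF standard_wordsD(2)[OF assms(1)] assms(2-4)] .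

lemma standard_words_row:
  assumes w: "w \<in> standard_words" and "s \<le> s'" "(s', r) \<in> cells"
  shows "w (s, r) \<le> w (s', r)"
  using assms(2,3)
proof (induction s' rule: dec_induct)
  case (step m)
  have c: "(m, r) \<in> cells" using cells_up[OF step.prems, of r m] cellsD[OF step.prems] by simp
  then show ?case using step.IH standard_wordsD(3)[OF w c step.prems] by simp
qed simp

lemma standard_words_ge:
  assumes w: "w \<in> standard_words" and c: "(s, r) \<in> cells"
  shows "r \<le> w (s, r)"
proof -
  have r: "1 \<le> r" using cellsD[OF c] by simp
  have "1 \<le> w (s, 1)"
    using words_range[OF standard_wordsD(1)[OF w] cells_up[OF c, of 1 s]] r by simp
  then show ?thesis using standard_words_column[OF w _ r c] by simp
qed

text \<open>The Gelfand-Tsetlin encoding of a tableau: the entry at (i, q) is the number of letters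
  of row i that are at most n - (q - i), with the subtraction moved to the other side.\<close>

definition word_pattern :: "filling \<Rightarrow> filling" where
  "word_pattern w = (\<lambda>(i, q). if (i, q) \<in> tri n then card {s. s < part i \<and> w (s, i) + q \<le> n + i} else 0)"

lemma word_pattern_in_patterns:
  assumes w: "w \<in> standard_words"
  shows "word_pattern w \<in> patterns"
  unfolding patterns_def mem_Collect_eq
proof (intro conjI allI ballI impI)
  fix p assume "p \<notin> tri n" then show "word_pattern w p = 0" by (cases p) (simp add: word_pattern_def)
next
  fix i assume i: "i \<in> {1..n}"
  have "{s. s < part i \<and> w (s, i) + i \<le> n + i} = {..<part i}"
    using words_range[OF standard_wordsD(1)[OF w]] i by (auto simp: cells_def)
  then show "word_pattern w (i, i) = part i" using i by (simp add: word_pattern_def tri_def)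
next
  fix p q assume pq: "p \<in> tri n" "q \<in> tri n" "tri_le p q"
  obtain i j i' j' where [simp]: "p = (i, j)" "q = (i', j')" by (cases p, cases q) auto
  have le: "1 \<le> i" "i \<le> i'" "j \<le> j'" using pq by (auto simp: tri_def tri_le_def)
  have "{s. s < part i' \<and> w (s, i') + j' \<le> n + i'} \<subseteq> {s. s < part i \<and> w (s, i) + j \<le> n + i}"
  proof clarify
    fix s assume s: "s < part i'" "w (s, i') + j' \<le> n + i'"
    then have "(s, i') \<in> cells" using le by (simp add: cells_def)
    from standard_words_column[OF w le(1,2) this] s part_mono[OF le(1,2)] le
    show "s < part i \<and> w (s, i) + j \<le> n + i" by simp
  qed
  then have "card {s. s < part i' \<and> w (s, i') + j' \<le> n + i'} \<le> card {s. s < part i \<and> w (s, i) + j \<le> n + i}"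
    by (rule card_mono[rotated]) simp
  then show "word_pattern w q \<le> word_pattern w p" using pq by (simp add: word_pattern_def)
qed

lemma down_closed_eq_lessThan_card:
  fixes K :: "nat set"
  assumes fin: "finite K" and down: "\<And>x y. x \<in> K \<Longrightarrow> y \<le> x \<Longrightarrow> y \<in> K"
  shows "x \<in> K \<longleftrightarrow> x < card K"
proof
  assume "x \<in> K"
  then have "{..x} \<subseteq> K" using down by blast
  from card_mono[OF fin this] show "x < card K" by simp
next
  assume x: "x < card K"
  show "x \<in> K"
  proof (rule ccontr)
    assume "x \<notin> K"
    then have "K \<subseteq> {..<x}" using down by (meson lessThan_iff not_le subsetI)
    from card_mono[OF _ this] x show False by simp
  qed
qed

lemma less_word_pattern_iff:
  assumes w: "w \<in> standard_words" and c: "(s, i) \<in> cells" and q: "i \<le> q" "q \<le> n"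
  shows "s < word_pattern w (i, q) \<longleftrightarrow> w (s, i) + q \<le> n + i"
proof -
  let ?K = "{s. s < part i \<and> w (s, i) + q \<le> n + i}"
  have i: "1 \<le> i" using cellsD[OF c] by simp
  have "s \<in> ?K \<longleftrightarrow> s < card ?K"
  proof (rule down_closed_eq_lessThan_card)
    fix x y assume "x \<in> ?K" "y \<le> x"
    then show "y \<in> ?K" using standard_words_row[OF w, of y x i] i by (auto simp: cells_def)
  qed simp
  then show ?thesis using c q i by (simp add: word_pattern_def tri_def cells_def)
qed

lemma inj_on_word_pattern: "inj_on word_pattern standard_words"
proof
  fix w w' assume w: "w \<in> standard_words" and w': "w' \<in> standard_words" and eq: "word_pattern w = word_pattern w'"
  have le: "u' (s, i) \<le> u (s, i)" if u: "u \<in> standard_words" "u' \<in> standard_words"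
    and eq: "word_pattern u = word_pattern u'" and c: "(s, i) \<in> cells" for u u' s i
  proof -
    have rng: "i \<le> u (s, i)" "u (s, i) \<le> n"
      using standard_words_ge[OF u(1) c] words_range[OF standard_wordsD(1)[OF u(1)] c] by auto
    \<comment> \<open>The last threshold that still admits the letter \<open>u (s, i)\<close>. It
      lies between i and n because this letter is at most n and at least its row number.\<close>
    let ?q = "n + i - u (s, i)"
    have "s < word_pattern u (i, ?q)" using less_word_pattern_iff[OF u(1) c, of ?q] rng by simp
    then have "u' (s, i) + ?q \<le> n + i" using less_word_pattern_iff[OF u(2) c, of ?q] rng eq by simp
    then show ?thesis using rng by simp
  qed
  have "w p = w' p" if c: "p \<in> cells" for p
    using le[OF w w' eq, of "fst p" "snd p"] le[OF w' w eq[symmetric], of "fst p" "snd p"] c by simp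
  then show "w = w'" by (rule words_eqI[OF standard_wordsD(1)[OF w] standard_wordsD(1)[OF w']])
qed

lemma finite_tri: "finite (tri n)"
  by (rule finite_subset[of _ "{..n} \<times> {..n}"]) (auto simp: tri_def)

lemma finite_patterns: "finite patterns"
proof (rule finite_subset)
  show "patterns \<subseteq> {z. \<forall>p. (p \<in> tri n \<longrightarrow> z p \<in> {..part 1}) \<and> (p \<notin> tri n \<longrightarrow> z p = 0)}"
  proof
    fix z assume z: "z \<in> patterns"
    have "z p \<le> part 1" if "p \<in> tri n" for p
      using pattern_le_part[OF z, of "fst p" "snd p"] part_mono[of 1 "fst p"] that by (auto simp: tri_def)
    then show "z \<in> {z. \<forall>p. (p \<in> tri n \<longrightarrow> z p \<in> {..part 1}) \<and> (p \<notin> tri n \<longrightarrow> z p = 0)}"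
      using patternsD(1)[OF z] by blast
  qed
qed (rule finite_set_of_finite_funs[OF finite_tri finite_atMost])

lemma card_standard_words_le: "card standard_words \<le> card patterns"
  using word_pattern_in_patterns inj_on_word_pattern finite_patterns by (intro card_inj_on_le) auto

subsection \<open>The highest weight vector\<close>

text \<open>A column of a word supporting \<open>hwv\<close> that contains \<open>Suc j\<close> also
  contains the smaller letter \<open>Suc i\<close>. If such a word arises by changing a letter
  \<open>Suc i\<close> into \<open>Suc j\<close>, the original column had \<open>Suc i\<close>
  twice; and at words with such a repetition the image vanishes, being straight.\<close>

lemma tens_upper_hwv:
  assumes ij: "i < j" "j < n"
  shows "tens (munit n i j) hwv w = 0"
proof (cases "w \<in> words")
  case w: True
  show ?thesis
  proof (cases "\<exists>p\<in>cells. \<exists>q\<in>cells. p \<noteq> q \<and> fst p = fst q \<and> w p = w q")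
    case True
    then show ?thesis using straight_repeat[OF tens_straight[OF hwv_straight] w] by blast
  next
    case False
    have "hwv (w(p := Suc j)) = 0" if p: "p \<in> cells" "w p = Suc i" for p
    proof (rule ccontr)
      assume "hwv (w(p := Suc j)) \<noteq> 0"
      then obtain \<sigma> where s: "\<sigma> \<in> col_perms" and e: "\<forall>q\<in>cells. (w(p := Suc j)) q = snd (\<sigma> q)"
        using hwv_nonzeroD(2) by blast
      have sp: "snd (\<sigma> p) = Suc j" using bspec[OF e p(1)] by simp
      have "(fst p, Suc j) \<in> cells"
        using col_perms_in_cells[OF s p(1)] col_permsD(2)[OF s, of p] sp by (metis prod.collapse)
      then have c: "(fst p, Suc i) \<in> cells" using cells_up[of "fst p" "Suc j" "Suc i" "fst p"] ij by simp
      define q where "q = inv_into UNIV \<sigma> (fst p, Suc i)"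
      have q: "q \<in> cells" "\<sigma> q = (fst p, Suc i)"
        using col_perms_in_cells[OF col_perms_inv[OF s] c] permutes_inverses(1)[OF col_permsD(1)[OF s]]
        by (simp_all add: q_def)
      have "q \<noteq> p" using sp q(2) ij by auto
      moreover have "fst q = fst p" using col_permsD(2)[OF s, of q] q(2) by simp
      moreover have "w q = w p" using bspec[OF e q(1)] q(2) \<open>q \<noteq> p\<close> p(2) by simp
      ultimately show False using False p(1) q(1) by metis
    qed
    then show ?thesis using w ij by (simp add: tens_munit)
  qed
qed (simp add: tens_outside)

text \<open>Replacing a letter of \<open>top_word\<close> by a smaller one duplicates a letter
  further up in the same column. The coordinate at \<open>top_word\<close> therefore ignores
  everything obtained by lowering.\<close>

lemma tens_lower_top:
  assumes \<phi>: "\<phi> \<in> straight" and ij: "j < i" "i < n"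
  shows "tens (munit n i j) \<phi> top_word = 0"
proof -
  have "\<phi> (top_word(p := Suc j)) = 0" if p: "p \<in> cells" "top_word p = Suc i" for p
  proof -
    have sp: "snd p = Suc i" using p by simp
    then have "(fst p, Suc j) \<in> cells" using cells_up[of "fst p" "Suc i" "Suc j" "fst p"] p ij by (metis prod.collapse le_SucI less_imp_le Suc_le_mono le_refl le_add1 plus_1_eq_Suc)
    moreover have "p \<noteq> (fst p, Suc j)" using sp ij by (metis less_irrefl old.nat.inject snd_conv)
    ultimately show ?thesis
      using ij by (intro straight_repeat[OF \<phi> words_upd[OF top_word_in_words p(1)] p(1)]) auto
  qed
  moreover have "j < n" using ij by simp
  ultimately show ?thesis
    unfolding tens_munit[OF top_word_in_words ij(2) \<open>j < n\<close>] by (intro sum.neutral) blast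
qed

lemma weight_eval_eq_sum_cells: "weight_eval n a h = (\<Sum>p\<in>cells. h $$ (snd p - 1, snd p - 1))"
proof -
  have c: "cells = (SIGMA r:{1..<n}. {..<part r})\<inverse>"
    using cells_subset by (auto simp: cells_def)
  have "(\<Sum>p\<in>cells. h $$ (snd p - 1, snd p - 1)) = (\<Sum>(r, s)\<in>(SIGMA r:{1..<n}. {..<part r}). h $$ (r - 1, r - 1))"
    unfolding c by (rule sum.reindex_bij_witness[of _ prod.swap prod.swap]) auto
  also have "\<dots> = (\<Sum>r\<in>{1..<n}. \<Sum>s<part r. h $$ (r - 1, r - 1))"
    by (rule sum.Sigma[symmetric]) auto
  also have "\<dots> = (\<Sum>r\<in>{1..<n}. (\<Sum>k\<in>{r..<n}. of_int (a k)) * h $$ (r - 1, r - 1))"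
  proof (intro sum.cong refl)
    fix r assume "r \<in> {1..<n}"
    then have "(of_nat (part r) :: complex) = of_int (\<Sum>k\<in>{r..<n}. a k)"
      by (subst int_part[symmetric]) auto
    then show "(\<Sum>s<part r. h $$ (r - 1, r - 1)) = (\<Sum>k\<in>{r..<n}. of_int (a k)) * h $$ (r - 1, r - 1)"
      by simp
  qed
  also have "\<dots> = (\<Sum>r\<in>{1..<n}. \<Sum>k\<in>{1..<n}. if r \<le> k then of_int (a k) * h $$ (r - 1, r - 1) else 0)"
    unfolding sum_distrib_right by (intro sum.cong refl sum.mono_neutral_cong_left) auto
  also have "\<dots> = (\<Sum>k\<in>{1..<n}. \<Sum>r\<in>{1..<n}. if r \<le> k then of_int (a k) * h $$ (r - 1, r - 1) else 0)"
    by (rule sum.swap)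
  also have "\<dots> = (\<Sum>k\<in>{1..<n}. of_int (a k) * (\<Sum>i<k. h $$ (i, i)))"
  proof (rule sum.cong[OF refl])
    fix k assume k: "k \<in> {1..<n}"
    have "(\<Sum>r\<in>{1..<n}. if r \<le> k then of_int (a k) * h $$ (r - 1, r - 1) else 0) =
        (\<Sum>r\<in>{1..k}. of_int (a k) * h $$ (r - 1, r - 1))"
      using k by (intro sum.mono_neutral_cong_right) auto
    also have "\<dots> = (\<Sum>i<k. of_int (a k) * h $$ (i, i))"
      by (rule sum.reindex_bij_witness[of _ Suc "\<lambda>r. r - 1"]) auto
    finally show "(\<Sum>r\<in>{1..<n}. if r \<le> k then of_int (a k) * h $$ (r - 1, r - 1) else 0) =
        of_int (a k) * (\<Sum>i<k. h $$ (i, i))" by (simp add: sum_distrib_left)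
  qed
  finally show ?thesis by (simp add: weight_eval_def)
qed

lemma tens_cartan_hwv:
  assumes h: "h \<in> carrier_mat n n" "diagonal_mat h"
  shows "tens h hwv w = weight_eval n a h * hwv w"
proof (cases "hwv w = 0")
  case True
  then show ?thesis using tens_diagonal[OF _ h, of w hwv] tens_outside[of w] by (cases "w \<in> words") auto
next
  case False
  then obtain \<sigma> where s: "\<sigma> \<in> col_perms" and e: "\<forall>q\<in>cells. w q = snd (\<sigma> q)"
    using hwv_nonzeroD(2) by blast
  have "(\<Sum>p\<in>cells. h $$ (w p - 1, w p - 1)) = (\<Sum>p\<in>cells. h $$ (snd (\<sigma> p) - 1, snd (\<sigma> p) - 1))"
    using e by (intro sum.cong) auto
  also have "\<dots> = weight_eval n a h"
    using sum.permute[OF col_permsD(1)[OF s], of "\<lambda>p. h $$ (snd p - 1, snd p - 1)"]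
    by (simp add: weight_eval_eq_sum_cells comp_def)
  finally show ?thesis using tens_diagonal[OF hwv_nonzeroD(1)[OF False] h] by simp
qed

subsection \<open>The invariant Hermitian form\<close>

definition form :: "tensor \<Rightarrow> tensor \<Rightarrow> complex" where
  "form \<phi> \<psi> = (\<Sum>w\<in>words. \<phi> w * cnj (\<psi> w))"

text \<open>Contravariance: changing one letter and changing it back are inverse bijections of
  words, so transposed matrix units are adjoint.\<close>

lemma form_munit:
  assumes ij: "i < n" "j < n"
  shows "form (tens (munit n i j) \<phi>) \<psi> = form \<phi> (tens (munit n j i) \<psi>)"
proof -
  have "form (tens (munit n i j) \<phi>) \<psi>
      = (\<Sum>w\<in>words. \<Sum>p\<in>cells. if w p = Suc i then \<phi> (w(p := Suc j)) * cnj (\<psi> w) else 0)"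
    unfolding form_def
    using ij by (intro sum.cong refl) (simp add: tens_munit sum_distrib_right sum.If_cases Int_def)
  also have "\<dots> = (\<Sum>p\<in>cells. \<Sum>w\<in>words. if w p = Suc i then \<phi> (w(p := Suc j)) * cnj (\<psi> w) else 0)"
    by (rule sum.swap)
  also have "\<dots> = (\<Sum>p\<in>cells. \<Sum>w\<in>words. if w p = Suc j then \<phi> w * cnj (\<psi> (w(p := Suc i))) else 0)"
  proof (rule sum.cong[OF refl])
    fix p assume p: "p \<in> cells"
    have "(\<Sum>w\<in>words. if w p = Suc i then \<phi> (w(p := Suc j)) * cnj (\<psi> w) else 0)
        = (\<Sum>w\<in>{w\<in>words. w p = Suc i}. \<phi> (w(p := Suc j)) * cnj (\<psi> w))"
      by (simp add: sum.If_cases Int_def)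
    also have "\<dots> = (\<Sum>w\<in>{w\<in>words. w p = Suc j}. \<phi> w * cnj (\<psi> (w(p := Suc i))))"
      by (rule sum.reindex_bij_witness[of _ "\<lambda>w. w(p := Suc i)" "\<lambda>w. w(p := Suc j)"])
        (use ij p words_upd[OF _ p] in \<open>auto simp: fun_upd_idem\<close>)
    also have "\<dots> = (\<Sum>w\<in>words. if w p = Suc j then \<phi> w * cnj (\<psi> (w(p := Suc i))) else 0)"
      by (simp add: sum.If_cases Int_def)
    finally show "(\<Sum>w\<in>words. if w p = Suc i then \<phi> (w(p := Suc j)) * cnj (\<psi> w) else 0)
        = (\<Sum>w\<in>words. if w p = Suc j then \<phi> w * cnj (\<psi> (w(p := Suc i))) else 0)" .
  qed
  also have "\<dots> = (\<Sum>w\<in>words. \<Sum>p\<in>cells. if w p = Suc j then \<phi> w * cnj (\<psi> (w(p := Suc i))) else 0)"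
    by (rule sum.swap)
  also have "\<dots> = form \<phi> (tens (munit n j i) \<psi>)"
    unfolding form_def
    using ij by (intro sum.cong refl) (simp add: tens_munit sum_distrib_left sum.If_cases Int_def)
  finally show ?thesis .
qed

text \<open>All column permutations contribute equally, since the sign in \<open>hwv\<close> cancels
  the one from the antisymmetry of \<phi>. Being orthogonal to \<open>hwv\<close> thus means
  vanishing at \<open>top_word\<close>.\<close>

lemma form_hwv:
  assumes \<phi>: "\<phi> \<in> straight"
  shows "form hwv \<phi> = of_nat (card col_perms) * cnj (\<phi> top_word)"
proof -
  have "form hwv \<phi> = (\<Sum>w\<in>words. \<Sum>\<sigma>\<in>col_perms. col_fit \<sigma> w * cnj (\<phi> w))"
    unfolding form_def by (intro sum.cong refl) (simp only: hwv_def if_True sum_distrib_right)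
  also have "\<dots> = (\<Sum>\<sigma>\<in>col_perms. \<Sum>w\<in>words. col_fit \<sigma> w * cnj (\<phi> w))"
    by (rule sum.swap)
  also have "\<dots> = (\<Sum>\<sigma>\<in>col_perms. cnj (\<phi> top_word))"
  proof (rule sum.cong[OF refl])
    fix \<sigma> assume s: "\<sigma> \<in> col_perms"
    let ?u = "top_word \<circ> \<sigma>"
    have u: "?u \<in> words" using words_comp[OF top_word_in_words col_permsD(1)[OF s]] .
    have "(\<forall>p\<in>cells. w p = snd (\<sigma> p)) \<longleftrightarrow> w = ?u" if w: "w \<in> words" for w
    proof
      assume "\<forall>p\<in>cells. w p = snd (\<sigma> p)"
      then show "w = ?u" using col_perms_in_cells[OF s] by (intro words_eqI[OF w u]) simp
    next
      assume "w = ?u"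
      then show "\<forall>p\<in>cells. w p = snd (\<sigma> p)" using col_perms_in_cells[OF s] by simp
    qed
    then have "(\<Sum>w\<in>words. col_fit \<sigma> w * cnj (\<phi> w))
        = (\<Sum>w\<in>words. if w = ?u then csign \<sigma> * cnj (\<phi> ?u) else 0)"
      by (intro sum.cong refl) auto
    also have "\<dots> = csign \<sigma> * cnj (csign \<sigma> * \<phi> top_word)"
      using u straight_col[OF \<phi> s top_word_in_words] by simp
    also have "\<dots> = (csign \<sigma> * csign \<sigma>) * cnj (\<phi> top_word)"
      by (simp only: complex_cnj_mult csign_def complex_cnj_of_int mult.assoc)
    also have "\<dots> = cnj (\<phi> top_word)" by simp
    finally show "(\<Sum>w\<in>words. col_fit \<sigma> w * cnj (\<phi> w)) = cnj (\<phi> top_word)" .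
  qed
  finally show ?thesis by simp
qed

lemma form_self_zero:
  assumes "form \<phi> \<phi> = 0" and w: "w \<in> words"
  shows "\<phi> w = 0"
proof -
  have "form \<phi> \<phi> = complex_of_real (\<Sum>w\<in>words. (cmod (\<phi> w))\<^sup>2)"
    unfolding form_def of_real_sum by (intro sum.cong refl) (simp add: complex_norm_square[symmetric])
  then have "complex_of_real (\<Sum>w\<in>words. (cmod (\<phi> w))\<^sup>2) = 0" using assms(1) by simp
  then have "(\<Sum>w\<in>words. (cmod (\<phi> w))\<^sup>2) = 0" by (simp only: of_real_eq_0_iff)
  then have "\<forall>w\<in>words. (cmod (\<phi> w))\<^sup>2 = 0" by (subst (asm) sum_nonneg_eq_0_iff) auto
  then show ?thesis using w by simp
qed

end

subsection \<open>Highest weight modules\<close>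

lemma slD: "X \<in> sl n \<Longrightarrow> X \<in> carrier_mat n n" "X \<in> sl n \<Longrightarrow> (\<Sum>i<n. X $$ (i, i)) = 0"
  by (simp_all add: sl_def)

lemma sl_add: "X \<in> sl n \<Longrightarrow> Y \<in> sl n \<Longrightarrow> X + Y \<in> sl n"
  by (auto simp: sl_def sum.distrib)

lemma sl_smult: "X \<in> sl n \<Longrightarrow> c \<cdot>\<^sub>m X \<in> sl n"
  by (auto simp: sl_def sum_distrib_left[symmetric])

lemma mult_index:
  fixes X Y :: "complex mat"
  assumes "X \<in> carrier_mat n n" "Y \<in> carrier_mat n n" "i < n" "j < n"
  shows "(X * Y) $$ (i, j) = (\<Sum>k<n. X $$ (i, k) * Y $$ (k, j))"
  using assms by (auto simp: scalar_prod_def atLeast0LessThan)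

lemma sl_bracket:
  assumes X: "X \<in> carrier_mat n n" and Y: "Y \<in> carrier_mat n n"
  shows "lie_bracket X Y \<in> sl n"
proof -
  have "(\<Sum>i<n. (X * Y) $$ (i, i)) = (\<Sum>i<n. \<Sum>k<n. X $$ (i, k) * Y $$ (k, i))"
    by (intro sum.cong refl mult_index[OF X Y]) simp_all
  also have "\<dots> = (\<Sum>k<n. \<Sum>i<n. X $$ (i, k) * Y $$ (k, i))" by (rule sum.swap)
  also have "\<dots> = (\<Sum>k<n. (Y * X) $$ (k, k))"
    by (intro sum.cong refl) (simp add: mult_index[OF Y X] mult.commute del: index_mult_mat)
  finally show ?thesis using X Y by (auto simp: sl_def lie_bracket_def sum_subtractf)
qed

lemma munit_index [simp]: "k < n \<Longrightarrow> l < n \<Longrightarrow> munit n i j $$ (k, l) = (if k = i \<and> l = j then 1 else 0)"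
  by (simp add: munit_def)

lemma munit_sl: "i \<noteq> j \<Longrightarrow> munit n i j \<in> sl n"
  by (auto simp: sl_def intro!: sum.neutral)

lemma cartanD: "h \<in> cartan n \<Longrightarrow> h \<in> sl n" "h \<in> cartan n \<Longrightarrow> h \<in> carrier_mat n n" "h \<in> cartan n \<Longrightarrow> diagonal_mat h"
  by (auto simp: cartan_def sl_def)

lemma lie_bracket_diagonal_index:
  assumes h: "h \<in> carrier_mat n n" "diagonal_mat h" and X: "X \<in> carrier_mat n n" and ij: "i < n" "j < n"
  shows "lie_bracket h X $$ (i, j) = (h $$ (i, i) - h $$ (j, j)) * X $$ (i, j)"
proof -
  have "(h * X) $$ (i, j) = (\<Sum>k<n. if k = i then h $$ (i, i) * X $$ (i, j) else 0)"
    unfolding mult_index[OF h(1) X ij]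
    using h ij by (intro sum.cong refl) (auto simp: diagonal_mat_def)
  moreover have "(X * h) $$ (i, j) = (\<Sum>k<n. if k = j then h $$ (j, j) * X $$ (i, j) else 0)"
    unfolding mult_index[OF X h(1) ij]
    using h ij by (intro sum.cong refl) (auto simp: diagonal_mat_def)
  ultimately show ?thesis
    using h X ij by (simp add: lie_bracket_def left_diff_distrib)
qed

lemma lie_bracket_diagonal_munit:
  assumes h: "h \<in> carrier_mat n n" "diagonal_mat h" and ij: "i < n" "j < n"
  shows "lie_bracket h (munit n i j) = (h $$ (i, i) - h $$ (j, j)) \<cdot>\<^sub>m munit n i j"
proof (rule eq_matI)
  fix k l assume "k < dim_row ((h $$ (i, i) - h $$ (j, j)) \<cdot>\<^sub>m munit n i j)"
    "l < dim_col ((h $$ (i, i) - h $$ (j, j)) \<cdot>\<^sub>m munit n i j)"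
  then have kl: "k < n" "l < n" by (simp_all add: munit_def)
  then show "lie_bracket h (munit n i j) $$ (k, l) = ((h $$ (i, i) - h $$ (j, j)) \<cdot>\<^sub>m munit n i j) $$ (k, l)"
    using lie_bracket_diagonal_index[OF h munit_carrier kl, of i j] by (simp add: munit_def)
qed (use h in \<open>auto simp: lie_bracket_def munit_def\<close>)

lemma weight_eval_simple_root:
  assumes h: "h \<in> sl n" and m: "1 \<le> m" "m < n"
  shows "weight_eval n (simple_root n m) h = h $$ (m - 1, m - 1) - h $$ (m, m)"
proof -
  let ?s = "\<lambda>k. \<Sum>i<k. h $$ (i, i)"
  have fund: "weight_eval n (fund_weight n k) h = ?s k" if "k \<le> n" for k
  proof (cases "k \<in> {1..<n}")
    case False
    then have "k = 0 \<or> k = n" using that by auto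
    moreover have "?s 0 = 0" "?s n = 0" using slD(2)[OF h] by simp_all
    ultimately have "?s k = 0" by metis
    moreover have "fund_weight n k l = 0" for l using False by (auto simp: fund_weight_def)
    ultimately show ?thesis by (simp add: weight_eval_def)
  qed (rule weight_eval_fund_weight)
  have "weight_eval n (simple_root n m) h = 2 * weight_eval n (fund_weight n m) h
      - weight_eval n (fund_weight n (m - 1)) h - weight_eval n (fund_weight n (m + 1)) h"
    by (simp add: weight_eval_def simple_root_def left_diff_distrib sum_subtractf sum_distrib_left mult.assoc)
  also have "\<dots> = 2 * ?s m - ?s (m - 1) - ?s (m + 1)" using m by (simp add: fund)
  also have "?s (m + 1) = ?s m + h $$ (m, m)" by simp
  also have "?s m = ?s (m - 1) + h $$ (m - 1, m - 1)" using m by (cases m) auto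
  finally show ?thesis by simp
qed

lemma weight_eval_pos_root:
  assumes h: "h \<in> sl n" and ij: "1 \<le> i" "i \<le> j" "j \<le> n"
  shows "weight_eval n (pos_root n i j) h = h $$ (i - 1, i - 1) - h $$ (j - 1, j - 1)"
  using ij(2,3)
proof (induction j rule: dec_induct)
  case base then show ?case by (simp add: pos_root_def weight_eval_def)
next
  case (step m)
  have "pos_root n i (Suc m) = (\<lambda>l. pos_root n i m l + simple_root n m l)"
    using step by (simp add: pos_root_def fun_eq_iff)
  then have "weight_eval n (pos_root n i (Suc m)) h
      = weight_eval n (pos_root n i m) h + weight_eval n (simple_root n m) h"
    by (simp add: weight_eval_def distrib_right sum.distrib)
  then show ?case using step ij(1) weight_eval_simple_root[OF h, of m] by simp
qed

lemma weight_eval_uminus: "weight_eval n (- \<mu>) h = - weight_eval n \<mu> h"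
  by (simp add: weight_eval_def sum_negf)

lemma root_vector_munit:
  assumes ij: "1 \<le> i" "i < j" "j \<le> n"
  shows "root_vector n (pos_root n i j) (munit n (i - 1) (j - 1))"
proof -
  have b: "i - 1 < n" "j - 1 < n" "i - 1 \<noteq> j - 1" using ij by auto
  have "munit n (i - 1) (j - 1) \<noteq> 0\<^sub>m n n"
  proof
    assume "munit n (i - 1) (j - 1) = 0\<^sub>m n n"
    then have "munit n (i - 1) (j - 1) $$ (i - 1, j - 1) = 0\<^sub>m n n $$ (i - 1, j - 1)" by simp
    then show False using b by simp
  qed
  then show ?thesis
    using b ij by (simp add: root_vector_def munit_sl cartanD lie_bracket_diagonal_munit weight_eval_pos_root)
qed

lemma pow2_diff_inject:
  fixes a b c d :: nat
  assumes eq: "(2::int) ^ a - 2 ^ b = 2 ^ c - 2 ^ d" and ne: "c < d"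
  shows "a = c \<and> b = d"
proof -
  have e: "(2::nat) ^ a + 2 ^ d = 2 ^ c + 2 ^ b"
  proof -
    have "(2::int) ^ a + 2 ^ d = 2 ^ c + 2 ^ b" using eq by simp
    then have "int (2 ^ a + 2 ^ d) = int (2 ^ c + 2 ^ b)" by simp
    then show ?thesis by (simp only: of_nat_eq_iff)
  qed
  have lt: "(2::nat) ^ x < 2 ^ y" if "x < y" for x y using that by simp
  have dbl: "2 * (2::nat) ^ x \<le> 2 ^ y" if "x < y" for x y
    using power_increasing[of "Suc x" y "2::nat"] that by simp
  have "b = d"
  proof (rule ccontr)
    assume "b \<noteq> d"
    then consider "b < d" | "d < b" by linarith
    then show False
    proof cases
      case 1
      have "(2::nat) ^ c + 2 ^ b \<le> 2 ^ d" using dbl[OF 1] dbl[OF ne] by linarith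
      moreover have "(0::nat) < 2 ^ a" by simp
      ultimately show False using e by linarith
    next
      case 2
      have "a < b"
      proof (rule ccontr)
        assume "\<not> a < b"
        then have "(2::nat) ^ b \<le> 2 ^ a" by (simp add: power_increasing)
        then show False using e lt[OF ne] by linarith
      qed
      have "(2::nat) ^ a + 2 ^ d \<le> 2 ^ b" using dbl[OF 2] dbl[OF \<open>a < b\<close>] by linarith
      moreover have "(0::nat) < 2 ^ c" by simp
      ultimately show False using e by linarith
    qed
  qed
  moreover have "(2::nat) ^ a = 2 ^ c" using e \<open>b = d\<close> by simp
  ultimately show ?thesis by simp
qed

text \<open>The weights of the matrix units are separated by the powers of 2, shifted to have trace 0.\<close>

lemma negative_root_vector:
  assumes f: "root_vector n (- pos_root n i j) f" and ij: "1 \<le> i" "i < j" "j \<le> n"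
  shows "\<exists>c. c \<noteq> 0 \<and> f = c \<cdot>\<^sub>m munit n (j - 1) (i - 1)"
proof -
  define m :: complex where "m = (\<Sum>k<n. 2 ^ k) / of_nat n"
  define h where "h = mat n n (\<lambda>(k, l). if k = l then 2 ^ k - m else 0)"
  have n0: "n \<noteq> 0" using ij by simp
  have hk: "h $$ (k, k) = 2 ^ k - m" if "k < n" for k using that by (simp add: h_def)
  have "(\<Sum>k<n. h $$ (k, k)) = 0" using n0 by (simp add: hk sum_subtractf m_def)
  then have hc: "h \<in> cartan n" by (auto simp: cartan_def sl_def h_def diagonal_mat_def)
  have fs: "f \<in> carrier_mat n n" and fn: "f \<noteq> 0\<^sub>m n n"
    using f slD(1) by (auto simp: root_vector_def)
  have b: "i - 1 < n" "j - 1 < n" "i - 1 < j - 1" using ij by auto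
  have "lie_bracket h f = weight_eval n (- pos_root n i j) h \<cdot>\<^sub>m f"
    using f hc by (simp add: root_vector_def)
  also have "weight_eval n (- pos_root n i j) h = h $$ (j - 1, j - 1) - h $$ (i - 1, i - 1)"
    unfolding weight_eval_uminus using weight_eval_pos_root[OF cartanD(1)[OF hc], of i j] ij by simp
  also have "\<dots> = 2 ^ (j - 1) - 2 ^ (i - 1)" using b by (simp add: hk)
  finally have br: "lie_bracket h f = (2 ^ (j - 1) - 2 ^ (i - 1)) \<cdot>\<^sub>m f" .
  have zero: "f $$ (k, l) = 0" if kl: "k < n" "l < n" "\<not> (k = j - 1 \<and> l = i - 1)" for k l
  proof (rule ccontr)
    assume nz: "f $$ (k, l) \<noteq> 0"
    have "(2 ^ k - 2 ^ l) * f $$ (k, l) = lie_bracket h f $$ (k, l)"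
      using lie_bracket_diagonal_index[OF cartanD(2,3)[OF hc] fs kl(1,2)] kl by (simp add: hk)
    also have "\<dots> = (2 ^ (j - 1) - 2 ^ (i - 1)) * f $$ (k, l)"
      unfolding br using fs kl by simp
    finally have "(2::complex) ^ k - 2 ^ l = 2 ^ (j - 1) - 2 ^ (i - 1)" using nz by simp
    then have "complex_of_int (2 ^ l - 2 ^ k) = complex_of_int (2 ^ (i - 1) - 2 ^ (j - 1))"
      by (simp add: algebra_simps)
    then have "(2::int) ^ l - 2 ^ k = 2 ^ (i - 1) - 2 ^ (j - 1)" by (simp only: of_int_eq_iff)
    from pow2_diff_inject[OF this b(3)] kl(3) show False by simp
  qed
  let ?c = "f $$ (j - 1, i - 1)"
  have eq: "f = ?c \<cdot>\<^sub>m munit n (j - 1) (i - 1)"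
    by (rule eq_matI) (use fs zero in \<open>auto simp: munit_def\<close>)
  moreover have "?c \<noteq> 0"
  proof
    assume "?c = 0"
    then have "f $$ (k, l) = 0" if "k < n" "l < n" for k l
      using zero[OF that] by (cases "k = j - 1 \<and> l = i - 1") simp_all
    then have "f = 0\<^sub>m n n" using fs by (intro eq_matI) auto
    then show False using fn by simp
  qed
  ultimately show ?thesis by blast
qed

text \<open>The nonzero entries off the diagonal are removed one at a time, until a traceless
  diagonal matrix is left.\<close>

lemma sl_induct [consumes 1, case_names diag unit add smult]:
  assumes X: "X \<in> sl n"
    and diag: "\<And>h. h \<in> cartan n \<Longrightarrow> P h"
    and unit: "\<And>i j. i < n \<Longrightarrow> j < n \<Longrightarrow> i \<noteq> j \<Longrightarrow> P (munit n i j)"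
    and add: "\<And>X Y. X \<in> sl n \<Longrightarrow> Y \<in> sl n \<Longrightarrow> P X \<Longrightarrow> P Y \<Longrightarrow> P (X + Y)"
    and smult: "\<And>X c. X \<in> sl n \<Longrightarrow> P X \<Longrightarrow> P (c \<cdot>\<^sub>m X)"
  shows "P X"
  using X
proof (induction "card {(i, j). i < n \<and> j < n \<and> i \<noteq> j \<and> X $$ (i, j) \<noteq> 0}" arbitrary: X rule: less_induct)
  case less
  let ?N = "\<lambda>X :: complex mat. {(i, j). i < n \<and> j < n \<and> i \<noteq> j \<and> X $$ (i, j) \<noteq> 0}"
  have Xc: "X \<in> carrier_mat n n" using slD(1)[OF less.prems] .
  show ?case
  proof (cases "?N X = {}")
    case True
    then have "X \<in> cartan n" using less.prems Xc by (auto simp: cartan_def diagonal_mat_def)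
    then show ?thesis by (rule diag)
  next
    case False
    then obtain i j where ij: "i < n" "j < n" "i \<noteq> j" "X $$ (i, j) \<noteq> 0" by auto
    define Y where "Y = X + (- X $$ (i, j)) \<cdot>\<^sub>m munit n i j"
    have Ys: "Y \<in> sl n" unfolding Y_def using less.prems munit_sl[OF ij(3)] by (intro sl_add sl_smult)
    have Yk: "Y $$ (k, l) = (if k = i \<and> l = j then 0 else X $$ (k, l))" if "k < n" "l < n" for k l
      using that Xc by (auto simp: Y_def munit_def)
    have "(i, j) \<in> ?N X" "(i, j) \<notin> ?N Y" using ij Yk[OF ij(1,2)] by simp_all
    moreover have "?N Y \<subseteq> ?N X" using Yk by (auto split: if_splits)
    ultimately have "?N Y \<subset> ?N X" by blast
    moreover have "finite (?N X)" by (rule finite_subset[of _ "{..<n} \<times> {..<n}"]) auto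
    ultimately have "card (?N Y) < card (?N X)" by (intro psubset_card_mono)
    then have "P Y" by (rule less.hyps[OF _ Ys])
    moreover have "X = Y + X $$ (i, j) \<cdot>\<^sub>m munit n i j"
      using Xc by (intro eq_matI) (auto simp: Y_def munit_def)
    moreover have "P (X $$ (i, j) \<cdot>\<^sub>m munit n i j)" using unit ij munit_sl[OF ij(3)] by (intro smult)
    ultimately show ?thesis using add[OF Ys sl_smult[OF munit_sl[OF ij(3)]]] by metis
  qed
qed

section \<open>Modules generated by lowering operators\<close>

context sl_representation
begin

lemma act_add_right: "X \<in> sl n \<Longrightarrow> act X (x + y) = act X x + act X y"
  by (rule module_hom.add[OF Vector_Spaces.linear.axioms(3)[OF act_linear]])

lemma act_scale_right: "X \<in> sl n \<Longrightarrow> act X (smul c x) = smul c (act X x)"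
  by (rule module_hom.scale[OF Vector_Spaces.linear.axioms(3)[OF act_linear]])

lemma act_zero_right: "X \<in> sl n \<Longrightarrow> act X 0 = 0"
  using act_scale_right[of X 0 0] by simp

text \<open>Products of lowering units in arbitrary order, so that closure under further lowering is
  immediate.\<close>

inductive_set low :: "'v \<Rightarrow> 'v set" for u :: 'v where
  base: "u \<in> low u"
| step: "x \<in> low u \<Longrightarrow> i < j \<Longrightarrow> j < n \<Longrightarrow> act (munit n j i) x \<in> low u"

definition low_pos :: "'v \<Rightarrow> 'v set" where
  "low_pos u = {act (munit n j i) x |i j x. x \<in> low u \<and> i < j \<and> j < n}"

lemma low_eq: "low u = insert u (low_pos u)"
proof
  show "low u \<subseteq> insert u (low_pos u)"
  proof
    fix x assume "x \<in> low u"
    then show "x \<in> insert u (low_pos u)" by cases (auto simp: low_pos_def)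
  qed
  show "insert u (low_pos u) \<subseteq> low u" by (auto simp: low_pos_def intro: low.intros)
qed

lemma act_span:
  assumes X: "X \<in> sl n" and sub: "\<And>x. x \<in> B \<Longrightarrow> act X x \<in> span C" and x: "x \<in> span B"
  shows "act X x \<in> span C"
  using x
proof (induction rule: span_induct_alt)
  case base then show ?case by (simp add: act_zero_right[OF X] span_zero)
next
  case (step c y z)
  then show ?case using sub by (simp add: act_add_right[OF X] act_scale_right[OF X] span_add span_scale)
qed

text \<open>The induction treats all X at once: moving X past a lowering unit leaves a bracket, an
  arbitrary element of \<open>sl n\<close>, which acts on a shorter product.\<close>

lemma low_invariant:
  assumes diag: "\<And>h. h \<in> cartan n \<Longrightarrow> act h u \<in> span {u}"
    and upper: "\<And>i j. i < j \<Longrightarrow> j < n \<Longrightarrow> act (munit n i j) u = 0"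
    and X: "X \<in> sl n" and x: "x \<in> span (low u)"
  shows "act X x \<in> span (low u)"
proof -
  have "\<forall>X\<in>sl n. act X x \<in> span (low u)" if "x \<in> low u" for x
    using that
  proof (induction rule: low.induct)
    case base
    show ?case
    proof
      fix X assume "X \<in> sl n"
      then show "act X u \<in> span (low u)"
      proof (induction rule: sl_induct)
        case (diag h)
        have "span {u} \<subseteq> span (low u)" by (intro span_mono) (simp add: low.base)
        then show ?case using assms(1)[OF diag] by blast
      next
        case (unit i j)
        show ?case
        proof (cases "i < j")
          case True
          then show ?thesis using upper unit by (simp add: span_zero)
        next
          case False
          then have "act (munit n i j) u \<in> low u" using unit by (intro low.intros) auto
          then show ?thesis by (rule span_base)
        qed
      next
        case (add X Y)
        then show ?case by (simp add: act_add span_add)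
      next
        case (smult X c)
        then show ?case by (simp add: act_smult span_scale)
      qed
    qed
  next
    case (step x i j)
    have F: "munit n j i \<in> sl n" using step.hyps by (intro munit_sl) simp
    show ?case
    proof
      fix X assume X: "X \<in> sl n"
      let ?F = "munit n j i"
      have br: "lie_bracket X ?F \<in> sl n" using slD(1)[OF X] by (intro sl_bracket) auto
      have "act X (act ?F x) = act (lie_bracket X ?F) x + act ?F (act X x)"
        using act_bracket[OF X F] by simp
      moreover have "act ?F (act X x) \<in> span (low u)"
        by (rule act_span[OF F _ bspec[OF step.IH X]]) (use step.hyps in \<open>auto intro!: span_base low.step\<close>)
      ultimately show "act X (act ?F x) \<in> span (low u)" using bspec[OF step.IH br] by (simp add: span_add)
    qed
  qed
  then show ?thesis using X by (intro act_span[OF X _ x]) blast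
qed

lemma low_split:
  assumes "x \<in> span (low u)"
  shows "\<exists>c. x - smul c u \<in> span (low_pos u)"
  using assms unfolding low_eq span_breakdown_eq .

text \<open>The sum of the positive coroots. Its bracket multiplies the lowering unit at (j, i), i <
  j, by -2 (j - i), so each lowering strictly decreases the eigenvalue.\<close>

definition grading :: "complex mat" where
  "grading = mat n n (\<lambda>(i, j). if i = j then of_nat n - 1 - 2 * of_nat i else 0)"

lemma grading_cartan: "grading \<in> cartan n"
proof -
  have s: "(\<Sum>i<m. 2 * of_nat i :: complex) = of_nat m * (of_nat m - 1)" for m
    by (induction m) (auto simp: algebra_simps)
  have "(\<Sum>i<n. grading $$ (i, i)) = (\<Sum>i<n. of_nat n - 1 - 2 * of_nat i)"
    by (intro sum.cong refl) (simp add: grading_def)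
  also have "\<dots> = 0" by (simp only: sum_subtractf s) (simp add: algebra_simps)
  finally show ?thesis by (auto simp: cartan_def sl_def diagonal_mat_def grading_def)
qed

text \<open>Proper lowerings of u are eigenvectors of \<open>grading\<close> with eigenvalues
  \<open>ev m\<close>, m >= 1, while u has \<open>ev 0\<close>. The product \<open>T M\<close> of
  the factors \<open>grading - ev k\<close>, k = 1, ..., M, kills any given combination of them once
  M is large, but multiplies u by a nonzero number. The argument works in any dimension.\<close>

lemma low_pos_not_generating:
  assumes u: "u \<noteq> 0" and eig: "act grading u = smul \<mu> u"
  shows "u \<notin> span (low_pos u)"
proof
  assume up: "u \<in> span (low_pos u)"
  note H = cartanD[OF grading_cartan]
  define ev where "ev m = \<mu> - 2 * of_nat m" for m :: nat
  have stepev: "act grading (act (munit n j i) x) = smul (ev (m + (j - i))) (act (munit n j i) x)"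
    if x: "act grading x = smul (ev m) x" and ij: "i < j" "j < n" for x i j m
  proof -
    have F: "munit n j i \<in> sl n" using ij by (intro munit_sl) simp
    have "act grading (act (munit n j i) x) = act (lie_bracket grading (munit n j i)) x + act (munit n j i) (act grading x)"
      using act_bracket[OF H(1) F] by simp
    also have "lie_bracket grading (munit n j i) = (- 2 * of_nat (j - i)) \<cdot>\<^sub>m munit n j i"
      using lie_bracket_diagonal_munit[OF H(2,3), of j i] ij by (simp add: grading_def of_nat_diff algebra_simps)
    also have "act ((- 2 * of_nat (j - i)) \<cdot>\<^sub>m munit n j i) x + act (munit n j i) (act grading x) =
        smul (- 2 * of_nat (j - i) + ev m) (act (munit n j i) x)"
      by (simp only: act_smult[OF F] x act_scale_right[OF F] scale_left_distrib)
    also have "- 2 * of_nat (j - i) + ev m = ev (m + (j - i))" by (simp add: ev_def)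
    finally show ?thesis .
  qed
  have lowev: "\<exists>m. act grading x = smul (ev m) x" if "x \<in> low u" for x
    using that
  proof (induction rule: low.induct)
    case base then show ?case using eig by (intro exI[of _ 0]) (simp add: ev_def)
  next
    case (step x i j) then show ?case using stepev by blast
  qed
  have posev: "\<exists>m\<ge>1. act grading x = smul (ev m) x" if px: "x \<in> low_pos u" for x
  proof -
    from px obtain i j y where y: "x = act (munit n j i) y" "y \<in> low u" "i < j" "j < n"
      by (auto simp: low_pos_def)
    then obtain m where "act grading y = smul (ev m) y" using lowev by blast
    then show ?thesis using stepev[of y m i j] y by (intro exI[of _ "m + (j - i)"]) auto
  qed
  define T where "T = rec_nat (\<lambda>x. x) (\<lambda>M g x. act grading (g x) - smul (ev (Suc M)) (g x))"
  have T0: "T 0 x = x" and TS: "T (Suc M) x = act grading (T M x) - smul (ev (Suc M)) (T M x)" for M x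
    by (simp_all add: T_def)
  have Tadd: "T M (x + y) = T M x + T M y" for M x y
    by (induction M) (simp_all add: T0 TS act_add_right[OF H(1)] scale_right_distrib)
  have Tscale: "T M (smul c x) = smul c (T M x)" for M c x
    by (induction M) (simp_all add: T0 TS act_scale_right[OF H(1)] scale_right_diff_distrib mult.commute)
  have Tev: "T M x = smul (\<Prod>k<M. ev m - ev (Suc k)) x" if x: "act grading x = smul (ev m) x" for M m x
  proof (induction M)
    case (Suc M)
    let ?P = "\<Prod>k<M. ev m - ev (Suc k)"
    have "T (Suc M) x = smul (?P * ev m) x - smul (ev (Suc M) * ?P) x"
      by (simp only: TS Suc.IH act_scale_right[OF H(1)] x scale_scale)
    also have "\<dots> = smul (?P * ev m - ev (Suc M) * ?P) x" by (simp only: scale_left_diff_distrib)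
    also have "?P * ev m - ev (Suc M) * ?P = (\<Prod>k<Suc M. ev m - ev (Suc k))"
      by (simp add: left_diff_distrib mult.commute)
    finally show ?case .
  qed (simp add: T0)
  have "\<exists>M0. \<forall>M\<ge>M0. T M x = 0" if "x \<in> span (low_pos u)" for x
    using that
  proof (induction rule: span_induct_alt)
    case base
    have "T M 0 = 0" for M using Tscale[of M 0 0] by simp
    then show ?case by blast
  next
    case (step c y z)
    obtain m where m: "1 \<le> m" "act grading y = smul (ev m) y" using posev[OF step(1)] by blast
    obtain M0 where M0: "\<And>M. M0 \<le> M \<Longrightarrow> T M z = 0" using step(2) by blast
    have "T M (smul c y + z) = 0" if "max m M0 \<le> M" for M
    proof -
      have "(\<Prod>k<M. ev m - ev (Suc k)) = 0"
        using m(1) that by (intro prod_zero) (auto intro!: bexI[of _ "m - 1"])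
      then show ?thesis using Tev[OF m(2), of M] M0[of M] that by (simp add: Tadd Tscale)
    qed
    then show ?case by blast
  qed
  from this[OF up] obtain M where M: "T M u = 0" by blast
  have "T M u = smul (\<Prod>k<M. ev 0 - ev (Suc k)) u" by (rule Tev) (simp add: ev_def eig)
  then have "(\<Prod>k<M. ev 0 - ev (Suc k)) = 0" using M u by simp
  then obtain k where "ev 0 - ev (Suc k) = 0" by (auto simp: prod_zero_iff)
  then have "complex_of_nat (Suc k) = 0" by (simp add: ev_def del: of_nat_Suc)
  then show False by (simp only: of_nat_eq_0_iff)
qed

end

section \<open>The isomorphism with the tensor model\<close>

locale pipe_module = pipe_setup n S a + irreducible_sl_representation smul n act
  for n :: nat and S :: "(nat \<times> nat) set" and a :: "nat \<Rightarrow> int"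
    and smul :: "complex \<Rightarrow> 'v::ab_group_add \<Rightarrow> 'v" and act :: "complex mat \<Rightarrow> 'v \<Rightarrow> 'v" +
  fixes f :: "nat \<Rightarrow> nat \<Rightarrow> complex mat" and v :: 'v
  assumes f_root: "\<And>i j. 1 \<le> i \<Longrightarrow> i < j \<Longrightarrow> j \<le> n \<Longrightarrow> root_vector n (- pos_root n i j) (f i j)"
    and v_highest: "highest_weight_vector smul n act a v"
begin

sublocale tensor: sl_representation "\<lambda>c \<phi> w. c * \<phi> w" n tens
proof unfold_locales
  fix X Y :: "complex mat" and \<phi> :: tensor and c :: complex
  assume X: "X \<in> sl n"
  show "tens (c \<cdot>\<^sub>m X) \<phi> = (\<lambda>w. c * tens X \<phi> w)"
    using tens_scale_left[OF slD(1)[OF X]] by (rule ext)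
  show "tens (X + Y) \<phi> = tens X \<phi> + tens Y \<phi>" if "Y \<in> sl n"
    using tens_add_left[OF slD(1)[OF X] slD(1)[OF that]] by (simp add: fun_eq_iff)
  show "tens (lie_bracket X Y) \<phi> = tens X (tens Y \<phi>) - tens Y (tens X \<phi>)" if "Y \<in> sl n"
    using tens_bracket[OF slD(1)[OF X] slD(1)[OF that]] by (simp add: fun_eq_iff)
  fix \<psi> :: tensor
  show "tens X (\<phi> + \<psi>) = tens X \<phi> + tens X \<psi>"
    using tens_add_right by (simp add: fun_eq_iff plus_fun_def)
  show "tens X (\<lambda>w. c * \<phi> w) = (\<lambda>w. c * tens X \<phi> w)"
    using tens_scale_right by (simp add: fun_eq_iff)
qed (auto simp: fun_eq_iff algebra_simps)

abbreviation pair_scale :: "complex \<Rightarrow> 'v \<times> tensor \<Rightarrow> 'v \<times> tensor" where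
  "pair_scale c x \<equiv> (smul c (fst x), \<lambda>w. c * snd x w)"

abbreviation pair_act :: "complex mat \<Rightarrow> 'v \<times> tensor \<Rightarrow> 'v \<times> tensor" where
  "pair_act X x \<equiv> (act X (fst x), tens X (snd x))"

lemma pair_scale_laws:
  "pair_scale c (x + y) = pair_scale c x + pair_scale c y"
  "pair_scale (c + d) x = pair_scale c x + pair_scale d x"
  "pair_scale c (pair_scale d x) = pair_scale (c * d) x"
  "pair_scale 1 x = x"
proof -
  show "pair_scale c (x + y) = pair_scale c x + pair_scale c y"
    unfolding prod_eq_iff fst_conv snd_conv fst_add snd_add
    by (intro conjI scale_right_distrib ext) (simp only: plus_fun_apply distrib_left)
  show "pair_scale (c + d) x = pair_scale c x + pair_scale d x"
    unfolding prod_eq_iff fst_conv snd_conv fst_add snd_add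
    by (intro conjI scale_left_distrib ext) (simp only: plus_fun_apply distrib_right)
  show "pair_scale c (pair_scale d x) = pair_scale (c * d) x"
    unfolding prod_eq_iff fst_conv snd_conv
    by (intro conjI scale_scale ext) (simp only: mult.assoc)
  show "pair_scale 1 x = x"
    unfolding prod_eq_iff fst_conv snd_conv
    by (intro conjI scale_one ext) (simp only: mult_1_left)
qed

sublocale pair: sl_representation pair_scale n pair_act
proof unfold_locales
  fix X Y :: "complex mat" and c :: complex
    and x y :: "'v \<times> tensor"
  assume X: "X \<in> sl n"
  show "pair_act (c \<cdot>\<^sub>m X) x = pair_scale c (pair_act X x)"
    by (simp add: act_smult[OF X] tensor.act_smult[OF X])
  show "pair_act (X + Y) x = pair_act X x + pair_act Y x" if "Y \<in> sl n"
    by (simp add: act_add[OF X that] tensor.act_add[OF X that])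
  show "pair_act (lie_bracket X Y) x = pair_act X (pair_act Y x) - pair_act Y (pair_act X x)" if "Y \<in> sl n"
    by (simp add: act_bracket[OF X that] tensor.act_bracket[OF X that])
  show "pair_act X (x + y) = pair_act X x + pair_act X y"
    by (simp add: act_add_right[OF X] tensor.act_add_right[OF X])
  show "pair_act X (pair_scale c x) = pair_scale c (pair_act X x)"
    by (simp add: act_scale_right[OF X] tensor.act_scale_right[OF X])
qed (rule pair_scale_laws)+

lemma v_nonzero: "v \<noteq> 0"
  using v_highest by (simp add: highest_weight_vector_def)

lemma act_cartan_v: "h \<in> cartan n \<Longrightarrow> act h v = smul (weight_eval n a h) v"
  using v_highest by (simp add: highest_weight_vector_def)

lemma act_upper_v:
  assumes "i < j" "j < n"
  shows "act (munit n i j) v = 0"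
  using v_highest root_vector_munit[of "Suc i" "Suc j" n] assms
  unfolding highest_weight_vector_def by (metis Suc_leI Suc_less_eq diff_Suc_1 le_add1 plus_1_eq_Suc)

text \<open>The submodule of the direct sum generated by the pair of highest weight vectors. It is the graph
  of an isomorphism between the given module and the one generated by \<^const>\<open>hwv\<close>.\<close>

definition graph :: "('v \<times> tensor) set" where
  "graph = pair.span (pair.low (v, hwv))"

lemma graph_base: "(v, hwv) \<in> graph"
  unfolding graph_def by (intro pair.span_base pair.low.base)

lemma graph_add: "x \<in> graph \<Longrightarrow> y \<in> graph \<Longrightarrow> x + y \<in> graph"
  unfolding graph_def by (rule pair.span_add)

lemma graph_scale: "x \<in> graph \<Longrightarrow> pair_scale c x \<in> graph"
  unfolding graph_def by (rule pair.span_scale)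

lemma graph_zero: "0 \<in> graph"
  unfolding graph_def by (rule pair.span_zero)

lemma graph_act:
  assumes X: "X \<in> sl n" and x: "x \<in> graph"
  shows "pair_act X x \<in> graph"
  unfolding graph_def
proof (rule pair.low_invariant[OF _ _ X x[unfolded graph_def]])
  fix h assume h: "h \<in> cartan n"
  have "pair_act h (v, hwv) = pair_scale (weight_eval n a h) (v, hwv)"
    using act_cartan_v[OF h] tens_cartan_hwv[OF cartanD(2,3)[OF h]] by (simp add: fun_eq_iff)
  then show "pair_act h (v, hwv) \<in> pair.span {(v, hwv)}"
    by (simp only:) (intro pair.span_scale pair.span_base, simp)
next
  fix i j assume ij: "i < j" "j < n"
  show "pair_act (munit n i j) (v, hwv) = 0"
    using act_upper_v[OF ij] tens_upper_hwv[OF ij] by (simp add: zero_prod_def fun_eq_iff)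
qed

lemma straight_subspace: "tensor.subspace straight"
proof (rule tensor.subspaceI)
  show "0 \<in> straight" unfolding straight_def by simp
  fix \<phi> \<psi> :: tensor and c
  assume \<phi>: "\<phi> \<in> straight"
  show "\<phi> + \<psi> \<in> straight" if \<psi>: "\<psi> \<in> straight"
  proof -
    have "alternate Y (\<phi> + \<psi>) w = 0"
      if "Y \<subseteq> {p\<in>cells. s \<le> fst p}" "col_len s < card Y" "w \<in> words" for s Y w
      using straight_garnir[OF \<phi> that] straight_garnir[OF \<psi> that] by (simp add: distrib_left sum.distrib)
    moreover have "(\<phi> + \<psi>) w = 0" if "w \<notin> words" for w
      using straight_outside[OF \<phi> that] straight_outside[OF \<psi> that] by simp
    moreover have "(\<phi> + \<psi>) (w \<circ> \<sigma>) = csign \<sigma> * (\<phi> + \<psi>) w" if "\<sigma> \<in> col_perms" "w \<in> words" for \<sigma> w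
      using straight_col[OF \<phi> that] straight_col[OF \<psi> that] by (simp add: distrib_left)
    ultimately show ?thesis unfolding straight_def by blast
  qed
  show "(\<lambda>w. c * \<phi> w) \<in> straight"
  proof -
    have "alternate Y (\<lambda>w. c * \<phi> w) w = 0"
      if "Y \<subseteq> {p\<in>cells. s \<le> fst p}" "col_len s < card Y" "w \<in> words" for s Y w
    proof -
      have "alternate Y (\<lambda>w. c * \<phi> w) w = c * alternate Y \<phi> w"
        by (simp add: sum_distrib_left mult.left_commute)
      then show ?thesis using straight_garnir[OF \<phi> that] by simp
    qed
    moreover have "c * \<phi> w = 0" if "w \<notin> words" for w
      using straight_outside[OF \<phi> that] by simp
    moreover have "c * \<phi> (w \<circ> \<sigma>) = csign \<sigma> * (c * \<phi> w)" if "\<sigma> \<in> col_perms" "w \<in> words" for \<sigma> w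
      using straight_col[OF \<phi> that] by simp
    ultimately show ?thesis unfolding straight_def by blast
  qed
qed

lemma pair_low_fst: "x \<in> pair.low (v, hwv) \<Longrightarrow> fst x \<in> low v"
  by (induction rule: pair.low.induct) (auto intro: low.intros)

lemma pair_low_snd: "x \<in> pair.low (v, hwv) \<Longrightarrow> snd x \<in> tensor.low hwv"
  by (induction rule: pair.low.induct) (auto intro: tensor.low.intros)

lemma low_hwv_straight: "\<phi> \<in> tensor.low hwv \<Longrightarrow> \<phi> \<in> straight"
  by (induction rule: tensor.low.induct) (auto intro: hwv_straight tens_straight)

lemma graph_snd_span: "x \<in> graph \<Longrightarrow> snd x \<in> tensor.span (tensor.low hwv)"
  unfolding graph_def
proof (induction rule: pair.span_induct_alt)
  case base then show ?case unfolding snd_zero by (rule tensor.span_zero)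
next
  case (step c y z)
  show ?case
    unfolding snd_add snd_conv
    by (rule tensor.span_add[OF tensor.span_scale[OF tensor.span_base[OF pair_low_snd[OF step(1)]]] step(2)])
qed

lemma graph_snd_straight: "x \<in> graph \<Longrightarrow> snd x \<in> straight"
  using graph_snd_span tensor.span_minimal[OF _ straight_subspace] low_hwv_straight by blast

text \<open>Modulo proper lowerings an element of the graph is a multiple of
  \<open>(v, hwv)\<close>, with the same factor in both components. The tensor component reveals
  this factor at \<open>top_word\<close>, where lowered tensors vanish and \<open>hwv\<close> is
  1.\<close>

lemma graph_top:
  assumes x: "x \<in> graph"
  shows "fst x - smul (snd x top_word) v \<in> span (low_pos v)"
proof -
  obtain c where c: "x - pair_scale c (v, hwv) \<in> pair.span (pair.low_pos (v, hwv))"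
    using pair.low_split[OF x[unfolded graph_def]] by blast
  have "fst y \<in> span (low_pos v) \<and> snd y top_word = 0" if "y \<in> pair.span (pair.low_pos (v, hwv))" for y
    using that
  proof (induction rule: pair.span_induct_alt)
    case base then show ?case by (simp add: span_zero)
  next
    case (step c y z)
    from step(1) obtain i j y' where y: "y = pair_act (munit n j i) y'" "y' \<in> pair.low (v, hwv)" "i < j" "j < n"
      by (auto simp: pair.low_pos_def)
    have "fst y \<in> low_pos v" using y pair_low_fst[OF y(2)] by (auto simp: low_pos_def)
    moreover have "snd y top_word = 0"
      using tens_lower_top[OF low_hwv_straight[OF pair_low_snd[OF y(2)]] y(3,4)] y(1) by simp
    ultimately show ?case using step(2) by (simp add: span_add span_scale span_base)
  qed
  from this[OF c] have 1: "fst x - smul c v \<in> span (low_pos v)" "snd x top_word - c = 0"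
    by (simp_all add: hwv_top)
  then show ?thesis by simp
qed

lemma v_not_in_low_pos: "v \<notin> span (low_pos v)"
  by (rule low_pos_not_generating[OF v_nonzero act_cartan_v[OF grading_cartan]])

text \<open>Tensors paired with 0 vanish at \<open>top_word\<close>, as otherwise v would be a
  combination of its own proper lowerings. They are stable under the action, so by contravariance
  they are orthogonal to everything generated by \<open>hwv\<close>, in particular to
  themselves.\<close>

lemma graph_fst_zero:
  assumes x: "(0, \<phi>) \<in> graph"
  shows "\<phi> = 0"
proof -
  have top: "\<psi> top_word = 0" if "(0, \<psi>) \<in> graph" for \<psi>
  proof (rule ccontr)
    let ?c = "\<psi> top_word"
    assume nz: "?c \<noteq> 0"
    have "- smul ?c v \<in> span (low_pos v)" using graph_top[OF that] by simp
    then have "smul (- inverse ?c) (- smul ?c v) \<in> span (low_pos v)" by (rule span_scale)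
    then show False using nz v_not_in_low_pos by simp
  qed
  have orth: "\<forall>\<psi>. (0, \<psi>) \<in> graph \<longrightarrow> form z \<psi> = 0" if "z \<in> tensor.low hwv" for z
    using that
  proof (induction rule: tensor.low.induct)
    case base
    show ?case
    proof (intro allI impI)
      fix \<psi> assume p: "(0, \<psi>) \<in> graph"
      show "form hwv \<psi> = 0" using form_hwv[OF graph_snd_straight[OF p, simplified]] top[OF p] by simp
    qed
  next
    case (step z i j)
    show ?case
    proof (intro allI impI)
      fix \<psi> assume p: "(0, \<psi>) \<in> graph"
      have m: "munit n i j \<in> sl n" using step.hyps by (intro munit_sl) simp
      have "(0, tens (munit n i j) \<psi>) \<in> graph"
        using graph_act[OF m p] by (simp add: act_zero_right[OF m])
      then show "form (tens (munit n j i) z) \<psi> = 0"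
        using step by (simp add: form_munit)
    qed
  qed
  have "form \<psi> \<phi> = 0" if "\<psi> \<in> tensor.span (tensor.low hwv)" for \<psi>
    using that
  proof (induction rule: tensor.span_induct_alt)
    case base then show ?case by (simp add: form_def)
  next
    case (step c y z)
    have "form ((\<lambda>w. c * y w) + z) \<phi> = c * form y \<phi> + form z \<phi>"
      by (simp add: form_def distrib_right sum.distrib sum_distrib_left mult.assoc)
    moreover have "form y \<phi> = 0" using orth[OF step(1)] x by blast
    ultimately show ?case using step(2) by (simp only: mult_zero_right add_0)
  qed
  then have "form \<phi> \<phi> = 0" using graph_snd_span[OF x] by simp
  then have "\<phi> w = 0" for w
    using form_self_zero straight_outside graph_snd_straight[OF x] by (cases "w \<in> words") auto
  then show ?thesis by (simp add: fun_eq_iff)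
qed

text \<open>The vectors paired with 0 form a submodule, which misses v by
  \<open>graph_top\<close>.\<close>

lemma graph_snd_zero:
  assumes x: "(x, 0) \<in> graph"
  shows "x = 0"
proof -
  let ?U = "{x. (x, 0) \<in> graph}"
  have "?U = {0} \<or> ?U = UNIV"
  proof (rule no_invariant_subspace)
    show "subspace ?U"
    proof (rule subspaceI)
      show "0 \<in> ?U" using graph_zero by (simp add: zero_prod_def)
      show "x + y \<in> ?U" if "x \<in> ?U" "y \<in> ?U" for x y
        using graph_add[of "(x, 0)" "(y, 0)"] that by simp
      show "smul c x \<in> ?U" if "x \<in> ?U" for c x
        using graph_scale[of "(x, 0)" c] that by (simp add: zero_fun_def)
    qed
    show "act X w \<in> ?U" if X: "X \<in> sl n" and w: "w \<in> ?U" for X w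
      using graph_act[OF X, of "(w, 0)"] w by (simp add: tensor.act_zero_right[OF X])
  qed
  moreover have "?U \<noteq> UNIV"
  proof
    assume "?U = UNIV"
    then have "(v, 0) \<in> graph" by blast
    from graph_top[OF this] show False using v_not_in_low_pos by simp
  qed
  ultimately show ?thesis using x by blast
qed

lemma graph_total: "\<exists>\<phi>. (x, \<phi>) \<in> graph"
proof -
  let ?U = "{x. \<exists>\<phi>. (x, \<phi>) \<in> graph}"
  have "?U = {0} \<or> ?U = UNIV"
  proof (rule no_invariant_subspace)
    show "subspace ?U"
    proof (rule subspaceI)
      show "0 \<in> ?U" using graph_zero by (auto simp: zero_prod_def)
      show "x + y \<in> ?U" if xy: "x \<in> ?U" "y \<in> ?U" for x y
      proof -
        obtain \<phi> \<psi> where "(x, \<phi>) \<in> graph" "(y, \<psi>) \<in> graph" using xy by blast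
        from graph_add[OF this] show ?thesis by auto
      qed
      show "smul c x \<in> ?U" if x: "x \<in> ?U" for c x
      proof -
        obtain \<phi> where "(x, \<phi>) \<in> graph" using x by blast
        from graph_scale[OF this] show ?thesis by auto
      qed
    qed
    show "act X w \<in> ?U" if X: "X \<in> sl n" and w: "w \<in> ?U" for X w
    proof -
      obtain \<phi> where "(w, \<phi>) \<in> graph" using w by blast
      from graph_act[OF X this] show ?thesis by auto
    qed
  qed
  moreover have "v \<in> ?U" using graph_base by blast
  ultimately show ?thesis using v_nonzero by blast
qed

end

subsection \<open>Leading terms\<close>

lemma tri_list_eq: "tri_list n = concat (map (\<lambda>i. map (Pair i) [i..<Suc n]) [1..<Suc n])"
  by (simp add: tri_list_def)

lemma set_tri_list: "set (tri_list n) = tri n"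
  by (force simp: tri_list_eq tri_def simp del: upt_Suc)

lemma sorted_concat_Pair: "sorted xs \<Longrightarrow> sorted (map fst (concat (map (\<lambda>i. map (Pair i) (g i)) xs)))"
  by (induction xs) (auto simp: sorted_append comp_def map_replicate_const)

lemma distinct_concat_Pair:
  "distinct xs \<Longrightarrow> (\<And>i. distinct (g i)) \<Longrightarrow> distinct (concat (map (\<lambda>i. map (Pair i) (g i)) xs))"
  by (induction xs) (auto simp: distinct_map inj_on_def)

definition steps :: "nat \<Rightarrow> (nat \<times> nat \<Rightarrow> int) \<Rightarrow> (nat \<times> nat) list" where
  "steps n x = concat (map (\<lambda>p. replicate (nat (x p)) p) (filter (\<lambda>p. p \<in> tri n - diag n) (tri_list n)))"

lemma set_steps: "p \<in> set (steps n x) \<Longrightarrow> 1 \<le> fst p \<and> fst p < snd p \<and> snd p \<le> n"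
  by (auto simp: steps_def set_tri_list tri_def diag_def split: if_splits)

lemma sorted_replicate_concat:
  "sorted (map fst xs) \<Longrightarrow> sorted (map fst (concat (map (\<lambda>p. replicate (k p) p) xs)))"
  by (induction xs) (auto simp: sorted_append)

lemma sorted_steps: "sorted (map fst (steps n x))"
  unfolding steps_def
  by (intro sorted_replicate_concat sorted_filter) (unfold tri_list_eq, intro sorted_concat_Pair sorted_upt)

lemma count_list_replicate_concat:
  "distinct xs \<Longrightarrow> count_list (concat (map (\<lambda>p. replicate (k p) p) xs)) q = (if q \<in> set xs then k q else 0)"
proof (induction xs)
  case (Cons p xs)
  have "count_list (replicate m p) q = (if p = q then m else 0)" for m by (induction m) auto
  then show ?case using Cons by auto
qed simp

lemma count_list_steps: "count_list (steps n x) (i, j) = (if 1 \<le> i \<and> i < j \<and> j \<le> n then nat (x (i, j)) else 0)"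
proof -
  have "distinct (tri_list n)" unfolding tri_list_eq by (intro distinct_concat_Pair distinct_upt)
  then have "count_list (steps n x) (i, j) = (if (i, j) \<in> tri n - diag n then nat (x (i, j)) else 0)"
    unfolding steps_def by (subst count_list_replicate_concat) (auto simp: set_tri_list)
  moreover have "(i, j) \<in> tri n - diag n \<longleftrightarrow> 1 \<le> i \<and> i < j \<and> j \<le> n" by (auto simp: tri_def diag_def)
  ultimately show ?thesis by simp
qed

lemma monomial_action_eq_foldr: "monomial_action n act f x v = foldr (\<lambda>(i, j). act (f i j)) (steps n x) v"
proof -
  have "compose_list (map (\<lambda>(i, j). act (f i j) ^^ nat (x (i, j))) xs) v
      = foldr (\<lambda>(i, j). act (f i j)) (concat (map (\<lambda>p. replicate (nat (x p)) p) xs)) v" for xs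
    by (induction xs) (auto simp: foldr_replicate)
  then show ?thesis by (simp add: monomial_action_def steps_def)
qed

section \<open>Coordinates of monomials as path counts\<close>

context pipe_setup
begin

text \<open>A step \<open>(i, j)\<close> stands for \<open>f i j\<close>. On coordinates it acts in the direction opposite to that
  on tensors, changing a letter \<open>j\<close> to \<open>i\<close>.\<close>

fun paths :: "(nat \<times> nat) list \<Rightarrow> filling \<Rightarrow> filling \<Rightarrow> nat" where
  "paths [] w u = (if w = u then 1 else 0)"
| "paths ((i, j) # L) w u = (\<Sum>p\<in>{p\<in>cells. w p = j}. paths L (w(p := i)) u)"

definition pair_count :: "filling \<Rightarrow> filling \<Rightarrow> nat \<Rightarrow> nat \<Rightarrow> nat" where
  "pair_count u w i j = card {p\<in>cells. u p = i \<and> w p = j}"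

lemma pair_count_upd:
  assumes p: "p \<in> cells" "u p = i" "w p = j" and "i \<noteq> j" and "i' \<noteq> j'"
  shows "pair_count u w i' j' = pair_count u (w(p := i)) i' j' + (if (i', j') = (i, j) then 1 else 0)"
proof (cases "(i', j') = (i, j)")
  case True
  have "{q\<in>cells. u q = i \<and> w q = j} = insert p {q\<in>cells. u q = i \<and> (w(p := i)) q = j}"
    using assms by auto
  moreover have "p \<notin> {q\<in>cells. u q = i \<and> (w(p := i)) q = j}" using assms by simp
  ultimately show ?thesis using True by (simp add: pair_count_def)
next
  case False
  have "{q\<in>cells. u q = i' \<and> w q = j'} = {q\<in>cells. u q = i' \<and> (w(p := i)) q = j'}"
  proof (rule Collect_cong)
    fix q
    show "(q \<in> cells \<and> u q = i' \<and> w q = j') = (q \<in> cells \<and> u q = i' \<and> (w(p := i)) q = j')"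
      using assms False by (cases "q = p") auto
  qed
  then show ?thesis using False by (simp add: pair_count_def)
qed

lemma pair_count_pos: "pair_count u w i j \<noteq> 0 \<longleftrightarrow> (\<exists>p\<in>cells. u p = i \<and> w p = j)"
  unfolding pair_count_def by (subst card_0_eq) auto

text \<open>Since the steps are sorted by their lower letter, no letter is changed twice.\<close>

lemma paths_nonzeroD:
  assumes "paths L w u \<noteq> 0" "sorted (map fst L)" "\<And>p. p \<in> set L \<Longrightarrow> fst p < snd p"
  shows "(\<forall>p\<in>cells. u p \<le> w p) \<and> (\<forall>i j. i < j \<longrightarrow> count_list L (i, j) = pair_count u w i j)"
  using assms
proof (induction L w u rule: paths.induct)
  case (1 w u)
  then have "w = u" by (simp split: if_splits)
  moreover have "pair_count u u i j = 0" if "i < j" for i j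
    using pair_count_pos[of u u i j] that by auto
  ultimately show ?case by simp
next
  case (2 i j L w u)
  have "\<exists>p\<in>{p\<in>cells. w p = j}. paths L (w(p := i)) u \<noteq> 0"
    using 2(2) by (metis (no_types, lifting) paths.simps(2) sum.neutral)
  then obtain p where p: "p \<in> cells" "w p = j" "paths L (w(p := i)) u \<noteq> 0" by blast
  have ij: "i < j" using 2(4)[of "(i, j)"] by simp
  have srt: "sorted (map fst L)" and fstL: "\<And>q. q \<in> set L \<Longrightarrow> i \<le> fst q" using 2(3) by auto
  have "(\<forall>q\<in>cells. u q \<le> (w(p := i)) q) \<and>
      (\<forall>i' j'. i' < j' \<longrightarrow> count_list L (i', j') = pair_count u (w(p := i)) i' j')"
    by (rule 2(1)[OF _ p(3) srt]) (use p(1,2) 2(4) in auto)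
  then have IH: "\<And>q. q \<in> cells \<Longrightarrow> u q \<le> (w(p := i)) q"
    "\<And>i' j'. i' < j' \<Longrightarrow> count_list L (i', j') = pair_count u (w(p := i)) i' j'"
    by blast+
  have up: "u p = i"
  proof (rule ccontr)
    assume "u p \<noteq> i"
    then have lt: "u p < i" using IH(1)[OF p(1)] by simp
    have "pair_count u (w(p := i)) (u p) i \<noteq> 0" unfolding pair_count_pos using p(1) by auto
    then have "count_list L (u p, i) \<noteq> 0" using IH(2)[OF lt] by simp
    then have "(u p, i) \<in> set L" by (meson count_notin)
    then show False using fstL lt by fastforce
  qed
  show ?case
  proof (intro conjI ballI allI impI)
    fix q assume q: "q \<in> cells"
    show "u q \<le> w q" using IH(1)[OF q] up p(2) ij by (cases "q = p") auto
  next
    fix i' j' :: nat assume "i' < j'"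
    then show "count_list ((i, j) # L) (i', j') = pair_count u w i' j'"
      using IH(2) pair_count_upd[where u = u and w = w and i' = i' and j' = j', OF p(1) up p(2)] ij by auto
  qed
qed

lemma paths_nonzeroI:
  assumes "w \<in> words" "u \<in> words" "\<forall>p\<in>cells. u p \<le> w p"
    and "\<forall>i j. i < j \<longrightarrow> count_list L (i, j) = pair_count u w i j"
    and "\<And>p. p \<in> set L \<Longrightarrow> fst p < snd p"
  shows "paths L w u \<noteq> 0"
  using assms
proof (induction L w u rule: paths.induct)
  case (1 w u)
  have "w p = u p" if p: "p \<in> cells" for p
  proof (rule ccontr)
    assume "w p \<noteq> u p"
    then have "u p < w p" using bspec[OF 1(3) p] by simp
    then have "pair_count u w (u p) (w p) = 0" using 1(4) by simp
    then show False using pair_count_pos[of u w "u p" "w p"] p by auto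
  qed
  then have "w = u" by (rule words_eqI[OF 1(1,2)])
  then show ?case by simp
next
  case (2 i j L w u)
  have ij: "i < j" using 2(6)[of "(i, j)"] by simp
  have "pair_count u w i j \<noteq> 0" using 2(5) ij by (metis count_list.simps(2) add_is_0 zero_neq_one)
  then obtain p where p: "p \<in> cells" "u p = i" "w p = j" unfolding pair_count_pos by blast
  have i: "i \<in> {1..n}" using words_range[OF 2(3) p(1)] p(2) by simp
  have "paths L (w(p := i)) u \<noteq> 0"
  proof (rule 2(1))
    show "p \<in> {p\<in>cells. w p = j}" using p by simp
    show "w(p := i) \<in> words" using words_upd[OF 2(2) p(1) i] .
    show "\<forall>q\<in>cells. u q \<le> (w(p := i)) q" using 2(4) p(2) by simp
    show "\<forall>i' j'. i' < j' \<longrightarrow> count_list L (i', j') = pair_count u (w(p := i)) i' j'"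
    proof (intro allI impI)
      fix i' j' :: nat assume *: "i' < j'"
      then have "count_list ((i, j) # L) (i', j') = pair_count u w i' j'" using 2(5) by blast
      then show "count_list L (i', j') = pair_count u (w(p := i)) i' j'"
        using pair_count_upd[where u = u and w = w and i' = i' and j' = j', OF p] ij * by (auto split: if_splits)
    qed
    show "fst q < snd q" if "q \<in> set L" for q using 2(6)[of q] that by simp
  qed (rule 2(3))
  moreover have "p \<in> {p\<in>cells. w p = j}" using p by simp
  ultimately have "\<not> (\<forall>q\<in>{p\<in>cells. w p = j}. paths L (w(q := i)) u = 0)" by (meson bspec)
  moreover have fin: "finite {p\<in>cells. w p = j}" by simp
  ultimately show ?case unfolding paths.simps(2) sum_eq_0_iff[OF fin] by simp
qed

section \<open>Words of patterns and the minimum property\<close>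

abbreviation pattern_steps :: "filling \<Rightarrow> (nat \<times> nat) list" where
  "pattern_steps z \<equiv> steps n (pattern_point z)"

text \<open>The coordinate at which the monomial of z is detected: the transitions from
  \<open>top_word\<close> to this word occur with the multiplicities \<open>pattern_point z\<close>,
  see \<open>pair_count_pattern_word\<close>.\<close>

definition pattern_word :: "filling \<Rightarrow> filling" where
  "pattern_word z = (\<lambda>p\<in>cells. w_ideal n S (level z (fst p)) (snd p))"

lemma pattern_word_range:
  assumes z: "z \<in> patterns" and p: "p \<in> cells"
  shows "pattern_word z p \<in> {snd p..n}"
  using w_ideal_range[OF level_in_order_ideals[OF z], of "snd p" "fst p" S] diag_in_level_iff[OF z, of "snd p" "fst p"]
    cellsD[OF p] p by (simp add: pattern_word_def)

lemma pattern_word_in_words: "z \<in> patterns \<Longrightarrow> pattern_word z \<in> words"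
  unfolding words_def
  using pattern_word_range cellsD by (intro PiE_I) (fastforce simp: pattern_word_def)+

lemma pair_count_pattern_word:
  assumes z: "z \<in> patterns"
  shows "int (pair_count top_word (pattern_word z) i j) = pattern_point z (i, j)"
proof -
  have "{p\<in>cells. top_word p = i \<and> pattern_word z p = j}
      = (\<lambda>s. (s, i)) ` {s. 1 \<le> i \<and> s < part i \<and> w_ideal n S (level z s) i = j}"
    by (force simp: pattern_word_def cells_def)
  then show ?thesis by (simp add: pair_count_def pattern_point_def card_image inj_on_def)
qed

lemma pattern_point_row_sum:
  assumes z: "z \<in> patterns" and i: "i \<in> {1..n}"
  shows "(\<Sum>j\<in>{i..n}. pattern_point z (i, j)) = int (part i)"
proof -
  have "(\<lambda>p. real_of_int (pattern_point z p)) \<in> region (\<lambda>i. real (part i))"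
    using pattern_point_in_polytope[OF z] pipe_polytope_subset_region by (auto simp: lattice_points_def)
  then have "(\<Sum>j\<in>{i..n}. real_of_int (pattern_point z (i, j))) = real (part i)"
    using i unfolding region_def by blast
  then have "real_of_int (\<Sum>j\<in>{i..n}. pattern_point z (i, j)) = real_of_int (int (part i))" by simp
  then show ?thesis by (simp only: of_int_eq_iff)
qed

text \<open>Monomials do not see the diagonal exponents, but these are recovered from the row sums,
  which equal \<open>part i\<close> for every pattern.\<close>

lemma pattern_eqI:
  assumes z: "z \<in> patterns" and z': "z' \<in> patterns"
    and eq: "\<And>i j. 1 \<le> i \<Longrightarrow> i < j \<Longrightarrow> j \<le> n \<Longrightarrow> pattern_point z (i, j) = pattern_point z' (i, j)"
  shows "z = z'"
proof -
  have "pattern_point z p = pattern_point z' p" for p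
  proof (cases "p \<in> tri n")
    case True
    then obtain i j where p: "p = (i, j)" "1 \<le> i" "i \<le> j" "j \<le> n" by (auto simp: tri_def)
    have "(\<Sum>k\<in>{i..n}. pattern_point z (i, k)) = (\<Sum>k\<in>{i..n}. pattern_point z' (i, k))"
      using p by (simp add: pattern_point_row_sum[OF z] pattern_point_row_sum[OF z'])
    moreover have "(\<Sum>k\<in>{Suc i..n}. pattern_point z (i, k)) = (\<Sum>k\<in>{Suc i..n}. pattern_point z' (i, k))"
      using p eq by (intro sum.cong) auto
    ultimately have "pattern_point z (i, i) = pattern_point z' (i, i)"
      using p by (simp add: sum.atLeast_Suc_atMost)
    then show ?thesis using p eq by (cases "i = j") auto
  next
    case False
    then show ?thesis by (simp add: pattern_point_outside[OF z] pattern_point_outside[OF z'])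
  qed
  then have "pattern_point z = pattern_point z'" by (rule ext)
  then show ?thesis using inj_on_pattern_point z z' by (simp add: inj_on_def)
qed

text \<open>A weight for which, among all fillings contributing to a given coordinate, the one coming from
  the permutations \<^const>\<open>w_ideal\<close> is the unique minimum. The base is large enough for the
  lowest row in which two fillings differ to decide.\<close>

definition cell_weight :: "nat \<Rightarrow> nat \<Rightarrow> int" where
  "cell_weight i j = int (n * card cells + 1) ^ i * int (tail_perm n S i j)"

definition pattern_weight :: "filling \<Rightarrow> int" where
  "pattern_weight z = (\<Sum>i\<in>{1..n}. \<Sum>j\<in>{1..n}.
     if i < j then pattern_point z (i, j) * (cell_weight i j - cell_weight i i) else 0)"

text \<open>Turns a linear function of the exponents into a sum over cells. Subtracting
  \<open>g i i\<close> makes the invisible diagonal contribute 0; the resulting correction depends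
  on u alone and is constant over the support of \<open>hwv\<close>.\<close>

lemma sum_pair_count:
  fixes g :: "nat \<Rightarrow> nat \<Rightarrow> int"
  assumes u: "u \<in> words" and w: "w \<in> words" and le: "\<forall>p\<in>cells. u p \<le> w p"
  shows "(\<Sum>i\<in>{1..n}. \<Sum>j\<in>{1..n}. if i < j then int (pair_count u w i j) * (g i j - g i i) else 0)
    = (\<Sum>p\<in>cells. g (u p) (w p)) - (\<Sum>p\<in>cells. g (u p) (u p))"
proof -
  have "(\<Sum>p\<in>cells. g (u p) (w p)) - (\<Sum>p\<in>cells. g (u p) (u p)) = (\<Sum>p\<in>cells. g (u p) (w p) - g (u p) (u p))"
    by (simp add: sum_subtractf)
  also have "\<dots> = (\<Sum>(i, j)\<in>{1..n} \<times> {1..n}. \<Sum>p\<in>{p\<in>cells. (u p, w p) = (i, j)}. g (u p) (w p) - g (u p) (u p))"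
    unfolding case_prod_beta prod.collapse
    by (rule sum.group[symmetric]) (use words_range[OF u] words_range[OF w] in auto)
  also have "\<dots> = (\<Sum>(i, j)\<in>{1..n} \<times> {1..n}. if i < j then int (pair_count u w i j) * (g i j - g i i) else 0)"
  proof (rule sum.cong[OF refl], clarify)
    fix i j
    have "(\<Sum>p\<in>{p\<in>cells. (u p, w p) = (i, j)}. g (u p) (w p) - g (u p) (u p))
        = (\<Sum>p\<in>{p\<in>cells. u p = i \<and> w p = j}. g i j - g i i)"
      by (rule sum.cong) auto
    also have "\<dots> = int (pair_count u w i j) * (g i j - g i i)" by (simp add: pair_count_def)
    also have "\<dots> = (if i < j then int (pair_count u w i j) * (g i j - g i i) else 0)"
    proof (cases "i < j")
      case False
      have "i = j \<or> pair_count u w i j = 0" using False le pair_count_pos[of u w i j] by fastforce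
      then show ?thesis using False by auto
    qed simp
    finally show "(\<Sum>p\<in>{p\<in>cells. (u p, w p) = (i, j)}. g (u p) (w p) - g (u p) (u p))
        = (if i < j then int (pair_count u w i j) * (g i j - g i i) else 0)" .
  qed
  also have "\<dots> = (\<Sum>i\<in>{1..n}. \<Sum>j\<in>{1..n}. if i < j then int (pair_count u w i j) * (g i j - g i i) else 0)"
    by (rule sum.cartesian_product[symmetric])
  finally show ?thesis by simp
qed

text \<open>After reindexing by the inverse \<rho> of \<sigma>, the letter at
  \<open>\<rho> q\<close> is compared with the letter at q in the scale of the row of q. In the
  lowest row that is moved, \<open>\<rho> q\<close> lies strictly above q in the same column, so
  \<open>tail_perm_w_ideal_greater\<close> makes the change positive. The base outweighs all losses
  in the rows above.\<close>

lemma cell_weight_minimal: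
  assumes z: "z \<in> patterns" and s: "\<sigma> \<in> col_perms" "\<sigma> \<noteq> id"
    and le: "\<And>p. p \<in> cells \<Longrightarrow> snd (\<sigma> p) \<le> pattern_word z p"
  shows "(\<Sum>p\<in>cells. cell_weight (snd p) (pattern_word z p)) < (\<Sum>p\<in>cells. cell_weight (snd (\<sigma> p)) (pattern_word z p))"
proof -
  define \<rho> where "\<rho> = inv_into UNIV \<sigma>"
  define w where "w = pattern_word z"
  define B where "B = int (n * card cells + 1)"
  let ?t = "\<lambda>q p. int (tail_perm n S (snd q) (w p))"
  have r: "\<rho> \<in> col_perms" using col_perms_inv[OF s(1)] by (simp add: \<rho>_def)
  note pr = col_permsD(1)[OF r]
  have \<sigma>\<rho>: "\<sigma> (\<rho> q) = q" for q using permutes_inverses(1)[OF col_permsD(1)[OF s(1)]] by (simp add: \<rho>_def)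
  have "\<rho> \<noteq> id"
  proof
    assume "\<rho> = id"
    then have "\<sigma> q = q" for q using \<sigma>\<rho>[of q] by simp
    then show False using s(2) by (simp add: fun_eq_iff)
  qed
  have "(\<Sum>p\<in>cells. cell_weight (snd (\<sigma> p)) (w p)) = (\<Sum>q\<in>cells. cell_weight (snd (\<sigma> (\<rho> q))) (w (\<rho> q)))"
    using sum.permute[OF pr, of "\<lambda>p. cell_weight (snd (\<sigma> p)) (w p)"] by (simp add: comp_def)
  then have diff: "(\<Sum>p\<in>cells. cell_weight (snd (\<sigma> p)) (w p)) - (\<Sum>p\<in>cells. cell_weight (snd p) (w p))
      = (\<Sum>q\<in>cells. B ^ snd q * (?t q (\<rho> q) - ?t q q))"
    by (simp add: \<sigma>\<rho> cell_weight_def B_def sum_subtractf right_diff_distrib)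
  define M where "M = {q\<in>cells. \<rho> q \<noteq> q}"
  define i where "i = Max (snd ` M)"
  have "M \<noteq> {}"
  proof
    assume "M = {}"
    then have "\<rho> q = q" for q using permutes_not_in[OF pr, of q] unfolding M_def by blast
    then show False using \<open>\<rho> \<noteq> id\<close> by (simp add: fun_eq_iff)
  qed
  moreover have finM: "finite M" by (simp add: M_def)
  ultimately have "i \<in> snd ` M" unfolding i_def by (intro Max_in) auto
  then obtain q0 where q0: "q0 \<in> M" "snd q0 = i" by blast
  have i_max: "snd q \<le> i" if "q \<in> M" for q using that finM by (simp add: i_def)
  have i1: "1 \<le> i" using q0 cellsD[of q0] by (simp add: M_def)
  have pos: "?t q q < ?t q (\<rho> q)" if q: "q \<in> M" "snd q = i" for q
  proof -
    have qc: "q \<in> cells" "\<rho> q \<noteq> q" using q by (simp_all add: M_def)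
    have rc: "\<rho> q \<in> cells" "fst (\<rho> q) = fst q" using col_perms_in_cells[OF r qc(1)] col_permsD(2)[OF r] by auto
    have ne: "snd (\<rho> q) \<noteq> i" using qc(2) rc(2) q(2) by (metis prod.collapse)
    have "snd (\<rho> q) \<le> i"
    proof (rule ccontr)
      assume "\<not> snd (\<rho> q) \<le> i"
      then have "\<rho> q \<notin> M" using i_max by blast
      then have "\<rho> (\<rho> q) = \<rho> q" using rc(1) by (simp add: M_def)
      then show False using permutes_inj[OF pr] qc(2) by (auto dest: injD)
    qed
    then have lt: "snd (\<rho> q) < snd q" using ne q(2) by simp
    let ?J = "level z (fst q)"
    have J: "?J \<in> order_ideals n" using level_in_order_ideals[OF z] .
    have d: "(snd q, snd q) \<in> ?J" "(snd (\<rho> q), snd (\<rho> q)) \<in> ?J"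
      using diag_in_level_iff[OF z] cellsD[OF qc(1)] cellsD[OF rc(1)] rc(2) by auto
    have wq: "w q = w_ideal n S ?J (snd q)" "w (\<rho> q) = w_ideal n S ?J (snd (\<rho> q))"
      using qc(1) rc by (simp_all add: w_def pattern_word_def)
    \<comment> \<open>Here \<open>le\<close> enters: the letter is at least the row to which
      \<sigma> matches it, so the tail keeps it within the range from that row to n, as
      \<open>tail_perm_w_ideal_greater\<close> demands.\<close>
    have "snd q \<le> w (\<rho> q)" using le[OF rc(1)] by (simp add: \<sigma>\<rho> w_def)
    moreover have "w (\<rho> q) \<le> n" using words_range[OF pattern_word_in_words[OF z] rc(1)] by (simp add: w_def)
    ultimately have "snd q \<le> tail_perm n S (snd q) (w (\<rho> q))"
      using permutes_in_image[OF tail_perm_permutes[of n S "snd q"], of "w (\<rho> q)"] by simp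
    from tail_perm_w_ideal_greater[OF J d(1,2) lt, of S] this
    show ?thesis by (simp add: wq tail_perm_w_ideal[OF J d(1)])
  qed
  have B1: "1 \<le> B" by (simp add: B_def)
  have t_le: "tail_perm n S (snd q) (w p) \<le> n" if "p \<in> cells" for p q
  proof -
    have "w p \<le> n" using words_range[OF pattern_word_in_words[OF z] that] by (simp add: w_def)
    then show ?thesis
      using permutes_in_image[OF tail_perm_permutes[of n S "snd q"], of "w p"]
        permutes_not_in[OF tail_perm_permutes[of n S "snd q"], of "w p"]
      by (cases "w p \<in> {snd q..n}") auto
  qed
  have other: "- (int n * B ^ (i - 1)) \<le> B ^ snd q * (?t q (\<rho> q) - ?t q q)" if q: "q \<in> cells" for q
  proof -
    consider "\<rho> q = q" | "q \<in> M" "snd q = i" | "q \<in> M" "snd q \<le> i - 1"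
      using q i_max[of q] by (fastforce simp: M_def)
    then show ?thesis
    proof cases
      case 1
      then show ?thesis using B1 by simp
    next
      case 2
      have "0 \<le> B ^ snd q * (?t q (\<rho> q) - ?t q q)" using pos[OF 2] B1 by simp
      moreover have "0 \<le> int n * B ^ (i - 1)" using B1 by simp
      ultimately show ?thesis by linarith
    next
      case 3
      have "- int n \<le> ?t q (\<rho> q) - ?t q q" using t_le[OF q, of q] by linarith
      then have "B ^ snd q * (- int n) \<le> B ^ snd q * (?t q (\<rho> q) - ?t q q)"
        using B1 by (intro mult_left_mono) auto
      moreover have "B ^ snd q * int n \<le> B ^ (i - 1) * int n"
        using B1 3 by (intro mult_right_mono power_increasing) auto
      ultimately show ?thesis by (simp add: mult.commute)
    qed
  qed
  have q0c: "q0 \<in> cells" using q0 by (simp add: M_def)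
  have "B ^ i \<le> B ^ snd q0 * (?t q0 (\<rho> q0) - ?t q0 q0)"
  proof -
    have "B ^ i * 1 \<le> B ^ i * (?t q0 (\<rho> q0) - ?t q0 q0)"
      using pos[OF q0] B1 by (intro mult_left_mono) auto
    then show ?thesis by (simp add: q0(2))
  qed
  moreover have "(\<Sum>q\<in>cells - {q0}. - (int n * B ^ (i - 1)))
      \<le> (\<Sum>q\<in>cells - {q0}. B ^ snd q * (?t q (\<rho> q) - ?t q q))"
    using other by (intro sum_mono) auto
  \<comment> \<open>This estimate dictates the base: fewer than \<open>card cells\<close> losses of
    at most \<open>n * B ^ (i - 1)\<close> each stay below the gain \<open>B ^ i\<close>.\<close>
  moreover have "int (card (cells - {q0})) * (int n * B ^ (i - 1)) < B ^ i"
  proof -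
    have c: "int (card (cells - {q0})) * int n \<le> int (n * card cells)"
      using card_mono[of cells "cells - {q0}"] by (simp add: mult.commute mult_left_mono)
    have "int (card (cells - {q0})) * int n * B ^ (i - 1) \<le> int (n * card cells) * B ^ (i - 1)"
      using c B1 by (intro mult_right_mono) auto
    also have "\<dots> < B * B ^ (i - 1)"
    proof (rule mult_strict_right_mono)
      show "int (n * card cells) < B" by (simp add: B_def)
      show "0 < B ^ (i - 1)" using B1 by (intro zero_less_power) linarith
    qed
    also have "\<dots> = B ^ i" using i1 by (cases i) auto
    finally show ?thesis by (simp add: mult.assoc)
  qed
  ultimately have "0 < B ^ snd q0 * (?t q0 (\<rho> q0) - ?t q0 q0)
      + (\<Sum>q\<in>cells - {q0}. B ^ snd q * (?t q (\<rho> q) - ?t q q))"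
    unfolding sum_constant by linarith
  also have "\<dots> = (\<Sum>q\<in>cells. B ^ snd q * (?t q (\<rho> q) - ?t q q))"
    by (rule sum.remove[OF finite_cells q0c, symmetric])
  finally show ?thesis using diff by (simp add: w_def)
qed

text \<open>A path forces the exponents of z to be the transition numbers between u and
  \<open>pattern_word z'\<close>. For u = \<open>top_word\<close> these are the exponents of z'. Any
  other u in the support of \<open>hwv\<close> comes from a nontrivial column permutation, and the
  minimum property makes the weight of z strictly larger.\<close>

lemma leading_word:
  assumes z: "z \<in> patterns" and z': "z' \<in> patterns"
    and path: "paths (pattern_steps z) (pattern_word z') u \<noteq> 0" and u: "hwv u \<noteq> 0"
  shows "(u = top_word \<and> z = z') \<or> pattern_weight z' < pattern_weight z"
proof -
  obtain \<sigma> where s: "\<sigma> \<in> col_perms" and us: "\<And>p. p \<in> cells \<Longrightarrow> u p = snd (\<sigma> p)"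
    using hwv_nonzeroD(2)[OF u] by blast
  note uw = hwv_nonzeroD(1)[OF u]
  have le: "\<forall>p\<in>cells. u p \<le> pattern_word z' p"
    and cnt: "\<And>i j. i < j \<Longrightarrow> count_list (pattern_steps z) (i, j) = pair_count u (pattern_word z') i j"
    using paths_nonzeroD[OF path sorted_steps] set_steps by blast+
  have nn: "0 \<le> pattern_point z p" for p by (cases p) (simp add: pattern_point_def)
  have cnt': "pattern_point z (i, j) = int (pair_count u (pattern_word z') i j)"
    if "1 \<le> i" "i < j" "j \<le> n" for i j
    using cnt[of i j] that nn[of "(i, j)"] by (simp add: count_list_steps)
  show ?thesis
  proof (cases "\<sigma> = id")
    case True
    then have ut: "u = top_word" using us by (intro words_eqI[OF uw top_word_in_words]) simp
    have "z = z'"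
      by (rule pattern_eqI[OF z z']) (simp add: cnt' ut pair_count_pattern_word[OF z'])
    then show ?thesis using ut by simp
  next
    case False
    let ?w = "pattern_word z'"
    have w: "?w \<in> words" using pattern_word_in_words[OF z'] .
    have top_le: "\<forall>p\<in>cells. top_word p \<le> ?w p" using pattern_word_range[OF z'] by simp
    have "pattern_weight z = (\<Sum>i\<in>{1..n}. \<Sum>j\<in>{1..n}.
        if i < j then int (pair_count u ?w i j) * (cell_weight i j - cell_weight i i) else 0)"
      unfolding pattern_weight_def using cnt' by (intro sum.cong refl) auto
    also have "\<dots> = (\<Sum>p\<in>cells. cell_weight (u p) (?w p)) - (\<Sum>p\<in>cells. cell_weight (u p) (u p))"
      by (rule sum_pair_count[OF uw w le])
    also have "(\<Sum>p\<in>cells. cell_weight (u p) (u p)) = (\<Sum>p\<in>cells. cell_weight (snd (\<sigma> p)) (snd (\<sigma> p)))"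
      using us by (intro sum.cong) auto
    also have "\<dots> = (\<Sum>p\<in>cells. cell_weight (snd p) (snd p))"
      using sum.permute[OF col_permsD(1)[OF s], of "\<lambda>p. cell_weight (snd p) (snd p)"] by (simp add: comp_def)
    also have "(\<Sum>p\<in>cells. cell_weight (u p) (?w p)) = (\<Sum>p\<in>cells. cell_weight (snd (\<sigma> p)) (?w p))"
      using us by (intro sum.cong) auto
    finally have 1: "pattern_weight z = (\<Sum>p\<in>cells. cell_weight (snd (\<sigma> p)) (?w p))
      - (\<Sum>p\<in>cells. cell_weight (snd p) (snd p))" .
    have "pattern_weight z' = (\<Sum>i\<in>{1..n}. \<Sum>j\<in>{1..n}.
        if i < j then int (pair_count top_word ?w i j) * (cell_weight i j - cell_weight i i) else 0)"
      unfolding pattern_weight_def pair_count_pattern_word[OF z'] ..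
    also have "\<dots> = (\<Sum>p\<in>cells. cell_weight (top_word p) (?w p)) - (\<Sum>p\<in>cells. cell_weight (top_word p) (top_word p))"
      by (rule sum_pair_count[OF top_word_in_words w top_le])
    also have "\<dots> = (\<Sum>p\<in>cells. cell_weight (snd p) (?w p)) - (\<Sum>p\<in>cells. cell_weight (snd p) (snd p))"
      by simp
    finally have 2: "pattern_weight z' = (\<Sum>p\<in>cells. cell_weight (snd p) (?w p))
      - (\<Sum>p\<in>cells. cell_weight (snd p) (snd p))" .
    have "(\<Sum>p\<in>cells. cell_weight (snd p) (?w p)) < (\<Sum>p\<in>cells. cell_weight (snd (\<sigma> p)) (?w p))"
      by (rule cell_weight_minimal[OF z' s False]) (use le us in fastforce)
    then show ?thesis using 1 2 by linarith
  qed
qed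

lemma paths_pattern_word:
  assumes z: "z \<in> patterns"
  shows "paths (pattern_steps z) (pattern_word z) top_word \<noteq> 0"
proof (rule paths_nonzeroI[OF pattern_word_in_words[OF z] top_word_in_words])
  show "\<forall>p\<in>cells. top_word p \<le> pattern_word z p" using pattern_word_range[OF z] by simp
  show "fst p < snd p" if "p \<in> set (pattern_steps z)" for p using set_steps[OF that] by simp
  show "\<forall>i j. i < j \<longrightarrow> count_list (pattern_steps z) (i, j) = pair_count top_word (pattern_word z) i j"
  proof (intro allI impI)
    fix i j :: nat assume ij: "i < j"
    have "pair_count top_word (pattern_word z) i j = nat (pattern_point z (i, j))"
      using pair_count_pattern_word[OF z, of i j] by simp
    moreover have "pattern_point z (i, j) = 0" if "\<not> (1 \<le> i \<and> j \<le> n)"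
      by (rule pattern_point_outside[OF z]) (use that in \<open>auto simp: tri_def\<close>)
    ultimately show "count_list (pattern_steps z) (i, j) = pair_count top_word (pattern_word z) i j"
      using ij by (auto simp: count_list_steps)
  qed
qed

end

section \<open>Triangularity, independence and spanning\<close>

context pipe_module
begin

definition f_coeff :: "nat \<Rightarrow> nat \<Rightarrow> complex" where
  "f_coeff i j = (SOME c. c \<noteq> 0 \<and> f i j = c \<cdot>\<^sub>m munit n (j - 1) (i - 1))"

lemma f_eq:
  assumes "1 \<le> i" "i < j" "j \<le> n"
  shows "f_coeff i j \<noteq> 0" "f i j = f_coeff i j \<cdot>\<^sub>m munit n (j - 1) (i - 1)"
  using someI_ex[OF negative_root_vector[OF f_root[OF assms] assms]] by (simp_all add: f_coeff_def)

lemma f_sl: "1 \<le> i \<Longrightarrow> i < j \<Longrightarrow> j \<le> n \<Longrightarrow> f i j \<in> sl n"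
  using f_root by (simp add: root_vector_def)

definition tens_steps :: "(nat \<times> nat) list \<Rightarrow> filling \<Rightarrow> complex" where
  "tens_steps L = foldr (\<lambda>(i, j). tens (f i j)) L hwv"

lemma foldr_graph:
  assumes "\<And>p. p \<in> set L \<Longrightarrow> 1 \<le> fst p \<and> fst p < snd p \<and> snd p \<le> n"
  shows "(foldr (\<lambda>(i, j). act (f i j)) L v, tens_steps L) \<in> graph"
  using assms
proof (induction L)
  case Nil
  then show ?case by (simp add: tens_steps_def graph_base)
next
  case (Cons p L)
  obtain i j where p: "p = (i, j)" by force
  have "f i j \<in> sl n" using Cons.prems[of p] by (intro f_sl) (simp_all add: p)
  from graph_act[OF this Cons.IH] Cons.prems show ?case by (simp add: p tens_steps_def)
qed

lemma tens_f:
  assumes ij: "1 \<le> i" "i < j" "j \<le> n" and w: "w \<in> words"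
  shows "tens (f i j) \<phi> w = f_coeff i j * (\<Sum>p\<in>{p\<in>cells. w p = j}. \<phi> (w(p := i)))"
proof -
  have "tens (f i j) \<phi> w = f_coeff i j * tens (munit n (j - 1) (i - 1)) \<phi> w"
    by (subst f_eq(2)[OF ij]) (rule tens_scale_left[OF munit_carrier])
  also have "tens (munit n (j - 1) (i - 1)) \<phi> w = (\<Sum>p\<in>{p\<in>cells. w p = j}. \<phi> (w(p := i)))"
    using tens_munit[OF w, of "j - 1" "i - 1"] ij by simp
  finally show ?thesis .
qed

text \<open>Root vectors are matrix units only up to nonzero scalars. These collect in one nonzero
  factor per monomial, which does not disturb the triangular shape.\<close>

definition steps_coeff :: "(nat \<times> nat) list \<Rightarrow> complex" where
  "steps_coeff L = prod_list (map (\<lambda>(i, j). f_coeff i j) L)"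

lemma tens_steps_eq:
  assumes "\<And>p. p \<in> set L \<Longrightarrow> 1 \<le> fst p \<and> fst p < snd p \<and> snd p \<le> n" and "w \<in> words"
  shows "tens_steps L w = steps_coeff L * (\<Sum>u\<in>words. of_nat (paths L w u) * hwv u)"
  using assms
proof (induction L arbitrary: w)
  case Nil
  have "(\<Sum>u\<in>words. of_nat (paths [] w u) * hwv u) = (\<Sum>u\<in>words. if w = u then hwv u else 0)"
    by (intro sum.cong) auto
  then show ?case using Nil by (simp add: tens_steps_def steps_coeff_def)
next
  case (Cons p L)
  obtain i j where p: "p = (i, j)" by force
  have ij: "1 \<le> i" "i < j" "j \<le> n" using Cons.prems(1)[of p] by (simp_all add: p)
  let ?C = "{q\<in>cells. w q = j}"
  have upd: "w(q := i) \<in> words" if "q \<in> ?C" for q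
    using words_upd[OF Cons.prems(2), of q i] that ij by simp
  have "tens_steps (p # L) w = f_coeff i j * (\<Sum>q\<in>?C. tens_steps L (w(q := i)))"
    using tens_f[OF ij Cons.prems(2), of "tens_steps L"] by (simp add: tens_steps_def p)
  also have "(\<Sum>q\<in>?C. tens_steps L (w(q := i)))
      = (\<Sum>q\<in>?C. steps_coeff L * (\<Sum>u\<in>words. of_nat (paths L (w(q := i)) u) * hwv u))"
    using Cons.IH upd Cons.prems(1) by (intro sum.cong refl) simp
  also have "\<dots> = steps_coeff L * (\<Sum>u\<in>words. \<Sum>q\<in>?C. of_nat (paths L (w(q := i)) u) * hwv u)"
    unfolding sum_distrib_left[symmetric] by (subst sum.swap) (rule refl)
  also have "\<dots> = steps_coeff L * (\<Sum>u\<in>words. of_nat (paths (p # L) w u) * hwv u)"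
    unfolding p paths.simps(2) of_nat_sum sum_distrib_right ..
  finally show ?case by (simp add: steps_coeff_def p mult.assoc)
qed

lemma steps_coeff_nonzero: "steps_coeff (steps n x) \<noteq> 0"
  using set_steps[of _ n x] f_eq(1) by (force simp: steps_coeff_def prod_list_zero_iff)

abbreviation basis_vector :: "filling \<Rightarrow> 'v" where
  "basis_vector z \<equiv> monomial_action n act f (pattern_point z) v"

abbreviation basis_tensor :: "filling \<Rightarrow> filling \<Rightarrow> complex" where
  "basis_tensor z \<equiv> tens_steps (pattern_steps z)"

abbreviation combination :: "tensor \<Rightarrow> filling \<Rightarrow> complex" where
  "combination c w \<equiv> \<Sum>z\<in>patterns. c z * basis_tensor z w"

lemma basis_graph: "(basis_vector z, basis_tensor z) \<in> graph"
  unfolding monomial_action_eq_foldr by (rule foldr_graph) (rule set_steps)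

lemma basis_tensor_apply:
  assumes "w \<in> words"
  shows "basis_tensor z w = steps_coeff (pattern_steps z) *
    (\<Sum>u\<in>words. of_nat (paths (pattern_steps z) w u) * hwv u)"
  by (rule tens_steps_eq[OF set_steps assms])

lemma basis_tensor_diagonal:
  assumes z: "z \<in> patterns"
  shows "basis_tensor z (pattern_word z) \<noteq> 0"
proof -
  let ?P = "paths (pattern_steps z) (pattern_word z)"
  have "(\<Sum>u\<in>words. of_nat (?P u) * hwv u) = (\<Sum>u\<in>words. if u = top_word then of_nat (?P top_word) else 0)"
  proof (rule sum.cong[OF refl])
    fix u
    show "of_nat (?P u) * hwv u = (if u = top_word then of_nat (?P top_word) else 0)"
      using leading_word[OF z z, of u] by (cases "u = top_word") (auto simp: hwv_top)
  qed
  then have "(\<Sum>u\<in>words. of_nat (?P u) * hwv u) = of_nat (?P top_word)" by simp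
  then show ?thesis
    using paths_pattern_word[OF z] steps_coeff_nonzero
    by (simp add: basis_tensor_apply[OF pattern_word_in_words[OF z]])
qed

lemma basis_tensor_triangular:
  assumes z: "z \<in> patterns" "z' \<in> patterns" "z \<noteq> z'" and le: "pattern_weight z \<le> pattern_weight z'"
  shows "basis_tensor z (pattern_word z') = 0"
proof -
  have "of_nat (paths (pattern_steps z) (pattern_word z') u) * hwv u = 0" for u
    using leading_word[OF z(1,2), of u] z(3) le by force
  then have "(\<Sum>u\<in>words. of_nat (paths (pattern_steps z) (pattern_word z') u) * hwv u) = 0"
    by (intro sum.neutral ballI)
  then show ?thesis
    unfolding basis_tensor_apply[OF pattern_word_in_words[OF z(2)]] by (simp only: mult_zero_right)
qed

text \<open>At the word of a pattern of largest weight in the support of c, every other pattern of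
  the support contributes 0, and the diagonal coordinate is nonzero.\<close>

lemma basis_tensor_independent:
  assumes sum: "\<And>w. w \<in> words \<Longrightarrow> combination c w = 0" and z: "z \<in> patterns"
  shows "c z = 0"
proof (rule ccontr)
  assume nz: "c z \<noteq> 0"
  define K where "K = {z\<in>patterns. c z \<noteq> 0}"
  have K: "finite K" "K \<noteq> {}" using finite_patterns z nz by (auto simp: K_def)
  then have "Max (pattern_weight ` K) \<in> pattern_weight ` K" by (intro Max_in) auto
  then obtain z0 where z0: "z0 \<in> K" "pattern_weight z0 = Max (pattern_weight ` K)" by force
  have z0p: "z0 \<in> patterns" "c z0 \<noteq> 0" using z0(1) by (simp_all add: K_def)
  have "c y * basis_tensor y (pattern_word z0) = (if y = z0 then c z0 * basis_tensor z0 (pattern_word z0) else 0)"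
    if y: "y \<in> patterns" for y
  proof (cases "y = z0 \<or> c y = 0")
    case False
    then have "y \<in> K" using y by (simp add: K_def)
    then have "pattern_weight y \<le> pattern_weight z0" unfolding z0(2) using K(1) by (intro Max_ge) auto
    then show ?thesis using basis_tensor_triangular[OF y z0p(1)] False by simp
  qed auto
  then have "(\<Sum>y\<in>patterns. c y * basis_tensor y (pattern_word z0))
      = (\<Sum>y\<in>patterns. if y = z0 then c z0 * basis_tensor z0 (pattern_word z0) else 0)"
    by (rule sum.cong[OF refl])
  also have "\<dots> = c z0 * basis_tensor z0 (pattern_word z0)" using z0p(1) finite_patterns by simp
  finally show False
    using sum[OF pattern_word_in_words[OF z0p(1)]] z0p(2) basis_tensor_diagonal[OF z0p(1)] by simp
qed

lemma combination_graph:
  "(\<Sum>z\<in>patterns. smul (c z) (basis_vector z), combination c) \<in> graph"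
proof -
  have "(\<Sum>z\<in>patterns. pair_scale (c z) (basis_vector z, basis_tensor z)) \<in> graph"
    unfolding graph_def
    by (intro pair.span_sum pair.span_scale) (rule basis_graph[unfolded graph_def])
  also have "(\<Sum>z\<in>patterns. pair_scale (c z) (basis_vector z, basis_tensor z))
      = (\<Sum>z\<in>patterns. smul (c z) (basis_vector z), combination c)"
    unfolding prod_eq_iff fst_sum snd_sum fst_conv snd_conv
    by (intro conjI refl ext) (rule sum_fun_apply)
  finally show ?thesis .
qed

lemma basis_vector_independent:
  assumes "(\<Sum>z\<in>patterns. smul (c z) (basis_vector z)) = 0" and z: "z \<in> patterns"
  shows "c z = 0"
proof (rule basis_tensor_independent[OF _ z])
  fix w
  have "combination c = 0"
    using graph_fst_zero combination_graph[of c] assms(1) by simp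
  from fun_cong[OF this, of w] show "combination c w = 0" by simp
qed

text \<open>The restrictions of the tensors to the standard words are independent and at least as many as
  the standard words, so by straightening the tensors span everything.\<close>

lemma basis_tensor_spans:
  assumes \<phi>: "\<phi> \<in> straight"
  shows "\<exists>c. \<forall>w. \<phi> w = combination c w"
proof -
  \<comment> \<open>Restriction to the standard words, extended by 0. Its values lie in the span of
    at most \<open>card standard_words\<close> delta functions.\<close>
  define r where "r \<psi> = (\<lambda>w. if w \<in> standard_words then \<psi> w else (0::complex))" for \<psi>
  define \<delta> where "\<delta> w = (\<lambda>u. if u = w then (1::complex) else 0)" for w :: "filling"
  let ?E = "\<delta> ` standard_words" and ?T = "(\<lambda>z. r (basis_tensor z)) ` patterns"
  have fin: "finite standard_words" by (rule finite_subset[OF _ finite_words]) (auto simp: standard_words_def)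
  have straight_comb: "combination c \<in> straight" for c
    using graph_snd_straight[OF combination_graph[of c]] by simp
  \<comment> \<open>Independence survives restriction, because a straight tensor that vanishes at
    all standard words is 0.\<close>
  have indep0: "c z = 0"
    if c: "\<And>w. (\<Sum>z\<in>patterns. c z * r (basis_tensor z) w) = 0" and z: "z \<in> patterns" for c z
  proof (rule basis_tensor_independent[OF _ z])
    fix w assume w: "w \<in> words"
    show "combination c w = 0"
    proof (rule straight_zero[OF straight_comb _ w])
      fix u assume "u \<in> standard_words"
      then show "combination c u = 0" using c[of u] by (simp add: r_def)
    qed
  qed
  have inj: "inj_on (\<lambda>z. r (basis_tensor z)) patterns"
  proof (rule inj_onI, rule ccontr)
    fix z1 z2 assume z: "z1 \<in> patterns" "z2 \<in> patterns" "r (basis_tensor z1) = r (basis_tensor z2)" "z1 \<noteq> z2"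
    let ?c = "\<lambda>z. if z = z1 then 1 else if z = z2 then - 1 else (0::complex)"
    have "?c z1 = 0"
    proof (rule indep0[where c = ?c, OF _ z(1)])
      fix w
      have "(\<Sum>z\<in>patterns. ?c z * r (basis_tensor z) w) = (\<Sum>z\<in>{z1, z2}. ?c z * r (basis_tensor z) w)"
        using finite_patterns z by (intro sum.mono_neutral_cong_right) auto
      also have "\<dots> = r (basis_tensor z1) w - r (basis_tensor z2) w" using z(4) by simp
      finally show "(\<Sum>z\<in>patterns. ?c z * r (basis_tensor z) w) = 0" using z(3) by simp
    qed
    then show False by simp
  qed
  have T_comb: "(\<Sum>t\<in>?T. (\<lambda>w. g t * t w)) = (\<lambda>w. \<Sum>z\<in>patterns. g (r (basis_tensor z)) * r (basis_tensor z) w)" for g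
    unfolding sum.reindex[OF inj] comp_def by (rule ext) (rule sum_fun_apply)
  have indepT: "tensor.independent ?T"
  proof (rule tensor.independent_if_scalars_zero)
    fix g t assume sum: "(\<Sum>t\<in>?T. (\<lambda>w. g t * t w)) = 0" and t: "t \<in> ?T"
    from t obtain z where z: "z \<in> patterns" "t = r (basis_tensor z)" by (rule imageE)
    have "g (r (basis_tensor z)) = 0"
    proof (rule indep0[where c = "\<lambda>z. g (r (basis_tensor z))", OF _ z(1)])
      fix w
      show "(\<Sum>z\<in>patterns. g (r (basis_tensor z)) * r (basis_tensor z) w) = 0"
        using fun_cong[OF sum[unfolded T_comb], of w] by (simp only: zero_fun_apply)
    qed
    then show "g t = 0" unfolding z(2) .
  qed (simp add: finite_patterns)
  have rE: "r \<psi> \<in> tensor.span ?E" for \<psi>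
  proof -
    have "r \<psi> = (\<Sum>w\<in>standard_words. (\<lambda>u. \<psi> w * \<delta> w u))"
    proof (rule ext)
      fix u
      have "(\<Sum>w\<in>standard_words. \<psi> w * \<delta> w u) = (\<Sum>w\<in>standard_words. if w = u then \<psi> w else 0)"
        by (intro sum.cong) (auto simp: \<delta>_def)
      then show "r \<psi> u = (\<Sum>w\<in>standard_words. (\<lambda>u. \<psi> w * \<delta> w u)) u"
        unfolding sum_fun_apply using fin by (simp add: r_def)
    qed
    also have "\<dots> \<in> tensor.span ?E"
      by (intro tensor.span_sum tensor.span_scale tensor.span_base) simp
    finally show ?thesis .
  qed
  have TE: "?T \<subseteq> tensor.span ?E" by (intro image_subsetI rE)
  have "r \<phi> \<in> tensor.span ?T"
  proof (rule ccontr)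
    \<comment> \<open>Adjoining the restriction of \<phi> would give more than
      \<open>card patterns\<close> independent vectors, hence more than there are delta functions
      spanning them.\<close>
    assume notin: "r \<phi> \<notin> tensor.span ?T"
    then have new: "r \<phi> \<notin> ?T" by (rule contrapos_nn) (rule tensor.span_base)
    have finT: "finite ?T" using finite_patterns by simp
    have "tensor.independent (insert (r \<phi>) ?T)"
      by (rule tensor.independent_insertI[OF notin indepT])
    moreover have "insert (r \<phi>) ?T \<subseteq> tensor.span ?E"
      unfolding insert_subset using rE TE by (rule conjI)
    ultimately have "finite (insert (r \<phi>) ?T) \<and> card (insert (r \<phi>) ?T) \<le> card ?E"
      by (rule tensor.independent_span_bound[OF finite_imageI[OF fin]])
    then have "card (insert (r \<phi>) ?T) \<le> card ?E" by (rule conjunct2)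
    also have "\<dots> \<le> card ?T"
      using card_image_le[OF fin, of \<delta>] card_standard_words_le card_image[OF inj] by linarith
    finally show False using card_insert_disjoint[OF finT new] by linarith
  qed
  then obtain g where g: "r \<phi> = (\<Sum>t\<in>?T. (\<lambda>w. g t * t w))"
    unfolding tensor.span_finite[OF finite_imageI[OF finite_patterns]] by (rule rangeE)
  define c where "c z = g (r (basis_tensor z))" for z
  have rc: "r \<phi> w = (\<Sum>z\<in>patterns. c z * r (basis_tensor z) w)" for w
    using fun_cong[OF g[unfolded T_comb], of w] by (simp add: c_def)
  let ?\<psi> = "\<phi> - combination c"
  have "?\<psi> \<in> straight"
    using tensor.subspace_diff[OF straight_subspace \<phi> straight_comb] .
  moreover have "?\<psi> w = 0" if "w \<in> standard_words" for w
    using rc[of w] that by (simp add: r_def)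
  ultimately have "?\<psi> w = 0" for w
    using straight_zero[of ?\<psi> w] straight_outside[of ?\<psi> w] by blast
  then show ?thesis by (intro exI[of _ c]) simp
qed

text \<open>A tensor paired with x is a combination of the basis tensors. Subtracting the same
  combination of pairs leaves a vector paired with 0, and such a vector is 0.\<close>

lemma basis_vector_spans: "\<exists>c. x = (\<Sum>z\<in>patterns. smul (c z) (basis_vector z))"
proof -
  obtain \<phi> where \<phi>: "(x, \<phi>) \<in> graph" using graph_total by blast
  obtain c where c: "\<And>w. \<phi> w = combination c w"
    using basis_tensor_spans[OF graph_snd_straight[OF \<phi>, simplified]] by blast
  have "(x, \<phi>) - (\<Sum>z\<in>patterns. smul (c z) (basis_vector z), combination c) \<in> graph"
    using \<phi> combination_graph[of c] unfolding graph_def by (rule pair.span_diff)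
  moreover have "\<phi> = combination c" using c by (rule ext)
  ultimately have "(x - (\<Sum>z\<in>patterns. smul (c z) (basis_vector z)), 0) \<in> graph" by simp
  from graph_snd_zero[OF this] show ?thesis by (intro exI[of _ c]) simp
qed

lemma inj_on_basis_vector: "inj_on basis_vector patterns"
proof (rule inj_onI, rule ccontr)
  fix z1 z2 assume z: "z1 \<in> patterns" "z2 \<in> patterns" "basis_vector z1 = basis_vector z2" "z1 \<noteq> z2"
  let ?c = "\<lambda>z. if z = z1 then 1 else if z = z2 then - 1 else (0::complex)"
  have "(\<Sum>z\<in>patterns. smul (?c z) (basis_vector z)) = (\<Sum>z\<in>{z1, z2}. smul (?c z) (basis_vector z))"
    using finite_patterns z by (intro sum.mono_neutral_cong_right) auto
  also have "\<dots> = 0" using z(3,4) by simp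
  finally have "?c z1 = 0" by (rule basis_vector_independent[where c = ?c, OF _ z(1)])
  then show False by simp
qed

lemma independent_basis_vectors: "independent (basis_vector ` patterns)"
proof (rule independent_if_scalars_zero)
  fix g t
  assume sum: "(\<Sum>t\<in>basis_vector ` patterns. smul (g t) t) = 0" and t: "t \<in> basis_vector ` patterns"
  from t obtain z where z: "z \<in> patterns" "t = basis_vector z" by (rule imageE)
  have "(\<Sum>z\<in>patterns. smul (g (basis_vector z)) (basis_vector z)) = 0"
    using sum unfolding sum.reindex[OF inj_on_basis_vector] comp_def .
  from basis_vector_independent[where c = "\<lambda>z. g (basis_vector z)", OF this z(1)]
  show "g t = 0" unfolding z(2) .
qed (simp add: finite_patterns)

lemma span_basis_vectors: "span (basis_vector ` patterns) = UNIV"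
proof -
  have "x \<in> span (basis_vector ` patterns)" for x
  proof -
    obtain c where "x = (\<Sum>z\<in>patterns. smul (c z) (basis_vector z))" using basis_vector_spans by blast
    then show ?thesis by (auto intro!: span_sum span_scale intro: span_base)
  qed
  then show ?thesis by blast
qed

end

theorem theorem2:
  fixes n :: nat
    and S :: "(nat \<times> nat) set"
    and a :: "nat \<Rightarrow> int"
    and f :: "nat \<Rightarrow> nat \<Rightarrow> complex mat"
    and smul :: "complex \<Rightarrow> 'v::ab_group_add \<Rightarrow> 'v"
    and act :: "complex mat \<Rightarrow> 'v \<Rightarrow> 'v"
    and v :: 'v
  assumes "n \<ge> 2"
    and "S \<subseteq> tri n" and "diag n \<subseteq> S"
    and "\<And>k. 1 \<le> k \<Longrightarrow> k \<le> n - 1 \<Longrightarrow> a k \<ge> 0"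
    and "\<And>i j. 1 \<le> i \<Longrightarrow> i < j \<Longrightarrow> j \<le> n \<Longrightarrow> root_vector n (- pos_root n i j) (f i j)"
    and "irreducible_sl_representation smul n act"
    and "highest_weight_vector smul n act a v"
  shows "inj_on (\<lambda>x. monomial_action n act f x v) (lattice_points (pipe_polytope n S a)) \<and>
    \<not> module.dependent smul
        ((\<lambda>x. monomial_action n act f x v) ` lattice_points (pipe_polytope n S a)) \<and>
    module.span smul
        ((\<lambda>x. monomial_action n act f x v) ` lattice_points (pipe_polytope n S a)) = UNIV"
proof -
  interpret irreducible_sl_representation smul n act by fact
  interpret pipe_module n S a smul act f v
    by unfold_locales (use assms in blast)+
  have image: "(\<lambda>x. monomial_action n act f x v) ` lattice_points (pipe_polytope n S a) = basis_vector ` patterns"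
    unfolding lattice_points_pipe_polytope image_image ..
  have "inj_on (\<lambda>x. monomial_action n act f x v) (pattern_point ` patterns)"
    using inj_on_basis_vector by (intro inj_on_imageI) (simp add: comp_def)
  then show ?thesis
    unfolding image using independent_basis_vectors span_basis_vectors
    by (simp add: lattice_points_pipe_polytope)
qed

end
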